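(* (1) The mapping $\Phi_+$ is a bijection between $\mathcal O$ and the set of properly bicolored mobiles of positive excess; for $O\in\mathcal O$, the outer degree of $O$ equals the excess of $\Phi_+(O)$. (2) The mapping $\Phi_-$ is a bijection between $\widetilde{\mathcal O}$ and the set of properly bicolored mobiles of negative excess; for $O\in\widetilde{\mathcal O}$, the outer degree of $O$ equals minus the excess of $\Phi_-(O)$.
   Context: A map is a connected finite graph (loops and multiple edges allowed) embedded in the oriented sphere up to orientation-preserving homeomorphism; a corner is the angular sector between two consecutive half-edges around a vertex; the degree of a face is its number of corners. A face-rooted map has a marked root-face; vertices and edges incident to it are outer; the outer degree is the degree of the root-face. An orientation assigns a direction to each edge. A directed path/circuit follows edge directions; a circuit is a simple closed directed path. In a face-rooted orientation a circuit is clockwise if the root-face is on its left, counterclockwise otherwise; the orientation is minimal if it has no counterclockwise circuit; it is clockwise-minimal if it is minimal and each outer edge has a non-root face on its right; it is accessible if every vertex can be reached by a directed path from some outer vertex. It is admissible if the root-face contour is a simple cycle and each outer vertex has indegree $1$. $\mathcal O$ is the set of clockwise-minimal accessible face-rooted orientations; $\widetilde{\mathcal O}$ is the set of admissible ones in $\mathcal O$ (their root-face contour is then a clockwise circuit). A properly bicolored mobile is a plane tree (a map with one face) with vertices colored black and white, every edge joining a black and a white vertex, where black vertices may carry dangling half-edges called buds; its excess is its number of edges minus its number of buds. Local transformation: let $e$ be an edge directed from $v'$ to $v$, with half-edges $h$ (at $v$) and $h'$ (at $v'$); let $c$, $c'$ be the corners preceding $h$, $h'$ in clockwise order around $v$,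 $v'$, contained in faces $f$, $f'$; a black vertex $b_g$ is placed in each face $g$. The local transformation of $e$ creates an edge joining $b_f$ to $v$ in the corner $c$, attaches a bud to $b_{f'}$ pointing toward the corner $c'$, and deletes $e$. For $O\in\mathcal O$ with root-face $f_0$: color the vertices of $O$ white, place a black vertex $b_f$ in each face $f$; $\Phi_+(O)$ is obtained by performing the local transformation of every edge and then deleting $b_{f_0}$ together with its incident buds. For $O\in\widetilde{\mathcal O}$: $\Phi_-(O)$ is obtained by first reversing the direction of every edge of the root-face contour, then performing the local transformation of every edge, and finally deleting $b_{f_0}$, the outer (white) vertices of $O$ and the edges between them. *)

theory Defs
  imports Main
begin

section \<open>Combinatorial maps (rotation systems)\<close>

text \<open>A map is encoded by its set of darts (half-edges), the edge involution
  alpha (fixed-point free) and the vertex rotation sigma, where sigma d is the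
  next half-edge after d in CLOCKWISE order around its vertex.  The corner
  "preceding d in clockwise order" is the sector between (sigma^-1 d) and d;
  we identify it with the dart d.  The face containing corner d is the orbit of
  d under phi = sigma o alpha (that face lies on the left of d, walking away
  from the vertex of d).  A face-rooted orientation additionally has a
  predicate head (head d means: the edge of d is directed towards the vertex
  of d) and a dart root whose face is the root-face.\<close>

record 'd fro =
  darts :: "'d set"
  alpha :: "'d \<Rightarrow> 'd"
  sigma :: "'d \<Rightarrow> 'd"
  head  :: "'d \<Rightarrow> bool"
  root  :: 'd

definition orb :: "('a \<Rightarrow> 'a) \<Rightarrow> 'a \<Rightarrow> 'a set" where
  "orb f x = {(f ^^ n) x | n. True}"

definition phi :: "'d fro \<Rightarrow> 'd \<Rightarrow> 'd" where
  "phi M = (\<lambda>d. sigma M (alpha M d))"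

definition phi_inv :: "'d fro \<Rightarrow> 'd \<Rightarrow> 'd" where
  "phi_inv M d = alpha M (inv_into (darts M) (sigma M) d)"

definition vert :: "'d fro \<Rightarrow> 'd \<Rightarrow> 'd set" where
  "vert M d = orb (sigma M) d"

definition face :: "'d fro \<Rightarrow> 'd \<Rightarrow> 'd set" where
  "face M d = orb (phi M) d"

definition root_face :: "'d fro \<Rightarrow> 'd set" where
  "root_face M = face M (root M)"

definition outer_degree :: "'d fro \<Rightarrow> nat" where
  "outer_degree M = card (root_face M)"

definition connected_darts :: "'d set \<Rightarrow> ('d \<Rightarrow> 'd) \<Rightarrow> ('d \<Rightarrow> 'd) \<Rightarrow> bool" where
  "connected_darts D a s \<longleftrightarrow>
     (\<forall>x\<in>D. \<forall>y\<in>D. (x, y) \<in> ({(d, a d) | d. d \<in> D} \<union> {(d, s d) | d. d \<in> D})\<^sup>*)"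

text \<open>A (planar) face-rooted orientation: a connected map on the sphere
  (Euler's formula V - E + F = 2) with at least one edge, an orientation of
  every edge, and a root dart.\<close>

definition is_fro :: "'d fro \<Rightarrow> bool" where
  "is_fro M \<longleftrightarrow>
     finite (darts M) \<and> darts M \<noteq> {} \<and>
     (\<forall>d\<in>darts M. alpha M d \<in> darts M \<and> alpha M (alpha M d) = d \<and> alpha M d \<noteq> d) \<and>
     bij_betw (sigma M) (darts M) (darts M) \<and>
     connected_darts (darts M) (alpha M) (sigma M) \<and>
     card (vert M ` darts M) + card (face M ` darts M) = card (darts M) div 2 + 2 \<and>
     (\<forall>d\<in>darts M. head M (alpha M d) \<longleftrightarrow> \<not> head M d) \<and>
     root M \<in> darts M"

subsection \<open>Directed paths, circuits, orientation properties\<close>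

text \<open>One directed step from the vertex of a tail dart t to the vertex of alpha t.\<close>
definition dstep :: "'d fro \<Rightarrow> ('d set \<times> 'd set) set" where
  "dstep M = {(vert M t, vert M (alpha M t)) | t. t \<in> darts M \<and> \<not> head M t}"

text \<open>A circuit (simple closed directed path), given by the list of the tail
  darts of its edges.\<close>
definition is_circuit :: "'d fro \<Rightarrow> 'd list \<Rightarrow> bool" where
  "is_circuit M ts \<longleftrightarrow>
     ts \<noteq> [] \<and> set ts \<subseteq> darts M \<and> (\<forall>t\<in>set ts. \<not> head M t) \<and>
     distinct (map (vert M) ts) \<and>
     (\<forall>i<length ts. vert M (alpha M (ts ! i)) = vert M (ts ! ((i + 1) mod length ts)))"

text \<open>Dual connectivity not crossing the edges of the circuit: the faces
  reachable from the face on the left of the first edge are exactly the faces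
  on the left of the circuit.\<close>
definition left_step :: "'d fro \<Rightarrow> 'd list \<Rightarrow> ('d \<times> 'd) set" where
  "left_step M ts =
     {(x, phi M x) | x. x \<in> darts M} \<union> {(phi M x, x) | x. x \<in> darts M} \<union>
     {(x, alpha M x) | x. x \<in> darts M \<and> x \<notin> set ts \<and> alpha M x \<notin> set ts}"

definition clockwise :: "'d fro \<Rightarrow> 'd list \<Rightarrow> bool" where
  "clockwise M ts \<longleftrightarrow> (hd ts, root M) \<in> (left_step M ts)\<^sup>*"

definition minimal :: "'d fro \<Rightarrow> bool" where
  "minimal M \<longleftrightarrow> (\<forall>ts. is_circuit M ts \<longrightarrow> clockwise M ts)"

text \<open>The face on the right of an edge with head dart h is the face of h.\<close>
definition cw_minimal :: "'d fro \<Rightarrow> bool" where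
  "cw_minimal M \<longleftrightarrow> minimal M \<and>
     (\<forall>h\<in>darts M. head M h \<and> (h \<in> root_face M \<or> alpha M h \<in> root_face M)
        \<longrightarrow> h \<notin> root_face M)"

definition accessible :: "'d fro \<Rightarrow> bool" where
  "accessible M \<longleftrightarrow>
     (\<forall>d\<in>darts M. \<exists>r\<in>root_face M. (vert M r, vert M d) \<in> (dstep M)\<^sup>*)"

definition indegree :: "'d fro \<Rightarrow> 'd set \<Rightarrow> nat" where
  "indegree M v = card {h \<in> darts M. head M h \<and> vert M h = v}"

definition admissible :: "'d fro \<Rightarrow> bool" where
  "admissible M \<longleftrightarrow>
     (\<forall>x\<in>root_face M. \<forall>y\<in>root_face M. x \<noteq> y \<longrightarrow> vert M x \<noteq> vert M y) \<and>
     (\<forall>x\<in>root_face M. alpha M x \<notin> root_face M) \<and>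
     (\<forall>x\<in>root_face M. indegree M (vert M x) = 1)"

definition calO :: "'d fro set" where
  "calO = {M. is_fro M \<and> cw_minimal M \<and> accessible M}"

definition calO_adm :: "'d fro set" where
  "calO_adm = {M. M \<in> calO \<and> admissible M}"

definition fro_iso :: "'d fro \<Rightarrow> 'e fro \<Rightarrow> bool" where
  "fro_iso M1 M2 \<longleftrightarrow> (\<exists>g. bij_betw g (darts M1) (darts M2) \<and>
     (\<forall>d\<in>darts M1. g (alpha M1 d) = alpha M2 (g d) \<and> g (sigma M1 d) = sigma M2 (g d) \<and>
                    head M2 (g d) = head M1 d) \<and>
     g (root M1) \<in> root_face M2)"

section \<open>Mobiles\<close>

text \<open>A mobile is a plane tree given by darts, an involution alpha whose fixed
  points are the buds, a clockwise rotation sigma, and a colouring of darts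
  (the colour of the vertex they belong to; True = white).\<close>

record 'm mobile =
  mdarts :: "'m set"
  malpha :: "'m \<Rightarrow> 'm"
  msigma :: "'m \<Rightarrow> 'm"
  mwhite :: "'m \<Rightarrow> bool"

definition num_edges :: "'m mobile \<Rightarrow> nat" where
  "num_edges T = card {d \<in> mdarts T. malpha T d \<noteq> d} div 2"

definition num_buds :: "'m mobile \<Rightarrow> nat" where
  "num_buds T = card {d \<in> mdarts T. malpha T d = d}"

definition excess :: "'m mobile \<Rightarrow> int" where
  "excess T = int (num_edges T) - int (num_buds T)"

definition is_pb_mobile :: "'m mobile \<Rightarrow> bool" where
  "is_pb_mobile T \<longleftrightarrow>
     finite (mdarts T) \<and>
     (\<forall>d\<in>mdarts T. malpha T d \<in> mdarts T \<and> malpha T (malpha T d) = d) \<and>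
     bij_betw (msigma T) (mdarts T) (mdarts T) \<and>
     connected_darts (mdarts T) (malpha T) (msigma T) \<and>
     card (orb (msigma T) ` mdarts T) = num_edges T + 1 \<and>
     (\<forall>d\<in>mdarts T. mwhite T (msigma T d) = mwhite T d) \<and>
     (\<forall>d\<in>mdarts T. malpha T d \<noteq> d \<longrightarrow> mwhite T (malpha T d) \<noteq> mwhite T d) \<and>
     (\<forall>d\<in>mdarts T. malpha T d = d \<longrightarrow> \<not> mwhite T d)"

definition mobile_iso :: "'m mobile \<Rightarrow> 'n mobile \<Rightarrow> bool" where
  "mobile_iso T1 T2 \<longleftrightarrow> (\<exists>g. bij_betw g (mdarts T1) (mdarts T2) \<and>
     (\<forall>d\<in>mdarts T1. g (malpha T1 d) = malpha T2 (g d) \<and> g (msigma T1 d) = msigma T2 (g d) \<and>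
                     mwhite T2 (g d) = mwhite T1 d))"

section \<open>The constructions Phi_+ and Phi_-\<close>

definition next_in :: "('a \<Rightarrow> bool) \<Rightarrow> ('a \<Rightarrow> 'a) \<Rightarrow> 'a \<Rightarrow> 'a" where
  "next_in P f x = (f ^^ (LEAST k. 0 < k \<and> P ((f ^^ k) x))) x"

text \<open>Generic construction: perform the local transformation of every edge
  w.r.t. the orientation hd, delete the black vertex of the root-face and the
  white vertices in delV (with all incident edges).
  Mobile darts: (h, True) is the white half-edge of the new edge created in
  the corner h (h a head dart); (d, False) is the black half-edge at b_f
  (f the face of corner d): an edge half if d is a head dart, a bud if d is a
  tail dart.  Around b_f the corners of f occur clockwise in phi^-1 order.\<close>
definition local_transform :: "'d fro \<Rightarrow> ('d \<Rightarrow> bool) \<Rightarrow> 'd set set \<Rightarrow> ('d \<times> bool) mobile" where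
  "local_transform M hdd delV =
    (let R = root_face M;
         PB = (\<lambda>d. d \<in> darts M \<and> d \<notin> R \<and> (hdd d \<longrightarrow> vert M d \<notin> delV));
         PW = (\<lambda>d. d \<in> darts M \<and> hdd d \<and> vert M d \<notin> delV)
     in \<lparr> mdarts = {(h, True) | h. PW h} \<union> {(d, False) | d. PB d},
          malpha = (\<lambda>(d, b). if b then (d, False) else if hdd d then (d, True) else (d, False)),
          msigma = (\<lambda>(d, b). if b then (next_in PW (sigma M) d, True)
                                  else (next_in PB (phi_inv M) d, False)),
          mwhite = (\<lambda>(d, b). b) \<rparr>)"

definition Phi_plus :: "'d fro \<Rightarrow> ('d \<times> bool) mobile" where
  "Phi_plus M = local_transform M (head M) {}"

definition Phi_minus :: "'d fro \<Rightarrow> ('d \<times> bool) mobile" where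
  "Phi_minus M = local_transform M
     (\<lambda>d. if d \<in> root_face M \<or> alpha M d \<in> root_face M then \<not> head M d else head M d)
     (vert M ` root_face M)"

end

theory Submission
  imports Defs
begin

(*
  Write phi for the permutation of the darts walking around faces, so that sigma = phi o alpha. By
  Euler's relation, two darts t and alpha t which are joined in the dual map without crossing a set of
  edges lie in the same orbit of the permutation walking around the contraction of these edges; this is
  the only form of planarity that is used. It shows that circuits separate, hence that minimality means
  that every face can be reached from the root face by crossing edges from left to right. With
  accessibility, it also shows that a walk through tails off the root face, which moves by sigma or by
  phi, never closes up. Induction along these walks proves that the mobile is connected (thus a tree, by
  Euler's relation) and that the partner of every bud can be recovered from the mobile.

  Conversely, edges and buds met along the contour of the tree form a parenthesis word. Matching buds
  with edges and joining the unmatched edges to new tails defines sigma = phi o alpha; Euler's inequality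
  forces the new tails to form one face. Every tail is reached from the root face through tails by sigma
  and phi, which yields accessibility and minimality.

  In the admissible case, the outer vertices are leaves of Phi_+(O) attached by the unmatched edges, and
  Phi_-(O) arises from Phi_+(O) by replacing these leaves by buds.
*)

section \<open>Permutations of finite sets and equivalence closures\<close>

text \<open>No Jordan curve is used. \<open>genus2\<close> is the Euler defect of the map with only
  some of its edges kept. It is 0 without edges, never drops when an edge is added, and rises when
  the added edge joins two cycles inside one component. If the full map has defect 0, such a merger
  is impossible at every stage; this is \<open>planar_separation\<close>. The obstacle to inverting
  the construction is that the mobile forgets where a bud points. The partner of a tail is
  determined by what its at most two children see, so well-foundedness of \<open>child\<close> turns
  recovery into an induction. For existence, the scarcer symbol must open the parentheses: buds for
  positive excess, edges for negative excess. The contour is read in opposite directions in the two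
  cases, and so both matchings fit one locale, \<open>closure\<close>, in which the block length is
  the rank used to prove accessibility.\<close>

lemma orb_self [simp]: "x \<in> orb f x"
  unfolding orb_def by (rule CollectI, rule exI[of _ 0]) simp

lemma orb_step: "y \<in> orb f x \<Longrightarrow> f y \<in> orb f x"
  unfolding orb_def
proof clarsimp
  fix n show "\<exists>m. f ((f ^^ n) x) = (f ^^ m) x" by (rule exI[of _ "Suc n"]) simp
qed

lemma orb_subset:
  assumes "x \<in> A" "\<And>y. y \<in> A \<Longrightarrow> f y \<in> A"
  shows "orb f x \<subseteq> A"
proof
  fix y assume "y \<in> orb f x"
  then obtain n where "y = (f ^^ n) x" by (auto simp: orb_def)
  moreover have "(f ^^ n) x \<in> A" by (induction n) (auto simp: assms)
  ultimately show "y \<in> A" by simp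
qed

lemma orb_subset_orb: "y \<in> orb f x \<Longrightarrow> orb f y \<subseteq> orb f x"
  by (rule orb_subset) (auto intro: orb_step)

lemma funpow_in_orb [simp]: "(f ^^ n) x \<in> orb f x"
  by (auto simp: orb_def)

lemma funpow_closed:
  assumes "bij_betw f D D" "x \<in> D" shows "(f ^^ n) x \<in> D"
  by (induction n) (use assms in \<open>auto dest: bij_betwE\<close>)

lemma orb_closed: "bij_betw f D D \<Longrightarrow> x \<in> D \<Longrightarrow> orb f x \<subseteq> D"
  by (auto simp: orb_def dest: funpow_closed)

lemma funpow_inj:
  assumes "bij_betw f D D" "x \<in> D" "y \<in> D" "(f ^^ n) x = (f ^^ n) y"
  shows "x = y"
  using assms(4)
proof (induction n)
  case (Suc n)
  then have "f ((f ^^ n) x) = f ((f ^^ n) y)" by simp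
  moreover have "(f ^^ n) x \<in> D" "(f ^^ n) y \<in> D" using funpow_closed assms by metis+
  ultimately show ?case using Suc.IH assms(1) by (metis bij_betw_inv_into_left)
qed simp

lemma funpow_return:
  assumes "finite D" "bij_betw f D D" "x \<in> D"
  obtains k where "k > 0" "(f ^^ k) x = x"
proof -
  have "\<not> inj_on (\<lambda>k. (f ^^ k) x) {..card D}"
  proof
    assume i: "inj_on (\<lambda>k. (f ^^ k) x) {..card D}"
    have "(\<lambda>k. (f ^^ k) x) ` {..card D} \<subseteq> D" using funpow_closed assms by fast
    then have "card {..card D} \<le> card D" using card_inj_on_le[OF i _ assms(1)] by blast
    then show False by simp
  qed
  then obtain i j where ij: "i < j" "(f ^^ i) x = (f ^^ j) x"
    unfolding inj_on_def by (metis linorder_neqE_nat)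
  have "(f ^^ i) x = (f ^^ i) ((f ^^ (j - i)) x)"
    using ij by (simp flip: funpow_add[THEN fun_cong, unfolded comp_def])
  then have "(f ^^ (j - i)) x = x"
    using funpow_inj[OF assms(2)] assms(3) funpow_closed[OF assms(2,3)] by metis
  then show ?thesis using ij(1) that[of "j - i"] by simp
qed

text \<open>On a finite set the inverse of a permutation is a power of it at each point. Hence
  orbits, although defined by forward iteration only, are equivalence classes.\<close>

lemma orb_sym:
  assumes "finite D" "bij_betw f D D" "x \<in> D" "y \<in> orb f x"
  shows "x \<in> orb f y"
proof -
  obtain n where n: "y = (f ^^ n) x" using assms(4) by (auto simp: orb_def)
  obtain k where k: "k > 0" "(f ^^ k) x = x" using funpow_return assms by metis
  have "(f ^^ (k * m)) x = x" for m
    by (induction m) (auto simp: k funpow_add)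
  \<comment> \<open>As \<open>k\<close> is at least 1, another \<open>k * n - n\<close> steps after
    \<open>n\<close> steps complete \<open>n\<close> full periods.\<close>
  then have "x = (f ^^ (k * n - n)) y"
    using k(1) unfolding n by (simp flip: funpow_add[THEN fun_cong, unfolded comp_def])
  then show ?thesis by (auto simp: orb_def)
qed

lemma orb_eq:
  assumes "finite D" "bij_betw f D D" "x \<in> D" "y \<in> orb f x"
  shows "orb f y = orb f x"
  using orb_sym[OF assms] assms(4) orb_subset_orb by (metis subset_antisym)

lemma orb_eq_iff:
  assumes "finite D" "bij_betw f D D" "x \<in> D"
  shows "orb f y = orb f x \<longleftrightarrow> y \<in> orb f x"
  using orb_eq[OF assms] orb_self by metis

lemma orb_preimage:
  assumes "finite D" "bij_betw f D D" "x \<in> D"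
  shows "\<exists>y \<in> orb f x. f y = x"
proof -
  obtain k where k: "k > 0" "(f ^^ k) x = x" using funpow_return assms by metis
  then have "f ((f ^^ (k - 1)) x) = x" by (cases k) auto
  then show ?thesis using funpow_in_orb by metis
qed

section \<open>Equivalence closures and the number of their classes\<close>

definition eqv :: "('a \<times> 'a) set \<Rightarrow> ('a \<times> 'a) set" where
  "eqv S = (S \<union> S\<inverse>)\<^sup>*"

definition gr :: "('a \<Rightarrow> 'a) \<Rightarrow> 'a set \<Rightarrow> ('a \<times> 'a) set" where
  "gr f D = {(x, f x) | x. x \<in> D}"

definition ncl :: "'a set \<Rightarrow> ('a \<times> 'a) set \<Rightarrow> nat" where
  "ncl D S = card ((\<lambda>x. eqv S `` {x}) ` D)"

lemma gr_I [intro]: "x \<in> D \<Longrightarrow> (x, f x) \<in> gr f D"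
  by (auto simp: gr_def)

lemma eqv_refl [simp]: "(x, x) \<in> eqv S"
  by (simp add: eqv_def)

lemma eqv_sym: "(x, y) \<in> eqv S \<Longrightarrow> (y, x) \<in> eqv S"
  unfolding eqv_def
  by (metis converse_Un converse_converse rtrancl_converseD sup_commute)

lemma eqv_trans: "(x, y) \<in> eqv S \<Longrightarrow> (y, z) \<in> eqv S \<Longrightarrow> (x, z) \<in> eqv S"
  unfolding eqv_def by (rule rtrancl_trans)

lemma eqv_base: "(x, y) \<in> S \<Longrightarrow> (x, y) \<in> eqv S"
  unfolding eqv_def by auto

lemma eqv_least:
  assumes "\<And>x y. (x, y) \<in> S \<Longrightarrow> (x, y) \<in> eqv S'" shows "eqv S \<subseteq> eqv S'"
proof
  fix p assume "p \<in> eqv S"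
  then obtain x y where p: "p = (x, y)" "(x, y) \<in> (S \<union> S\<inverse>)\<^sup>*" by (cases p) (auto simp: eqv_def)
  from p(2) have "(x, y) \<in> eqv S'"
  proof (induction)
    case (step y z)
    then have "(y, z) \<in> eqv S'" using assms eqv_sym by (metis UnE converseE Pair_inject)
    then show ?case using step.IH eqv_trans by metis
  qed simp
  then show "p \<in> eqv S'" using p by simp
qed

lemma eqv_mono: "S \<subseteq> S' \<Longrightarrow> eqv S \<subseteq> eqv S'"
  by (rule eqv_least) (auto intro: eqv_base)

lemma eqv_eqI:
  assumes "\<And>x y. (x, y) \<in> S \<Longrightarrow> (x, y) \<in> eqv S'" "\<And>x y. (x, y) \<in> S' \<Longrightarrow> (x, y) \<in> eqv S"
  shows "eqv S = eqv S'"
  using eqv_least[of S S'] eqv_least[of S' S] assms by blast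

lemma eqv_closed:
  assumes "(x, y) \<in> eqv S" "x \<in> A" "\<And>u v. (u, v) \<in> S \<Longrightarrow> u \<in> A \<longleftrightarrow> v \<in> A"
  shows "y \<in> A"
  using assms(1) unfolding eqv_def
  by (induction) (use assms in auto)

lemma eqv_class_eq: "eqv S `` {x} = eqv S `` {y} \<longleftrightarrow> (x, y) \<in> eqv S"
proof
  assume "eqv S `` {x} = eqv S `` {y}"
  then show "(x, y) \<in> eqv S" using eqv_refl[of y S] by blast
next
  assume "(x, y) \<in> eqv S"
  then show "eqv S `` {x} = eqv S `` {y}" using eqv_sym[of _ _ S] eqv_trans[of _ _ S] by blast
qed

lemma funpow_eqv:
  assumes "bij_betw f D D" "x \<in> D"
  shows "(x, (f ^^ n) x) \<in> eqv (gr f D)"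
proof (induction n)
  case (Suc n)
  have "((f ^^ n) x, f ((f ^^ n) x)) \<in> eqv (gr f D)"
    by (intro eqv_base gr_I funpow_closed assms)
  then show ?case using Suc eqv_trans by fastforce
qed simp

lemma eqv_gr:
  assumes "finite D" "bij_betw f D D" "x \<in> D"
  shows "eqv (gr f D) `` {x} = orb f x"
proof
  show "orb f x \<subseteq> eqv (gr f D) `` {x}"
    using funpow_eqv[OF assms(2,3)] by (auto simp: orb_def)
  show "eqv (gr f D) `` {x} \<subseteq> orb f x"
  proof clarify
    fix y assume "(x, y) \<in> eqv (gr f D)"
    then show "y \<in> orb f x"
    proof (rule eqv_closed)
      fix u v assume "(u, v) \<in> gr f D"
      then have uv: "v = f u" "u \<in> D" by (auto simp: gr_def)
      show "u \<in> orb f x \<longleftrightarrow> v \<in> orb f x"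
      proof
        assume "v \<in> orb f x"
        moreover have "u \<in> orb f v"
          unfolding uv(1) by (rule orb_sym[OF assms(1,2) uv(2) orb_step[OF orb_self]])
        ultimately show "u \<in> orb f x" using orb_subset_orb[of v f x] by blast
      next
        assume "u \<in> orb f x"
        then show "v \<in> orb f x" unfolding uv(1) by (rule orb_step)
      qed
    qed simp
  qed
qed

lemma ncl_gr:
  assumes "finite D" "bij_betw f D D"
  shows "ncl D (gr f D) = card (orb f ` D)"
proof -
  have "(\<lambda>x. eqv (gr f D) `` {x}) ` D = orb f ` D"
    by (rule image_cong) (auto simp: eqv_gr[OF assms])
  then show ?thesis by (simp add: ncl_def)
qed

lemma eqv_insert:
  "eqv (insert (a, b) S) `` {x} =
    (if x \<in> eqv S `` {a} \<union> eqv S `` {b} then eqv S `` {a} \<union> eqv S `` {b} else eqv S `` {x})"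
proof -
  let ?C = "eqv S `` {a} \<union> eqv S `` {b}"
  have cl: "(u \<in> ?C) = (v \<in> ?C)" if "(u, v) \<in> insert (a, b) S" for u v
  proof (cases "(u, v) \<in> S")
    case True
    then show ?thesis using eqv_base[of u v S] eqv_sym[of _ _ S] eqv_trans[of _ _ S] by blast
  next
    case False
    then have "u = a" "v = b" using that by auto
    then show ?thesis by simp
  qed
  have sub: "eqv S \<subseteq> eqv (insert (a, b) S)" by (rule eqv_mono) auto
  have ab: "(a, b) \<in> eqv (insert (a, b) S)" by (rule eqv_base) simp
  show ?thesis
  proof (cases "x \<in> ?C")
    case True
    have "eqv (insert (a, b) S) `` {x} \<subseteq> ?C"
    proof
      fix y assume "y \<in> eqv (insert (a, b) S) `` {x}"
      then have "(x, y) \<in> eqv (insert (a, b) S)" by simp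
      then show "y \<in> ?C" by (rule eqv_closed[OF _ True cl])
    qed
    moreover have "?C \<subseteq> eqv (insert (a, b) S) `` {x}"
    proof -
      note tr = eqv_trans[of _ _ "insert (a, b) S"] and sy = eqv_sym[of _ _ "insert (a, b) S"]
      have "(a, x) \<in> eqv (insert (a, b) S)" using True sub ab tr by blast
      then have "(x, a) \<in> eqv (insert (a, b) S)" by (rule sy)
      moreover have "(x, b) \<in> eqv (insert (a, b) S)" using calculation ab by (rule tr)
      ultimately show ?thesis using sub tr by blast
    qed
    ultimately show ?thesis using True by auto
  next
    case False
    have "eqv (insert (a, b) S) `` {x} \<subseteq> eqv S `` {x}"
    proof clarify
      fix y assume xy: "(x, y) \<in> eqv (insert (a, b) S)"
      have "y \<in> eqv S `` {x}"
      proof (rule eqv_closed[OF xy])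
        fix u v assume uv: "(u, v) \<in> insert (a, b) S"
        show "(u \<in> eqv S `` {x}) = (v \<in> eqv S `` {x})"
        proof (cases "(u, v) \<in> S")
          case True
          then show ?thesis using eqv_base[of u v S] eqv_sym[of _ _ S] eqv_trans[of _ _ S] by blast
        next
          case F: False
          then have "u = a" "v = b" using uv by auto
          then show ?thesis using False eqv_sym[of _ _ S] by blast
        qed
      qed simp
      then show "(x, y) \<in> eqv S" by simp
    qed
    then show ?thesis using False sub by auto
  qed
qed

lemma eqv_insert_same:
  assumes "(a, b) \<in> eqv S" shows "eqv (insert (a, b) S) = eqv S"
  by (rule eqv_eqI) (use assms in \<open>auto intro: eqv_base\<close>)

lemma ncl_insert:
  assumes "finite D" "a \<in> D" "b \<in> D" "(a, b) \<notin> eqv S"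
  shows "ncl D (insert (a, b) S) + 1 = ncl D S"
proof -
  define c where "c x = eqv S `` {x}" for x
  define P where "P = c ` D"
  have eq: "(\<lambda>x. eqv (insert (a, b) S) `` {x}) ` D = insert (c a \<union> c b) (P - {c a, c b})"
  proof -
    have "x \<in> c a \<union> c b \<longleftrightarrow> c x = c a \<or> c x = c b" for x
      unfolding c_def eqv_class_eq using eqv_sym[of _ _ S] by blast
    then show ?thesis
      unfolding eqv_insert P_def c_def[symmetric] using assms(2,3) by auto
  qed
  have ne: "c a \<noteq> c b" using assms(4) eqv_class_eq unfolding c_def by metis
  have "c a \<union> c b \<notin> P - {c a, c b}"
  proof
    assume "c a \<union> c b \<in> P - {c a, c b}"
    then have "c a \<union> c b \<in> c ` D" "c a \<union> c b \<noteq> c a" unfolding P_def by simp_all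
    then obtain x where x: "c a \<union> c b = c x" "c x \<noteq> c a" by (metis imageE)
    have "a \<in> c a" by (simp add: c_def)
    then have "a \<in> c x" using x(1) by blast
    then have "c x = c a" unfolding c_def eqv_class_eq by simp
    then show False using x(2) by simp
  qed
  moreover have P: "finite P" "{c a, c b} \<subseteq> P" using assms by (auto simp: P_def)
  ultimately have "card (insert (c a \<union> c b) (P - {c a, c b})) = Suc (card P - card {c a, c b})"
    by (simp add: card_Diff_subset)
  moreover have "card {c a, c b} = 2" "card {c a, c b} \<le> card P"
    using ne card_mono[OF P] by auto
  ultimately show ?thesis
    unfolding ncl_def eq unfolding P_def c_def by linarith
qed

lemma ncl_insert_le:
  assumes "finite D" "a \<in> D" "b \<in> D"
  shows "ncl D (insert (a, b) S) \<le> ncl D S" "ncl D S \<le> ncl D (insert (a, b) S) + 1"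
proof -
  have "ncl D (insert (a, b) S) = ncl D S" if "(a, b) \<in> eqv S"
    using eqv_insert_same[OF that] by (simp add: ncl_def)
  then show "ncl D (insert (a, b) S) \<le> ncl D S" "ncl D S \<le> ncl D (insert (a, b) S) + 1"
    using ncl_insert[OF assms, of S] by fastforce+
qed

section \<open>Genus of partial maps\<close>

lemma bij_betw_involution:
  assumes "\<And>d. d \<in> D \<Longrightarrow> f d \<in> D \<and> f (f d) = d"
  shows "bij_betw f D D"
  by (rule bij_betw_byWitness[where f' = f]) (use assms in auto)

text \<open>Here \<open>p'\<close> is \<open>p\<close> composed with the transposition of
  \<open>a\<close> and \<open>b\<close>. Once \<open>a\<close> and \<open>b\<close> are identified,
  exchanging their images changes no class.\<close>

lemma transp_eqv:
  assumes ab: "a \<in> D" "b \<in> D"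
    and p: "p' a = p b" "p' b = p a" "\<And>x. x \<noteq> a \<Longrightarrow> x \<noteq> b \<Longrightarrow> p' x = p x"
  shows "eqv (insert (a, b) (gr p' D)) = eqv (insert (a, b) (gr p D))"
proof -
  \<comment> \<open>The hypotheses are symmetric in \<open>p\<close> and \<open>p'\<close>, so one
    inclusion, stated for arbitrary permutations, gives both.\<close>
  have "eqv (insert (a, b) (gr p D)) \<subseteq> eqv (insert (a, b) (gr p' D))"
    if ab: "a \<in> D" "b \<in> D"
      and p: "p' a = p b" "p' b = p a" "\<And>x. x \<noteq> a \<Longrightarrow> x \<noteq> b \<Longrightarrow> p' x = p x" for p p'
  proof (rule eqv_least)
    let ?S = "insert (a, b) (gr p' D)"
    fix x y assume xy: "(x, y) \<in> insert (a, b) (gr p D)"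
    have 1: "(a, b) \<in> eqv ?S" by (rule eqv_base) simp
    have 2: "(b, a) \<in> eqv ?S" by (rule eqv_sym[OF 1])
    have 3: "(z, p' z) \<in> eqv ?S" if "z \<in> D" for z
      by (rule eqv_base) (use that in auto)
    consider "x = a" "y = b" | "x = a" "y = p' b" | "x = b" "y = p' a" | "x \<in> D" "y = p' x"
    proof -
      assume h: "x = a \<Longrightarrow> y = b \<Longrightarrow> thesis" "x = a \<Longrightarrow> y = p' b \<Longrightarrow> thesis"
        "x = b \<Longrightarrow> y = p' a \<Longrightarrow> thesis" "x \<in> D \<Longrightarrow> y = p' x \<Longrightarrow> thesis"
      have "x = a \<and> y = b \<or> x \<in> D \<and> y = p x" using xy by (auto simp: gr_def)
      then show thesis
      proof
        assume x: "x \<in> D \<and> y = p x"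
        consider "x = a" | "x = b" | "x \<noteq> a" "x \<noteq> b" by blast
        then show thesis
        proof cases
          case 1 then show thesis using h(2) p(2) x by metis
        next
          case 2 then show thesis using h(3) p(1) x by metis
        next
          case 3 then show thesis using h(4) p(3)[OF 3] x by metis
        qed
      qed (use h(1) in blast)
    qed
    then show "(x, y) \<in> eqv ?S"
    proof cases
      case c: 2 then show ?thesis using eqv_trans[OF 1 3[OF ab(2)]] by simp
    next
      case c: 3 then show ?thesis using eqv_trans[OF 2 3[OF ab(1)]] by simp
    qed (use 1 3 in simp_all)
  qed
  from this[of p' p] this[of p p'] show ?thesis using assms by (intro subset_antisym) simp_all
qed

text \<open>From \<open>b\<close>, the map \<open>p'\<close> jumps to \<open>p a\<close> and then
  follows the \<open>p\<close>-cycle of \<open>a\<close>. That cycle avoids \<open>b\<close>, so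
  nothing disturbs the walk before it returns to \<open>a\<close>.\<close>

lemma transp_merge:
  assumes fin: "finite D" and bij: "bij_betw p D D" and ab: "a \<in> D" "b \<in> D"
    and p: "p' b = p a" "\<And>x. x \<noteq> a \<Longrightarrow> x \<noteq> b \<Longrightarrow> p' x = p x"
    and ne: "b \<notin> orb p a"
  shows "a \<in> orb p' b"
proof -
  obtain k where k: "k > 0" "(p ^^ k) a = a" using funpow_return[OF fin bij ab(1)] by metis
  define m where "m = (LEAST k. k > 0 \<and> (p ^^ k) a = a)"
  have m: "m > 0" "(p ^^ m) a = a" using LeastI[of "\<lambda>k. k > 0 \<and> (p ^^ k) a = a", OF conjI, OF k] by (auto simp: m_def)
  have less: "(p ^^ j) a \<noteq> a" if "0 < j" "j < m" for j
    using not_less_Least[of j "\<lambda>k. k > 0 \<and> (p ^^ k) a = a"] that by (auto simp: m_def)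
  have "(p' ^^ j) b = (p ^^ j) a" if "0 < j" "j \<le> m" for j
    using that
  proof (induction j)
    case (Suc j)
    show ?case
    proof (cases "j = 0")
      case False
      then have "(p' ^^ j) b = (p ^^ j) a" using Suc by simp
      moreover have "(p ^^ j) a \<noteq> a" using less False Suc.prems by simp
      moreover have "(p ^^ j) a \<noteq> b" using ne funpow_in_orb by metis
      ultimately show ?thesis using p(2) by simp
    qed (simp add: p)
  qed simp
  from this[of m] have "(p' ^^ m) b = a" using m by simp
  then show ?thesis using funpow_in_orb by metis
qed

text \<open>After \<open>a\<close> and \<open>b\<close> are identified both permutations have the
  same classes, and one identification costs at most one class. If \<open>a\<close> and
  \<open>b\<close> lie on different cycles of \<open>p\<close>, it costs one class for
  \<open>p\<close> and none for \<open>p'\<close>.\<close>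

lemma transp_card_orb:
  assumes fin: "finite D" and bij: "bij_betw p D D" "bij_betw p' D D" and ab: "a \<in> D" "b \<in> D"
    and p: "p' a = p b" "p' b = p a" "\<And>x. x \<noteq> a \<Longrightarrow> x \<noteq> b \<Longrightarrow> p' x = p x"
  shows "card (orb p' ` D) \<le> card (orb p ` D) + 1"
    and "b \<notin> orb p a \<Longrightarrow> card (orb p' ` D) + 1 = card (orb p ` D)"
proof -
  have e: "ncl D (insert (a, b) (gr p' D)) = ncl D (insert (a, b) (gr p D))"
    unfolding ncl_def using transp_eqv[OF ab, of p' p] p by simp
  note n = ncl_gr[OF fin bij(1)] ncl_gr[OF fin bij(2)]
  show "card (orb p' ` D) \<le> card (orb p ` D) + 1"
    using ncl_insert_le[OF fin ab, of "gr p D"] ncl_insert_le[OF fin ab, of "gr p' D"] e n by linarith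
  assume ne: "b \<notin> orb p a"
  have "a \<in> orb p' b" by (rule transp_merge[OF fin bij(1) ab p(2,3) ne])
  then have "(b, a) \<in> eqv (gr p' D)" using eqv_gr[OF fin bij(2) ab(2)] by blast
  then have "(a, b) \<in> eqv (gr p' D)" by (rule eqv_sym)
  then have "ncl D (insert (a, b) (gr p' D)) = ncl D (gr p' D)"
    using eqv_insert_same by (metis ncl_def)
  moreover have "(a, b) \<notin> eqv (gr p D)" using ne eqv_gr[OF fin bij(1) ab(1)] by blast
  then have "ncl D (insert (a, b) (gr p D)) + 1 = ncl D (gr p D)" by (rule ncl_insert[OF fin ab])
  ultimately show "card (orb p' ` D) + 1 = card (orb p ` D)" using e n by linarith
qed

definition restr :: "'a set \<Rightarrow> ('a \<Rightarrow> 'a) \<Rightarrow> 'a \<Rightarrow> 'a" where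
  "restr C f = (\<lambda>x. if x \<in> C then f x else x)"

text \<open>Twice the genus of the map with face permutation \<open>f\<close> in which only the edges with darts in
  \<open>C\<close> are kept, the other edges being replaced by pairs of buds.\<close>

definition genus2 :: "'a set \<Rightarrow> ('a \<Rightarrow> 'a) \<Rightarrow> ('a \<Rightarrow> 'a) \<Rightarrow> 'a set \<Rightarrow> int" where
  "genus2 D f \<alpha> C = int (card C div 2) + 2 * int (ncl D (gr f D \<union> gr (restr C \<alpha>) D))
     - int (card (orb f ` D)) - int (card (orb (f \<circ> restr C \<alpha>) ` D))"

locale edge_involution =
  fixes D :: "'a set" and f \<alpha> :: "'a \<Rightarrow> 'a"
  assumes fin: "finite D" and bij: "bij_betw f D D"
    and inv: "\<And>d. d \<in> D \<Longrightarrow> \<alpha> d \<in> D \<and> \<alpha> (\<alpha> d) = d"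
begin

definition edge_set :: "'a set \<Rightarrow> bool" where
  "edge_set C \<longleftrightarrow> C \<subseteq> D \<and> (\<forall>d\<in>C. \<alpha> d \<in> C \<and> \<alpha> d \<noteq> d)"

lemma bij_restr: assumes "edge_set C" shows "bij_betw (restr C \<alpha>) D D"
  by (rule bij_betw_involution) (use assms inv in \<open>auto simp: restr_def edge_set_def\<close>)

lemma bij_comp: assumes "edge_set C" shows "bij_betw (f \<circ> restr C \<alpha>) D D"
  using bij_betw_trans[OF bij_restr[OF assms] bij] .

lemma edge_set_insert:
  assumes "edge_set C" "a \<in> D - C" "\<alpha> a \<noteq> a"
  shows "edge_set (insert a (insert (\<alpha> a) C))" "\<alpha> a \<notin> C"
proof -
  have a: "\<alpha> a \<in> D" "\<alpha> (\<alpha> a) = a" using assms inv by auto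
  show "\<alpha> a \<notin> C" using a(2) assms(1,2) unfolding edge_set_def by force
  show "edge_set (insert a (insert (\<alpha> a) C))" using a assms unfolding edge_set_def by simp
qed

text \<open>Keeping one more edge composes the walk with a transposition. Between two components,
  two cycles merge and the class count, which has weight two, drops by one: the defect is unchanged.
  Inside a component, splitting a cycle compensates for the new edge, whereas merging two cycles
  adds to the defect.\<close>

lemma genus2_insert:
  assumes C: "edge_set C" and a: "a \<in> D - C" "\<alpha> a \<noteq> a"
  defines "C' \<equiv> insert a (insert (\<alpha> a) C)"
  shows "genus2 D f \<alpha> C \<le> genus2 D f \<alpha> C'"
    and "(a, \<alpha> a) \<in> eqv (gr f D \<union> gr (restr C \<alpha>) D) \<Longrightarrow> \<alpha> a \<notin> orb (f \<circ> restr C \<alpha>) a \<Longrightarrow>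
         genus2 D f \<alpha> C < genus2 D f \<alpha> C'"
proof -
  let ?b = "\<alpha> a"
  let ?S = "gr f D \<union> gr (restr C \<alpha>) D"
  let ?S' = "gr f D \<union> gr (restr C' \<alpha>) D"
  let ?p = "f \<circ> restr C \<alpha>" and ?p' = "f \<circ> restr C' \<alpha>"
  have D: "a \<in> D" "?b \<in> D" "a \<notin> C" "?b \<notin> C" "\<alpha> ?b = a"
    using a inv edge_set_insert[OF C a] by auto
  have C': "edge_set C'" using edge_set_insert[OF C a] by (simp add: C'_def)
  have finC: "finite C" using C fin finite_subset by (auto simp: edge_set_def)
  have "card C' = card C + 2" using finC D a(2) by (simp add: C'_def)
  then have c: "card C' div 2 = card C div 2 + 1" by simp
  have S': "eqv ?S' = eqv (insert (a, ?b) ?S)"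
  proof (rule eqv_eqI)
    fix x y assume "(x, y) \<in> ?S'"
    then have "x = a \<and> y = ?b \<or> x = ?b \<and> y = a \<or> (x, y) \<in> ?S"
      using D by (cases "x = a"; cases "x = ?b") (auto simp: gr_def restr_def C'_def)
    then consider "x = a" "y = ?b" | "x = ?b" "y = a" | "(x, y) \<in> ?S" by blast
    then show "(x, y) \<in> eqv (insert (a, ?b) ?S)"
      by cases (auto intro: eqv_base eqv_sym[OF eqv_base])
  next
    fix x y assume "(x, y) \<in> insert (a, ?b) ?S"
    moreover have "(a, ?b) \<in> ?S'" using D by (auto simp: gr_def restr_def C'_def)
    ultimately have "(x, y) \<in> ?S' \<or> x = y"
      using D by (cases "x = a"; cases "x = ?b") (auto simp: gr_def restr_def C'_def)
    then consider "(x, y) \<in> ?S'" | "x = y" by blast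
    then show "(x, y) \<in> eqv ?S'" by cases (auto intro: eqv_base)
  qed
  then have n': "ncl D ?S' = ncl D (insert (a, ?b) ?S)" by (simp add: ncl_def)
  have p: "?p' a = ?p ?b" "?p' ?b = ?p a" "\<And>x. x \<noteq> a \<Longrightarrow> x \<noteq> ?b \<Longrightarrow> ?p' x = ?p x"
    using D by (auto simp: restr_def C'_def)
  note t = transp_card_orb[OF fin bij_comp[OF C] bij_comp[OF C'] D(1,2) p]
  \<comment> \<open>A step of the walk is an edge step followed by a step of \<open>f\<close>, so
    its cycles stay inside components.\<close>
  have orb: "?b \<notin> orb ?p a" if "(a, ?b) \<notin> eqv ?S"
  proof
    assume "?b \<in> orb ?p a"
    then have "(a, ?b) \<in> eqv (gr ?p D)" using eqv_gr[OF fin bij_comp[OF C] D(1)] by blast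
    moreover have "eqv (gr ?p D) \<subseteq> eqv ?S"
    proof (rule eqv_least)
      fix x y assume "(x, y) \<in> gr ?p D"
      then have x: "x \<in> D" "y = f (restr C \<alpha> x)" by (auto simp: gr_def)
      have "restr C \<alpha> x \<in> D" using x(1) bij_restr[OF C] bij_betwE by blast
      then have "(restr C \<alpha> x, y) \<in> eqv ?S" "(x, restr C \<alpha> x) \<in> eqv ?S"
        using x by (auto intro!: eqv_base)
      then show "(x, y) \<in> eqv ?S" by (rule eqv_trans[rotated])
    qed
    ultimately show False using that by blast
  qed
  have conn: "ncl D (insert (a, ?b) ?S) = ncl D ?S" if "(a, ?b) \<in> eqv ?S"
    using eqv_insert_same[OF that] by (simp add: ncl_def)
  show "genus2 D f \<alpha> C \<le> genus2 D f \<alpha> C'"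
  proof (cases "(a, ?b) \<in> eqv ?S")
    case True
    then show ?thesis using conn c n' t(1) by (simp add: genus2_def comp_def)
  next
    case False
    then show ?thesis using ncl_insert[OF fin D(1,2) False] c n' t(2) orb by (simp add: genus2_def comp_def)
  qed
  assume "(a, ?b) \<in> eqv ?S" "?b \<notin> orb ?p a"
  then show "genus2 D f \<alpha> C < genus2 D f \<alpha> C'"
    using conn c n' t(2) by (simp add: genus2_def comp_def)
qed

lemma genus2_mono:
  assumes "edge_set C" "edge_set C'" "C \<subseteq> C'"
  shows "genus2 D f \<alpha> C \<le> genus2 D f \<alpha> C'"
  using assms
proof (induction "card (C' - C)" arbitrary: C rule: less_induct)
  case less
  show ?case
  proof (cases "C' = C")
    case False
    then obtain a where a: "a \<in> C' - C" using less.prems by auto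
    then have a': "a \<in> D - C" "\<alpha> a \<noteq> a" "\<alpha> a \<in> C'" using less.prems by (auto simp: edge_set_def)
    let ?C = "insert a (insert (\<alpha> a) C)"
    have "finite C'" using less.prems fin finite_subset by (auto simp: edge_set_def)
    then have "card (C' - ?C) < card (C' - C)" using a by (intro psubset_card_mono) auto
    then have "genus2 D f \<alpha> ?C \<le> genus2 D f \<alpha> C'"
      using less edge_set_insert(1)[OF less.prems(1) a'(1,2)] a a'(3) by blast
    then show ?thesis using genus2_insert(1)[OF less.prems(1) a'(1,2)] by linarith
  qed simp
qed

lemma genus2_empty: "genus2 D f \<alpha> {} = 0"
proof -
  have r: "restr {} \<alpha> = id" by (auto simp: restr_def)
  have "eqv (gr f D \<union> gr id D) = eqv (gr f D)"
    by (rule eqv_eqI) (auto simp: gr_def intro: eqv_base)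
  then show ?thesis unfolding genus2_def r using ncl_gr[OF fin bij] by (simp add: ncl_def)
qed

lemma genus2_nonneg: "edge_set C \<Longrightarrow> 0 \<le> genus2 D f \<alpha> C"
  using genus2_mono[of "{}" C] genus2_empty by (simp add: edge_set_def)

text \<open>Otherwise adding the edge of \<open>a\<close> to \<open>C\<close> would merge two cycles
  of one component and make the defect positive; by monotonicity it would still be positive at
  \<open>C'\<close>.\<close>

lemma planar_separation:
  assumes "edge_set C'" "genus2 D f \<alpha> C' = 0" "edge_set C" "C \<subseteq> C'" "a \<in> C' - C"
    and "(a, \<alpha> a) \<in> eqv (gr f D \<union> gr (restr C \<alpha>) D)"
  shows "\<alpha> a \<in> orb (f \<circ> restr C \<alpha>) a"
proof (rule ccontr)
  assume n: "\<not> ?thesis"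
  have a: "a \<in> D - C" "\<alpha> a \<noteq> a" "\<alpha> a \<in> C'" using assms by (auto simp: edge_set_def)
  have "genus2 D f \<alpha> C < genus2 D f \<alpha> (insert a (insert (\<alpha> a) C))"
    using genus2_insert(2)[OF assms(3) a(1,2) assms(6)] n by blast
  also have "\<dots> \<le> genus2 D f \<alpha> C'"
    using edge_set_insert(1)[OF assms(3) a(1,2)] assms a(3) by (intro genus2_mono) auto
  finally show False using genus2_nonneg[OF assms(3)] assms(2) by linarith
qed

end

section \<open>Planar orientations: circuits separate\<close>

lemma funpow_cong:
  assumes "bij_betw f D D" "\<And>x. x \<in> D \<Longrightarrow> f x = g x" "x \<in> D"
  shows "(f ^^ n) x = (g ^^ n) x"
proof (induction n)
  case (Suc n)
  then show ?case using assms(2)[OF funpow_closed[OF assms(1,3)], of n] by simp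
qed simp

lemma orb_cong:
  assumes "bij_betw f D D" "\<And>x. x \<in> D \<Longrightarrow> f x = g x" "x \<in> D"
  shows "orb f x = orb g x"
  unfolding orb_def using funpow_cong[OF assms] by simp

text \<open>The point \<open>x\<close> lies on the forward orbit of \<open>f x\<close>, so a set
  closed under \<open>f\<close> is closed under the inverse as well.\<close>

lemma perm_closed_iff:
  assumes "finite D" "bij_betw f D D" "\<And>y. y \<in> D \<Longrightarrow> y \<in> A \<Longrightarrow> f y \<in> A" "x \<in> D"
  shows "f x \<in> A \<longleftrightarrow> x \<in> A"
proof
  assume fx: "f x \<in> A"
  have fD: "f x \<in> D" using assms(2,4) bij_betwE by blast
  have "orb f (f x) \<subseteq> A \<inter> D"
    by (rule orb_subset) (use fx fD assms bij_betwE in \<open>auto, blast\<close>)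
  moreover have "x \<in> orb f (f x)"
    using orb_sym[OF assms(1,2,4) orb_step[OF orb_self]] .
  ultimately show "x \<in> A" by blast
qed (use assms in auto)

lemma ex_simple_cycle:
  assumes "finite V" "V \<noteq> {}" "\<And>v. v \<in> V \<Longrightarrow> f v \<in> V"
  obtains v m where "v \<in> V" "m > 0" "(f ^^ m) v = v" "inj_on (\<lambda>i. (f ^^ i) v) {..<m}"
proof -
  obtain v0 where v0: "v0 \<in> V" using assms by auto
  have cl: "(f ^^ n) v0 \<in> V" for n by (induction n) (use v0 assms in auto)
  have "\<not> inj_on (\<lambda>k. (f ^^ k) v0) {..card V}"
  proof
    assume i: "inj_on (\<lambda>k. (f ^^ k) v0) {..card V}"
    have "card {..card V} \<le> card V" using card_inj_on_le[OF i _ assms(1)] cl by blast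
    then show False by simp
  qed
  then obtain i j where ij: "i < j" "(f ^^ i) v0 = (f ^^ j) v0"
    unfolding inj_on_def by (metis linorder_neqE_nat)
  define v where "v = (f ^^ i) v0"
  have "(f ^^ (j - i)) v = (f ^^ (j - i + i)) v0" by (simp add: v_def funpow_add)
  then have per: "0 < j - i \<and> (f ^^ (j - i)) v = v" using ij by (simp add: v_def)
  define m where "m = (LEAST k. 0 < k \<and> (f ^^ k) v = v)"
  have m: "0 < m \<and> (f ^^ m) v = v" unfolding m_def by (rule LeastI[of _ "j - i"]) (rule per)
  have least: "\<not> (0 < k \<and> (f ^^ k) v = v)" if "k < m" for k
    using not_less_Least[of k "\<lambda>k. 0 < k \<and> (f ^^ k) v = v"] that by (simp add: m_def)
  have "(f ^^ a) v \<noteq> (f ^^ b) v" if "a < b" "b < m" for a b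
  proof
    assume e: "(f ^^ a) v = (f ^^ b) v"
    have "(f ^^ (m - b + a)) v = (f ^^ (m - b)) ((f ^^ a) v)" by (simp add: funpow_add)
    also have "\<dots> = (f ^^ (m - b + b)) v" using e by (simp add: funpow_add)
    also have "\<dots> = v" using m that by simp
    finally have "(f ^^ (m - b + a)) v = v" .
    moreover have "0 < m - b + a" "m - b + a < m" using that by linarith+
    ultimately show False using least by blast
  qed
  then have "inj_on (\<lambda>i. (f ^^ i) v) {..<m}"
    unfolding inj_on_def by (metis lessThan_iff linorder_neqE_nat)
  then show ?thesis using that m cl v_def by blast
qed

text \<open>The corner of a tail lies in the face to the left of its edge, so a step of the second
  kind crosses an edge from left to right.\<close>

definition dual_step :: "'d fro \<Rightarrow> ('d \<times> 'd) set" where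
  "dual_step M = {(d, phi M d) | d. d \<in> darts M} \<union>
     {(t, alpha M t) | t. t \<in> darts M \<and> \<not> head M t}"

definition dual_accessible :: "'d fro \<Rightarrow> bool" where
  "dual_accessible M \<longleftrightarrow> (\<forall>d\<in>darts M. (root M, d) \<in> (dual_step M)\<^sup>*)"

locale fro =
  fixes M :: "'d fro"
  assumes is_fro: "is_fro M"
begin

abbreviation "D \<equiv> darts M"
abbreviation "al \<equiv> alpha M"
abbreviation "sg \<equiv> sigma M"
abbreviation "ph \<equiv> phi M"
abbreviation "R \<equiv> root_face M"

lemma fin: "finite D" and ne: "D \<noteq> {}" and bij_sg: "bij_betw sg D D" and rt: "root M \<in> D"
  using is_fro by (auto simp: is_fro_def)

lemma al [simp]: "d \<in> D \<Longrightarrow> al d \<in> D" "d \<in> D \<Longrightarrow> al (al d) = d" "d \<in> D \<Longrightarrow> al d \<noteq> d"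
  "d \<in> D \<Longrightarrow> d \<noteq> al d"
  using is_fro by (auto simp: is_fro_def)

lemma head_al [simp]: "d \<in> D \<Longrightarrow> head M (al d) \<longleftrightarrow> \<not> head M d"
  using is_fro by (auto simp: is_fro_def)

lemma bij_al: "bij_betw al D D"
  by (rule bij_betw_involution) simp

lemma ph_eq: "ph = sg \<circ> al"
  by (auto simp: phi_def)

lemma bij_ph: "bij_betw ph D D"
  unfolding ph_eq by (rule bij_betw_trans[OF bij_al bij_sg])

lemma sg_closed [simp]: "d \<in> D \<Longrightarrow> sg d \<in> D"
  using bij_sg bij_betwE by blast

lemma ph_closed [simp]: "d \<in> D \<Longrightarrow> ph d \<in> D"
  using bij_ph bij_betwE by blast

lemma ph_al: "d \<in> D \<Longrightarrow> ph (al d) = sg d" and sg_al: "sg (al d) = ph d"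
  by (auto simp: phi_def)

lemma sg_inj: "x \<in> D \<Longrightarrow> y \<in> D \<Longrightarrow> sg x = sg y \<longleftrightarrow> x = y"
  using bij_sg by (metis bij_betw_inv_into_left)

lemma ph_inj: "x \<in> D \<Longrightarrow> y \<in> D \<Longrightarrow> ph x = ph y \<longleftrightarrow> x = y"
  using bij_ph by (metis bij_betw_inv_into_left)

lemma connected_induct:
  assumes "x \<in> A" "x \<in> D" "\<And>d. d \<in> D \<Longrightarrow> d \<in> A \<Longrightarrow> al d \<in> A" "\<And>d. d \<in> D \<Longrightarrow> d \<in> A \<Longrightarrow> sg d \<in> A"
  shows "D \<subseteq> A"
proof
  fix y assume "y \<in> D"
  then have "(x, y) \<in> ({(d, al d) | d. d \<in> D} \<union> {(d, sg d) | d. d \<in> D})\<^sup>*"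
    using is_fro assms(2) by (auto simp: is_fro_def connected_darts_def)
  then show "y \<in> A"
    by induction (use assms in auto)
qed

lemma vert_self [simp]: "x \<in> vert M x" by (simp add: vert_def)
lemma vert_closed: "x \<in> D \<Longrightarrow> vert M x \<subseteq> D"
  unfolding vert_def by (rule orb_closed[OF bij_sg])
lemma vert_eq_iff: "x \<in> D \<Longrightarrow> vert M y = vert M x \<longleftrightarrow> y \<in> vert M x"
  unfolding vert_def by (rule orb_eq_iff[OF fin bij_sg])
lemma vert_sg [simp]: "x \<in> D \<Longrightarrow> vert M (sg x) = vert M x"
  using vert_eq_iff by (simp add: vert_def orb_step)
lemma vert_funpow: "x \<in> D \<Longrightarrow> vert M ((sg ^^ n) x) = vert M x"
  using vert_eq_iff by (simp add: vert_def)

lemma root_in_R [simp]: "root M \<in> R" by (simp add: root_face_def face_def)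
lemma R_sub: "R \<subseteq> D" unfolding root_face_def face_def by (rule orb_closed[OF bij_ph rt])
lemma R_D [simp]: "x \<in> R \<Longrightarrow> x \<in> D" using R_sub by blast
lemma R_ph [simp]: "x \<in> D \<Longrightarrow> ph x \<in> R \<longleftrightarrow> x \<in> R"
  by (rule perm_closed_iff[OF fin bij_ph]) (auto simp: root_face_def face_def orb_step)
lemma face_R: "x \<in> R \<Longrightarrow> face M x = R"
  unfolding root_face_def face_def by (rule orb_eq[OF fin bij_ph rt])

sublocale E: edge_involution D ph al
  by unfold_locales (use fin bij_ph in auto)

lemma edge_set_full: "E.edge_set D"
  by (simp add: E.edge_set_def)

text \<open>With every edge kept, the walk \<open>ph o al\<close> is \<open>sg\<close>, and there is
  one component. The defect is then E + 2 - F - V, which vanishes by the Euler relation in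
  \<open>is_fro\<close>.\<close>

lemma planar: "genus2 D ph al D = 0"
proof -
  let ?S = "gr ph D \<union> gr (restr D al) D"
  have "D \<subseteq> eqv ?S `` {root M}"
  proof (rule connected_induct[of "root M"])
    fix d assume d: "d \<in> D" "d \<in> eqv ?S `` {root M}"
    have 1: "(d, al d) \<in> eqv ?S" by (rule eqv_base) (use d in \<open>auto simp: gr_def restr_def\<close>)
    show "al d \<in> eqv ?S `` {root M}" using d(2) eqv_trans[OF _ 1] by simp
    have "(al d, ph (al d)) \<in> eqv ?S" by (rule eqv_base) (use d in auto)
    then have 2: "(d, sg d) \<in> eqv ?S" using eqv_trans[OF 1] d by (simp add: ph_al)
    show "sg d \<in> eqv ?S `` {root M}" using d(2) eqv_trans[OF _ 2] by simp
  qed (use rt in auto)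
  then have "(\<lambda>x. eqv ?S `` {x}) ` D = {eqv ?S `` {root M}}"
  proof -
    assume a: "D \<subseteq> eqv ?S `` {root M}"
    have "eqv ?S `` {x} = eqv ?S `` {root M}" if "x \<in> D" for x
    proof -
      have "(root M, x) \<in> eqv ?S" using a that by blast
      then have "(x, root M) \<in> eqv ?S" by (rule eqv_sym)
      then show ?thesis unfolding eqv_class_eq .
    qed
    then have "(\<lambda>x. eqv ?S `` {x}) ` D = (\<lambda>x. eqv ?S `` {root M}) ` D" by (rule image_cong[OF refl])
    also have "\<dots> = {eqv ?S `` {root M}}" using rt by (rule image_constant)
    finally show ?thesis .
  qed
  then have n: "ncl D ?S = 1" by (simp add: ncl_def)
  have "orb (ph \<circ> restr D al) x = orb sg x" if "x \<in> D" for x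
    by (rule orb_cong[OF E.bij_comp[OF edge_set_full] _ that]) (simp add: restr_def ph_al)
  then have "orb (ph \<circ> restr D al) ` D = vert M ` D" by (auto simp: vert_def)
  moreover have "orb ph ` D = face M ` D" by (auto simp: face_def)
  moreover have "card (vert M ` D) + card (face M ` D) = card D div 2 + 2"
    using is_fro by (simp add: is_fro_def)
  ultimately show ?thesis by (simp add: genus2_def n)
qed

text \<open>Two corners are related when they can be joined in the dual map without crossing an edge
  of \<open>W\<close> in either direction.\<close>

definition avoid :: "'d set \<Rightarrow> ('d \<times> 'd) set" where
  "avoid W = eqv (gr ph D \<union> gr (restr (D - (W \<union> al ` W)) al) D)"

lemma avoid_ph: "x \<in> D \<Longrightarrow> (x, ph x) \<in> avoid W"
  unfolding avoid_def by (rule eqv_base) auto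

lemma avoid_al:
  assumes "W \<subseteq> D" "x \<in> D" "x \<notin> W" "al x \<notin> W" shows "(x, al x) \<in> avoid W"
proof -
  have "x \<notin> al ` W"
  proof
    assume "x \<in> al ` W"
    then obtain w where "w \<in> W" "x = al w" by auto
    then show False using assms by auto
  qed
  then show ?thesis unfolding avoid_def
    by (intro eqv_base) (use assms in \<open>auto simp: gr_def restr_def\<close>)
qed

text \<open>Think of \<open>X\<close> as corners along one side of the curve \<open>W\<close>.
  Moving by \<open>ph\<close> at edges of \<open>W\<close> and by \<open>sg\<close> elsewhere is the
  walk around the contraction of \<open>W\<close>. It stays in \<open>X\<close>, hence misses
  \<open>al t\<close>, and a dual path from \<open>t\<close> to \<open>al t\<close> would contradict
  \<open>planar_separation\<close>.\<close>

lemma separation: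
  assumes W: "W \<subseteq> D"
    and X: "\<And>x. x \<in> X \<Longrightarrow> x \<in> D" "\<And>x. x \<in> X \<Longrightarrow> x \<in> W \<Longrightarrow> ph x \<in> X"
      "\<And>x. x \<in> X \<Longrightarrow> x \<notin> W \<Longrightarrow> sg x \<in> X" "X \<inter> al ` W = {}"
    and t: "t \<in> W" "t \<in> X"
  shows "(t, al t) \<notin> avoid W"
proof
  let ?C = "D - (W \<union> al ` W)"
  assume c: "(t, al t) \<in> avoid W"
  have C: "E.edge_set ?C"
    unfolding E.edge_set_def
  proof (intro conjI ballI)
    fix d assume d: "d \<in> ?C"
    then show "al d \<noteq> d" by simp
    have "al d \<notin> W" using d al(2)[of d] by (metis DiffD1 DiffD2 UnI2 imageI)
    moreover have "al d \<notin> al ` W"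
    proof
      assume "al d \<in> al ` W"
      then obtain w where w: "w \<in> W" "al d = al w" by auto
      then have "d = w" using W d al(2) by (metis DiffD1 subset_iff)
      then show False using d w by simp
    qed
    ultimately show "al d \<in> ?C" using d by simp
  qed auto
  have "al t \<in> orb (ph \<circ> restr ?C al) t"
    by (rule E.planar_separation[OF edge_set_full planar C]) (use t W c in \<open>auto simp: avoid_def\<close>)
  moreover have "orb (ph \<circ> restr ?C al) t \<subseteq> X"
  proof (rule orb_subset[OF t(2)])
    fix y assume y: "y \<in> X"
    then have "y \<notin> al ` W" using X(4) by blast
    then show "(ph \<circ> restr ?C al) y \<in> X"
      using X(1-3)[OF y] by (cases "y \<in> W") (auto simp: restr_def ph_al)
  qed
  ultimately show False using X(4) t(1) by blast
qed

text \<open>The darts met clockwise between the incoming edge and the outgoing one are those on the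
  left of the circuit at this vertex. As the circuit passes through the vertex only once, none of
  its other darts ends there.\<close>

lemma circuit_wedge:
  assumes c: "is_circuit M ts" and i: "i < length ts"
  shows "\<exists>k>0. (sg ^^ k) (al (ts ! i)) = ts ! ((i + 1) mod length ts) \<and>
    (\<forall>j. 0 < j \<and> j < k \<longrightarrow> (sg ^^ j) (al (ts ! i)) \<notin> set ts \<and> al ((sg ^^ j) (al (ts ! i))) \<notin> set ts)"
proof -
  let ?l = "length ts"
  let ?a = "al (ts ! i)" and ?t = "ts ! ((i + 1) mod ?l)"
  have l: "(n + 1) mod ?l < ?l" for n by (rule mod_less_divisor) (use i in linarith)
  have D: "ts ! n \<in> D" "\<not> head M (ts ! n)" if "n < ?l" for n
    using c that unfolding is_circuit_def by (meson nth_mem subset_iff)+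
  have a: "?a \<in> D" "head M ?a" using D i by auto
  have vt: "vert M (al (ts ! n)) = vert M (ts ! ((n + 1) mod ?l))" if "n < ?l" for n
    using c that unfolding is_circuit_def by blast
  have inj: "m = n" if "m < ?l" "n < ?l" "vert M (ts ! m) = vert M (ts ! n)" for m n
    using c that unfolding is_circuit_def by (metis distinct_conv_nth length_map nth_map)
  have "?t \<in> vert M ?a" using vt[OF i] by simp
  then obtain k0 where k0: "(sg ^^ k0) ?a = ?t" unfolding vert_def orb_def by auto
  define k where "k = (LEAST k. (sg ^^ k) ?a = ?t)"
  have k: "(sg ^^ k) ?a = ?t" unfolding k_def by (rule LeastI[of _ k0]) (rule k0)
  have least: "(sg ^^ j) ?a \<noteq> ?t" if "j < k" for j
    using not_less_Least that unfolding k_def by metis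
  have "k \<noteq> 0" using k a D(2)[OF l[of i]] by (metis funpow_0)
  moreover have "(sg ^^ j) ?a \<notin> set ts \<and> al ((sg ^^ j) ?a) \<notin> set ts" if j: "0 < j" "j < k" for j
  proof
    let ?y = "(sg ^^ j) ?a"
    have vy: "vert M ?y = vert M ?a" "?y \<in> D"
      using vert_funpow a funpow_closed[OF bij_sg] by auto
    show "?y \<notin> set ts"
    proof
      assume "?y \<in> set ts"
      then obtain m where m: "m < ?l" "?y = ts ! m" by (metis in_set_conv_nth)
      then have "vert M (ts ! m) = vert M ?t" using vy vt[OF i] by simp
      then have "?y = ?t" using inj[OF m(1) l] m by metis
      then show False using least j by blast
    qed
    show "al ?y \<notin> set ts"
    proof
      assume "al ?y \<in> set ts"
      then obtain m where m: "m < ?l" "al ?y = ts ! m" by (metis in_set_conv_nth)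
      then have y: "?y = al (ts ! m)" using vy(2) al(2) by metis
      then have "vert M (ts ! ((m + 1) mod ?l)) = vert M ?t" using vy vt[OF i] vt[OF m(1)] by simp
      then have "(m + 1) mod ?l = (i + 1) mod ?l" by (rule inj[OF l l])
      then have "m = i" using m(1) i by (simp add: mod_Suc split: if_splits)
      then have "?y = ?a" using y by simp
      \<comment> \<open>A return to \<open>?a\<close> after \<open>j\<close> steps would bring the
        rotation to \<open>?t\<close> already after \<open>k - j\<close> steps, against the choice
        of \<open>k\<close>.\<close>
      then have "(sg ^^ (k - j)) ?a = (sg ^^ (k - j)) ?y" by simp
      also have "\<dots> = (sg ^^ (k - j + j)) ?a" by (simp add: funpow_add)
      also have "\<dots> = ?t" using k j by simp
      finally show False using least[of "k - j"] j by simp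
    qed
  qed
  ultimately show ?thesis using k by blast
qed

text \<open>The two sides of a circuit are distinct: this is \<open>separation\<close> applied to
  the union of the left wedges along the circuit.\<close>

lemma circuit_separates:
  assumes c: "is_circuit M ts" and t: "t \<in> set ts"
  shows "(t, al t) \<notin> avoid (set ts)"
proof -
  let ?l = "length ts"
  have D: "ts ! n \<in> D" "\<not> head M (ts ! n)" if "n < ?l" for n
    using c that unfolding is_circuit_def by (meson nth_mem subset_iff)+
  obtain k where k: "\<And>i. i < ?l \<Longrightarrow> k i > 0" "\<And>i. i < ?l \<Longrightarrow> (sg ^^ k i) (al (ts ! i)) = ts ! ((i + 1) mod ?l)"
    "\<And>i j. i < ?l \<Longrightarrow> 0 < j \<Longrightarrow> j < k i \<Longrightarrow>
      (sg ^^ j) (al (ts ! i)) \<notin> set ts \<and> al ((sg ^^ j) (al (ts ! i))) \<notin> set ts"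
    using circuit_wedge[OF c] by metis
  \<comment> \<open>The left wedges. The bound \<open>0 < j\<close> excludes the incoming head,
    while \<open>j = k i\<close> includes the next tail of the circuit.\<close>
  define X where "X = {(sg ^^ j) (al (ts ! i)) | i j. i < ?l \<and> 0 < j \<and> j \<le> k i}"
  show ?thesis
  proof (rule separation[of _ X])
    show "set ts \<subseteq> D" using c by (simp add: is_circuit_def)
    show "x \<in> D" if "x \<in> X" for x
      using that D funpow_closed[OF bij_sg] al(1) unfolding X_def by auto
    show "ph x \<in> X" if x: "x \<in> X" "x \<in> set ts" for x
    proof -
      obtain i where i: "i < ?l" "x = ts ! i" using x(2) by (metis in_set_conv_nth)
      then have "ph x = (sg ^^ 1) (al (ts ! i))" by (simp add: sg_al)
      moreover have "(1::nat) \<le> k i" using k(1)[OF i(1)] by simp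
      ultimately show ?thesis unfolding X_def using i(1) by (metis (mono_tags, lifting) CollectI zero_less_one)
    qed
    show "sg x \<in> X" if x: "x \<in> X" "x \<notin> set ts" for x
    proof -
      obtain i j where ij: "x = (sg ^^ j) (al (ts ! i))" "i < ?l" "0 < j" "j \<le> k i"
        using x(1) unfolding X_def by auto
      have "(i + 1) mod ?l < ?l" by (rule mod_less_divisor) (use ij(2) in linarith)
      then have "ts ! ((i + 1) mod ?l) \<in> set ts" by (rule nth_mem)
      then have "j \<noteq> k i" using x(2) ij k(2) by metis
      then have "sg x = (sg ^^ Suc j) (al (ts ! i))" "Suc j \<le> k i" using ij by auto
      then show ?thesis unfolding X_def using ij(2) by blast
    qed
    show "X \<inter> al ` set ts = {}"
    proof -
      have False if xw: "x \<in> X" "w \<in> set ts" "x = al w" for x w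
      proof -
        obtain i j where ij: "x = (sg ^^ j) (al (ts ! i))" "i < ?l" "0 < j" "j \<le> k i"
          using xw(1) unfolding X_def by auto
        have w: "w \<in> D" "\<not> head M w" using c xw(2) unfolding is_circuit_def by auto
        show False
        proof (cases "j = k i")
          case True
          then have "x = ts ! ((i + 1) mod ?l)" using k(2) ij by simp
          moreover have "(i + 1) mod ?l < ?l" by (rule mod_less_divisor) (use ij(2) in linarith)
          ultimately show False using D(2) w xw(3) head_al by metis
        next
          case False
          then have "al x \<notin> set ts" using k(3)[OF ij(2,3)] ij by simp
          then show False using xw w by simp
        qed
      qed
      then show ?thesis by blast
    qed
    show "t \<in> set ts" by (rule t)
    show "t \<in> X"
    proof -
      obtain i where i: "i < ?l" "t = ts ! i" using t by (metis in_set_conv_nth)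
      \<comment> \<open>The cyclic predecessor of \<open>i\<close>; adding the length first keeps
        the subtraction from being cut off at 0.\<close>
      define m where "m = (i + ?l - 1) mod ?l"
      have m: "m < ?l" unfolding m_def by (rule mod_less_divisor) (use i in linarith)
      have "(m + 1) mod ?l = (i + ?l - 1 + 1) mod ?l" unfolding m_def by (rule mod_add_left_eq)
      moreover have "i + ?l - 1 + 1 = i + ?l" using i by linarith
      ultimately have "(m + 1) mod ?l = i" using i by simp
      then have "t = (sg ^^ k m) (al (ts ! m))" using k(2)[OF m] i by simp
      then show ?thesis unfolding X_def using m k(1) by blast
    qed
  qed
qed

section \<open>Minimality is dual accessibility\<close>

lemma left_step_sym: "(x, y) \<in> left_step M ts \<Longrightarrow> (y, x) \<in> left_step M ts"
  unfolding left_step_def by auto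

text \<open>The definition of \<open>clockwise\<close> starts from the first edge only. Rotating
  through the wedges, without crossing the circuit, shows that every edge sees the same left
  side.\<close>

lemma left_connected:
  assumes c: "is_circuit M ts" and i: "i < length ts"
  shows "(ts ! i, ts ! ((i + 1) mod length ts)) \<in> (left_step M ts)\<^sup>*"
proof -
  obtain k where k: "k > 0" "(sg ^^ k) (al (ts ! i)) = ts ! ((i + 1) mod length ts)"
    "\<And>j. 0 < j \<Longrightarrow> j < k \<Longrightarrow> (sg ^^ j) (al (ts ! i)) \<notin> set ts \<and> al ((sg ^^ j) (al (ts ! i))) \<notin> set ts"
    using circuit_wedge[OF assms] by metis
  have t: "ts ! i \<in> D" using c i unfolding is_circuit_def by auto
  have "(ts ! i, (sg ^^ j) (al (ts ! i))) \<in> (left_step M ts)\<^sup>*" if "0 < j" "j \<le> k" for j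
    using that
  proof (induction j)
    case (Suc j)
    show ?case
    proof (cases "j = 0")
      case True
      then show ?thesis using t by (auto simp: left_step_def sg_al)
    next
      case False
      let ?y = "(sg ^^ j) (al (ts ! i))"
      have y: "?y \<in> D" using funpow_closed[OF bij_sg] t al(1) by blast
      have "(?y, al ?y) \<in> left_step M ts" using k(3)[of j] False Suc.prems y by (auto simp: left_step_def)
      moreover have "(al ?y, sg ?y) \<in> left_step M ts"
        using y ph_al[OF y] al(1)[OF y] unfolding left_step_def by force
      moreover have "(ts ! i, ?y) \<in> (left_step M ts)\<^sup>*" using Suc False by simp
      ultimately show ?thesis by (simp add: rtrancl.rtrancl_into_rtrancl)
    qed
  qed simp
  then show ?thesis using k by (metis order_refl)
qed

text \<open>Dual steps cross edges from left to right, hence cross a circuit only away from its left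
  side. If the root-face were not on the left, the corners there could never be reached.\<close>

lemma minimalI:
  assumes "dual_accessible M" shows "minimal M"
  unfolding minimal_def
proof (intro allI impI)
  fix ts assume c: "is_circuit M ts"
  then have ts: "ts \<noteq> []" "set ts \<subseteq> D" by (auto simp: is_circuit_def)
  have hts: "\<forall>t\<in>set ts. \<not> head M t" using c unfolding is_circuit_def by (elim conjE)
  define L where "L = {x. (hd ts, x) \<in> (left_step M ts)\<^sup>*}"
  have L: "y \<in> L" if "x \<in> L" "(x, y) \<in> left_step M ts" for x y
    using that unfolding L_def by (auto intro: rtrancl_into_rtrancl)
  have tsL: "ts ! i \<in> L" if "i < length ts" for i
    using that
  proof (induction i)
    case 0 then show ?case using ts by (simp add: L_def hd_conv_nth)
  next
    case (Suc i)
    then have "(ts ! i, ts ! Suc i) \<in> (left_step M ts)\<^sup>*" using left_connected[OF c, of i] by simp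
    then show ?case using Suc unfolding L_def by (auto intro: rtrancl_trans)
  qed
  have "root M \<in> L"
  proof (rule ccontr)
    assume nr: "root M \<notin> L"
    have "y \<notin> L" if "(root M, y) \<in> (dual_step M)\<^sup>*" for y
      using that
    proof induction
      case (step y z)
      show ?case
      proof
        assume z: "z \<in> L"
        from step(2) consider "y \<in> D" "z = ph y" | "y \<in> D" "z = al y" "\<not> head M y"
          by (auto simp: dual_step_def)
        then show False
        proof cases
          case 1
          then have "(z, y) \<in> left_step M ts" by (auto simp: left_step_def)
          then show False using L[OF z] step.IH by blast
        next
          case 2
          have "y \<notin> set ts" using tsL step.IH by (metis in_set_conv_nth)
          moreover have "al y \<notin> set ts"
          proof
            assume "al y \<in> set ts"
            then have "\<not> head M (al y)" using hts by (rule bspec[rotated])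
            then show False using 2(1,3) by simp
          qed
          ultimately have "(y, z) \<in> left_step M ts" using 2(1,2) by (simp add: left_step_def)
          then have "(z, y) \<in> left_step M ts" by (rule left_step_sym)
          then show False using L[OF z] step.IH by blast
        qed
      qed
    qed (rule nr)
    moreover have "hd ts \<in> D" "hd ts \<in> L" using ts by (auto simp: L_def)
    ultimately show False using assms unfolding dual_accessible_def by blast
  qed
  then show "clockwise M ts" by (simp add: L_def clockwise_def)
qed

lemma avoid_sym: "(x, y) \<in> avoid W \<Longrightarrow> (y, x) \<in> avoid W"
  unfolding avoid_def by (rule eqv_sym)

lemma avoid_trans: "(x, y) \<in> avoid W \<Longrightarrow> (y, z) \<in> avoid W \<Longrightarrow> (x, z) \<in> avoid W"
  unfolding avoid_def by (rule eqv_trans)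

text \<open>If some face is unreachable, the boundary of the component of the root among the reachable
  faces is crossed only from left to right by the edges leaving it, hence contains a
  counterclockwise circuit.\<close>

lemma dual_accessibleI:
  assumes min: "minimal M" shows "dual_accessible M"
proof (rule ccontr)
  assume "\<not> dual_accessible M"
  define Q where "Q = {d. (root M, d) \<in> (dual_step M)\<^sup>*}"
  obtain d0 where d0: "d0 \<in> D" "d0 \<notin> Q"
    using \<open>\<not> dual_accessible M\<close> unfolding dual_accessible_def Q_def by blast
  have Q_ph: "ph d \<in> Q" if "d \<in> D" "d \<in> Q" for d
    using that unfolding Q_def by (auto simp: dual_step_def intro: rtrancl_into_rtrancl)
  have Q_al: "al d \<in> Q" if "d \<in> D" "d \<in> Q" "\<not> head M d" for d
    using that unfolding Q_def by (auto simp: dual_step_def intro: rtrancl_into_rtrancl)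
  define S where "S = gr ph D \<union> {(x, al x) | x. x \<in> D \<and> x \<in> Q \<and> al x \<in> Q}"
  define K where "K = eqv S `` {root M}"
  have KQ: "K \<subseteq> Q \<inter> D"
  proof
    fix y assume "y \<in> K"
    then have "(root M, y) \<in> eqv S" by (simp add: K_def)
    then show "y \<in> Q \<inter> D"
    proof (rule eqv_closed)
      show "root M \<in> Q \<inter> D" using rt by (simp add: Q_def)
      fix u v assume "(u, v) \<in> S"
      then consider "u \<in> D" "v = ph u" | "u \<in> D" "u \<in> Q" "al u \<in> Q" "v = al u"
        by (auto simp: S_def gr_def)
      then show "u \<in> Q \<inter> D \<longleftrightarrow> v \<in> Q \<inter> D"
      proof cases
        case 1
        then show ?thesis using perm_closed_iff[OF fin bij_ph Q_ph] by simp
      qed auto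
    qed
  qed
  have K_ph: "ph x \<in> K \<longleftrightarrow> x \<in> K" if "x \<in> D" for x
  proof -
    have "(x, ph x) \<in> eqv S" by (rule eqv_base) (use that in \<open>auto simp: S_def\<close>)
    then show ?thesis using eqv_trans[of "root M" _ S] eqv_sym[of x "ph x" S] unfolding K_def by blast
  qed
  define B where "B = {t \<in> D. \<not> head M t \<and> t \<notin> K \<and> al t \<in> K}"
  \<comment> \<open>Such an \<open>x\<close> is not in \<open>Q\<close>, since \<open>S\<close>
    would then join it to \<open>K\<close>. If \<open>al x\<close> were a tail, crossing its edge
    would put \<open>x\<close> into \<open>Q\<close>; hence \<open>x\<close> is a tail.\<close>
  have BI: "x \<in> B" if x: "x \<in> D" "x \<notin> K" "al x \<in> K" for x
  proof -
    have "x \<notin> Q"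
    proof
      assume "x \<in> Q"
      then have "(x, al x) \<in> eqv S" using x KQ by (intro eqv_base) (auto simp: S_def)
      then show False using x eqv_trans[of "root M" _ S] eqv_sym[of x "al x" S] unfolding K_def by blast
    qed
    then have "\<not> head M x" using Q_al[of "al x"] x KQ by auto
    then show ?thesis using x by (simp add: B_def)
  qed
  have BQ: "B \<inter> Q = {}"
  proof -
    have False if t: "t \<in> B" "t \<in> Q" for t
    proof -
      have "(t, al t) \<in> eqv S" using t KQ unfolding B_def by (intro eqv_base) (auto simp: S_def)
      then show False using t(1) eqv_trans[of "root M" _ S] eqv_sym[of t "al t" S] unfolding K_def B_def by blast
    qed
    then show ?thesis by blast
  qed
  have "B \<noteq> {}"
  proof
    assume B: "B = {}"
    have K_al: "al d \<in> K" if "d \<in> D" "d \<in> K" for d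
      using BI[of "al d"] B that by auto
    have "D \<subseteq> K"
    proof (rule connected_induct[of "root M"])
      fix d assume d: "d \<in> D" "d \<in> K"
      show "al d \<in> K" using K_al[OF d] .
      have "ph (al d) \<in> K" using K_ph[of "al d"] K_al[OF d] d by simp
      then show "sg d \<in> K" using d by (simp add: ph_al)
    qed (use rt in \<open>auto simp: K_def\<close>)
    then show False using d0 KQ by blast
  qed
  \<comment> \<open>Rotate clockwise around the end of \<open>t\<close>, starting at
    \<open>ph t\<close>, which is outside \<open>K\<close>, up to the first dart in
    \<open>K\<close>. The dart just before it is again on the boundary.\<close>
  have next_B: "\<exists>y\<in>B. vert M y = vert M (al t)" if t: "t \<in> B" for t
  proof -
    have tD: "t \<in> D" "t \<notin> K" "al t \<in> K" using t by (auto simp: B_def)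
    have "al t \<in> orb sg (ph t)"
      unfolding sg_al[symmetric] by (rule orb_sym[OF fin bij_sg]) (use tD in \<open>auto intro: orb_step[OF orb_self]\<close>)
    then obtain k0 where "al t = (sg ^^ k0) (ph t)" unfolding orb_def by blast
    then have k0: "(sg ^^ k0) (ph t) \<in> K" using tD(3) by simp
    define k where "k = (LEAST k. (sg ^^ k) (ph t) \<in> K)"
    have k: "(sg ^^ k) (ph t) \<in> K" unfolding k_def by (rule LeastI[of _ k0]) (rule k0)
    have "ph t \<notin> K" using K_ph tD by simp
    then obtain j where j: "k = Suc j" using k by (cases k) auto
    let ?y = "(sg ^^ j) (ph t)"
    have y: "?y \<in> D" using tD(1) funpow_closed[OF bij_sg] by simp
    have "?y \<notin> K" using not_less_Least[of j "\<lambda>k. (sg ^^ k) (ph t) \<in> K"] j by (auto simp: k_def)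
    moreover have "al ?y \<in> K" using k j y K_ph[of "al ?y"] by (simp add: ph_al)
    ultimately have "?y \<in> B" using BI y by blast
    moreover have "vert M ?y = vert M (al t)"
      using vert_funpow[of "ph t" j] vert_sg[of "al t"] tD by (simp add: sg_al)
    ultimately show ?thesis by blast
  qed
  \<comment> \<open>One boundary edge is chosen per vertex. A cycle of the induced map on vertices
    then visits each vertex once, as a circuit requires.\<close>
  define b where "b v = (SOME y. y \<in> B \<and> vert M y = v)" for v
  have b: "b v \<in> B \<and> vert M (b v) = v" if "v \<in> vert M ` B" for v
    unfolding b_def by (rule someI_ex) (use that in auto)
  define nx where "nx v = vert M (al (b v))" for v
  have nx: "nx v \<in> vert M ` B" if "v \<in> vert M ` B" for v
    using next_B[of "b v"] b[OF that] unfolding nx_def by (metis imageI)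
  have "finite (vert M ` B)" using fin by (simp add: B_def)
  then obtain v m where vm: "v \<in> vert M ` B" "m > 0" "(nx ^^ m) v = v" "inj_on (\<lambda>i. (nx ^^ i) v) {..<m}"
    using ex_simple_cycle[of "vert M ` B" nx] nx \<open>B \<noteq> {}\<close> by blast
  have cl: "(nx ^^ i) v \<in> vert M ` B" for i by (induction i) (use vm(1) nx in auto)
  define ts where "ts = map (\<lambda>i. b ((nx ^^ i) v)) [0..<m]"
  have tsB: "set ts \<subseteq> B" using b[OF cl] by (auto simp: ts_def)
  have BD: "B \<subseteq> D" by (auto simp: B_def)
  have c: "is_circuit M ts"
    unfolding is_circuit_def
  proof (intro conjI allI impI)
    show "ts \<noteq> []" using vm(2) by (simp add: ts_def)
    show "set ts \<subseteq> D" using tsB BD by blast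
    show "\<forall>t\<in>set ts. \<not> head M t" using tsB by (auto simp: B_def)
    have "map (vert M) ts = map (\<lambda>i. (nx ^^ i) v) [0..<m]" using b[OF cl] by (simp add: ts_def)
    then show "distinct (map (vert M) ts)" using vm(4) by (simp add: distinct_map atLeast0LessThan)
    fix i assume "i < length ts"
    then have i: "i < m" by (simp add: ts_def)
    have "vert M (al (ts ! i)) = (nx ^^ Suc i) v" using i by (simp add: ts_def nx_def)
    also have "\<dots> = (nx ^^ ((i + 1) mod m)) v" using i vm(3) by (cases "Suc i = m") auto
    also have "\<dots> = vert M (ts ! ((i + 1) mod length ts))"
      using b[OF cl] vm(2) by (simp add: ts_def)
    finally show "vert M (al (ts ! i)) = vert M (ts ! ((i + 1) mod length ts))" .
  qed
  let ?t = "hd ts"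
  have t: "?t \<in> set ts" using c by (simp add: is_circuit_def)
  have "(?t, root M) \<in> (left_step M ts)\<^sup>*" using min c unfolding minimal_def clockwise_def by blast
  then have "(?t, root M) \<in> avoid (set ts)"
  proof induction
    case (step y z)
    have "(y, z) \<in> avoid (set ts)"
    proof -
      have W: "set ts \<subseteq> D" using tsB BD by blast
      from step(2) consider "y \<in> D" "z = ph y" | "z \<in> D" "y = ph z"
        | "y \<in> D" "z = al y" "y \<notin> set ts" "al y \<notin> set ts"
        unfolding left_step_def by blast
      then show ?thesis
      proof cases
        case 2
        then show ?thesis using avoid_sym[OF avoid_ph[OF 2(1)]] by simp
      qed (use avoid_ph avoid_al[OF W] in simp_all)
    qed
    with step.IH show ?case by (rule avoid_trans)
  qed (simp add: avoid_def)
  moreover have "eqv S \<subseteq> avoid (set ts)"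
    unfolding avoid_def
  proof (rule eqv_least, fold avoid_def)
    fix x y assume "(x, y) \<in> S"
    then consider "x \<in> D" "y = ph x" | "x \<in> D" "x \<in> Q" "al x \<in> Q" "y = al x"
      by (auto simp: S_def gr_def)
    then show "(x, y) \<in> avoid (set ts)"
    proof cases
      case 1
      then show ?thesis using avoid_ph by simp
    next
      case 2
      then show ?thesis using avoid_al[of "set ts" x] tsB BQ BD by blast
    qed
  qed
  \<comment> \<open>The root is joined to the left of \<open>?t\<close> by minimality and to its
    right inside \<open>K\<close>. Neither path crosses the circuit, so its two sides would be
    connected.\<close>
  moreover have "(root M, al ?t) \<in> eqv S" using t tsB by (auto simp: B_def K_def)
  ultimately have "(?t, root M) \<in> avoid (set ts)" "(root M, al ?t) \<in> avoid (set ts)" by blast+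
  then have "(?t, al ?t) \<in> avoid (set ts)" by (rule avoid_trans)
  then show False using circuit_separates[OF c t] by blast
qed

end

section \<open>First return maps\<close>

lemma next_in_spec:
  assumes "k > 0" "P ((f ^^ k) x)"
  obtains m where "0 < m" "m \<le> k" "P ((f ^^ m) x)" "next_in P f x = (f ^^ m) x"
    "\<And>j. 0 < j \<Longrightarrow> j < m \<Longrightarrow> \<not> P ((f ^^ j) x)"
proof -
  define m where "m = (LEAST k. 0 < k \<and> P ((f ^^ k) x))"
  have "0 < m \<and> P ((f ^^ m) x)" unfolding m_def by (rule LeastI[of _ k]) (use assms in simp)
  moreover have "m \<le> k" unfolding m_def by (rule Least_le) (use assms in simp)
  moreover have "\<not> P ((f ^^ j) x)" if "0 < j" "j < m" for j
    using not_less_Least[of j "\<lambda>k. 0 < k \<and> P ((f ^^ k) x)"] that by (simp add: m_def)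
  moreover have "next_in P f x = (f ^^ m) x" by (simp add: next_in_def m_def)
  ultimately show ?thesis using that by blast
qed

lemma next_in_eqI:
  assumes "0 < m" "P ((f ^^ m) x)" "\<And>j. 0 < j \<Longrightarrow> j < m \<Longrightarrow> \<not> P ((f ^^ j) x)"
  shows "next_in P f x = (f ^^ m) x"
proof -
  have "(LEAST k. 0 < k \<and> P ((f ^^ k) x)) = m"
    by (rule Least_equality) (use assms not_le_imp_less in auto)
  then show ?thesis by (simp add: next_in_def)
qed

lemma next_in_cong:
  assumes "\<And>k. P ((f ^^ k) x) \<longleftrightarrow> Q ((g ^^ k) x)" "\<And>k. (f ^^ k) x = (g ^^ k) x"
  shows "next_in P f x = next_in Q g x"
  unfolding next_in_def using assms by simp

lemma next_in_step:
  assumes "k > 0" "P ((f ^^ k) x)"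
  shows "next_in P f x = (if P (f x) then f x else next_in P f (f x))"
proof (cases "P (f x)")
  case True
  then show ?thesis using next_in_eqI[of 1 P f x] by simp
next
  case False
  obtain m where m: "0 < m" "P ((f ^^ m) x)" "next_in P f x = (f ^^ m) x"
    "\<And>j. 0 < j \<Longrightarrow> j < m \<Longrightarrow> \<not> P ((f ^^ j) x)"
    using next_in_spec[of k P f x, OF assms] by metis
  obtain n where n: "m = Suc n" using m(1) by (cases m) auto
  have "n > 0" using False m(2) n by (cases n) auto
  then have "next_in P f (f x) = (f ^^ n) (f x)"
  proof (rule next_in_eqI)
    show "P ((f ^^ n) (f x))" using m(2) n by (simp add: funpow_swap1)
    show "\<not> P ((f ^^ j) (f x))" if "0 < j" "j < n" for j
      using m(4)[of "Suc j"] n that by (simp add: funpow_swap1)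
  qed
  then show ?thesis using False m(3) n by (simp add: funpow_swap1)
qed

context
  fixes D S :: "'a set" and f :: "'a \<Rightarrow> 'a"
  assumes fin: "finite D" and bij: "bij_betw f D D" and S: "S \<subseteq> D"
begin

lemma next_in_return:
  assumes "x \<in> S"
  obtains m where "0 < m" "(f ^^ m) x \<in> S" "next_in (\<lambda>d. d \<in> S) f x = (f ^^ m) x"
    "\<And>j. 0 < j \<Longrightarrow> j < m \<Longrightarrow> (f ^^ j) x \<notin> S"
proof -
  obtain k where "k > 0" "(f ^^ k) x = x" using funpow_return[OF fin bij] assms S by blast
  then show ?thesis using next_in_spec[of k "\<lambda>d. d \<in> S" f x] assms that by metis
qed

text \<open>If two points of \<open>S\<close> have the same first return, then pulling back along
  the shorter path places one of them on the path of the other, strictly before its return unless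
  they coincide.\<close>

lemma bij_next_in: "bij_betw (next_in (\<lambda>d. d \<in> S) f) S S"
proof -
  let ?n = "next_in (\<lambda>d. d \<in> S) f"
  have into: "?n ` S \<subseteq> S" using next_in_return by (metis image_subsetI)
  have eq: "x = y" if xy: "x \<in> S" "y \<in> S" and a: "0 < a" "(f ^^ a) x = (f ^^ b) y" "a \<le> b"
    "\<And>j. 0 < j \<Longrightarrow> j < b \<Longrightarrow> (f ^^ j) y \<notin> S" for x y a b
  proof -
    have "(f ^^ a) x = (f ^^ a) ((f ^^ (b - a)) y)" using a
      by (simp flip: funpow_add[THEN fun_cong, unfolded comp_def])
    then have x: "x = (f ^^ (b - a)) y"
      using funpow_inj[OF bij] xy S funpow_closed[OF bij] by blast
    then have "\<not> 0 < b - a" using a(1,3) a(4)[of "b - a"] xy(1) by force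
    then show "x = y" using x by simp
  qed
  have "inj_on ?n S"
  proof (rule inj_onI)
    fix x y assume xy: "x \<in> S" "y \<in> S" "?n x = ?n y"
    obtain a where a: "0 < a" "?n x = (f ^^ a) x" "\<And>j. 0 < j \<Longrightarrow> j < a \<Longrightarrow> (f ^^ j) x \<notin> S"
      using next_in_return[OF xy(1)] by metis
    obtain b where b: "0 < b" "?n y = (f ^^ b) y" "\<And>j. 0 < j \<Longrightarrow> j < b \<Longrightarrow> (f ^^ j) y \<notin> S"
      using next_in_return[OF xy(2)] by metis
    have ab: "(f ^^ a) x = (f ^^ b) y" using a(2) b(2) xy(3) by simp
    show "x = y"
    proof (cases "a \<le> b")
      case True
      show ?thesis by (rule eq[OF xy(1,2) a(1) ab True b(3)])
    next
      case False
      then have "b \<le> a" by simp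
      show ?thesis by (rule eq[OF xy(2,1) b(1) ab[symmetric] \<open>b \<le> a\<close> a(3), symmetric])
    qed
  qed
  moreover have "finite S" using S fin finite_subset by blast
  ultimately show ?thesis using endo_inj_surj[OF _ into] by (simp add: bij_betw_def)
qed

lemma orb_next_in:
  assumes "x \<in> S"
  shows "orb (next_in (\<lambda>d. d \<in> S) f) x = orb f x \<inter> S"
proof
  let ?n = "next_in (\<lambda>d. d \<in> S) f"
  show "orb ?n x \<subseteq> orb f x \<inter> S"
  proof (rule orb_subset)
    fix y assume y: "y \<in> orb f x \<inter> S"
    then obtain m where m: "?n y = (f ^^ m) y" "(f ^^ m) y \<in> S" using next_in_return by (metis IntD2)
    then have "?n y \<in> orb f y" by simp
    then show "?n y \<in> orb f x \<inter> S" using y m orb_subset_orb by (metis IntD1 IntI subset_iff)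
  qed (use assms in simp)
  have "(f ^^ n) x \<in> orb ?n x" if "(f ^^ n) x \<in> S" "x \<in> S" for n x
    using that
  proof (induction n arbitrary: x rule: less_induct)
    case (less n)
    show ?case
    proof (cases "n = 0")
      case False
      obtain m where m: "0 < m" "m \<le> n" "?n x = (f ^^ m) x" "(f ^^ m) x \<in> S"
        using next_in_spec[of n "\<lambda>d. d \<in> S" f x] False less.prems by (metis neq0_conv)
      have e: "(f ^^ (n - m)) (?n x) = (f ^^ n) x"
        using m by (simp flip: funpow_add[THEN fun_cong, unfolded comp_def])
      have "(f ^^ (n - m)) (?n x) \<in> orb ?n (?n x)"
        by (rule less.IH) (use m less.prems e in simp_all)
      then show ?thesis using e orb_subset_orb[OF orb_step[OF orb_self]] by (metis subset_iff)
    qed simp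
  qed
  then show "orb f x \<inter> S \<subseteq> orb ?n x" using assms by (auto simp: orb_def[of f])
qed

end

lemma card_orb_next_in:
  assumes "finite D" "bij_betw f D D" "S \<subseteq> D"
  shows "card (orb (next_in (\<lambda>d. d \<in> S) f) ` S) = card (orb f ` S)"
proof -
  have "orb (next_in (\<lambda>d. d \<in> S) f) ` S = (\<lambda>v. v \<inter> S) ` orb f ` S"
    using orb_next_in[OF assms] by (auto simp: image_image)
  moreover have "inj_on (\<lambda>v. v \<inter> S) (orb f ` S)"
  proof (rule inj_onI)
    fix v w assume vw: "v \<in> orb f ` S" "w \<in> orb f ` S" "v \<inter> S = w \<inter> S"
    then obtain x y where xy: "x \<in> S" "v = orb f x" "y \<in> S" "w = orb f y" by blast
    have "x \<in> v \<inter> S" using xy(1,2) by simp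
    then have "x \<in> orb f y" unfolding vw(3) using xy(4) by simp
    moreover have "y \<in> D" using xy(3) assms(3) by blast
    ultimately show "v = w" using orb_eq_iff[OF assms(1,2), of y x] xy(2,4) by simp
  qed
  ultimately show ?thesis by (simp add: card_image)
qed

section \<open>Rotating and turning left from tail to tail is acyclic\<close>

text \<open>The corner of a head lies in the face to the right of its edge. Thus
  \<open>tails_R\<close> says that the root-face is never on the right of an edge, which is the
  condition on outer edges.\<close>

locale cw_fro = fro +
  assumes tails_R: "\<And>h. h \<in> R \<Longrightarrow> \<not> head M h"
    and acc: "accessible M" and dual: "dual_accessible M"

lemma calO_iff: "M \<in> calO \<longleftrightarrow> cw_fro M"
proof -
  have "cw_minimal M \<longleftrightarrow> dual_accessible M \<and> (\<forall>h\<in>root_face M. \<not> head M h)" if "is_fro M"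
  proof -
    interpret fro M using that by unfold_locales
    have "minimal M \<longleftrightarrow> dual_accessible M" using minimalI dual_accessibleI by blast
    then show ?thesis unfolding cw_minimal_def using R_D by blast
  qed
  then show ?thesis by (auto simp: calO_def cw_fro_def cw_fro_axioms_def fro_def)
qed

context cw_fro
begin

text \<open>The tails off the root face form a forest under this relation: rotating clockwise around the
  vertex of a tail, or following it to the next corner of its left face, leads to its children.\<close>

definition child :: "('a \<times> 'a) set" where
  "child = {(y, x). x \<in> D \<and> y \<in> D \<and> \<not> head M x \<and> \<not> head M y \<and> x \<notin> R \<and> (y = ph x \<or> y = sg x)}"

lemma head_notin_R: "x \<in> D \<Longrightarrow> head M x \<Longrightarrow> x \<notin> R"
  using tails_R by blast

lemma sg_notin_R: "x \<in> D \<Longrightarrow> \<not> head M x \<Longrightarrow> sg x \<notin> R"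
  using R_ph[of "al x"] head_notin_R[of "al x"] by (simp add: ph_al)

text \<open>At an outer vertex the preceding edge of the root contour arrives, being traversed from
  its tail. Any other vertex is the end of a nonempty directed path.\<close>

lemma vert_has_head:
  assumes "d \<in> D" shows "\<exists>h\<in>vert M d. head M h"
proof -
  have R: "\<exists>h\<in>vert M r. head M h" if r: "r \<in> R" for r
  proof -
    obtain y where y: "y \<in> orb ph r" "ph y = r" using orb_preimage[OF fin bij_ph] R_D[OF r] by blast
    have "y \<in> R" using y(1) face_R[OF r] by (simp add: face_def)
    then have "head M (al y)" "sg (al y) = r" "al y \<in> D" using y(2) tails_R by (auto simp: sg_al)
    then show ?thesis using vert_sg[of "al y"] vert_self by metis
  qed
  obtain r where r: "r \<in> R" "(vert M r, vert M d) \<in> (dstep M)\<^sup>*"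
    using acc assms unfolding accessible_def by blast
  from r(2) show ?thesis
  proof cases
    case base
    then show ?thesis using R[OF r(1)] by metis
  next
    case (step v)
    then obtain t where t: "t \<in> D" "\<not> head M t" "vert M d = vert M (al t)" by (auto simp: dstep_def)
    then show ?thesis by (intro bexI[of _ "al t"]) simp_all
  qed
qed

text \<open>The preimages of \<open>z\<close> under \<open>sg\<close> and under \<open>ph\<close>
  are the two darts of one edge. Exactly one of them is a tail, so \<open>z\<close> has a unique
  possible parent.\<close>

definition pred :: "'a \<Rightarrow> 'a" where
  "pred z = (let y = inv_into D sg z in if head M y then al y else y)"

lemma pred:
  assumes "z \<in> D"
  shows "pred z \<in> D" "\<not> head M (pred z)" "z = ph (pred z) \<or> z = sg (pred z)"
proof -
  let ?y = "inv_into D sg z"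
  have y: "?y \<in> D" "sg ?y = z" using assms bij_sg
    by (auto simp: bij_betw_def f_inv_into_f inv_into_into)
  show "pred z \<in> D" "\<not> head M (pred z)" using y by (auto simp: pred_def Let_def)
  show "z = ph (pred z) \<or> z = sg (pred z)" using y by (auto simp: pred_def Let_def ph_al)
qed

lemma pred_ph: "x \<in> D \<Longrightarrow> \<not> head M x \<Longrightarrow> pred (ph x) = x"
  and pred_sg: "x \<in> D \<Longrightarrow> \<not> head M x \<Longrightarrow> pred (sg x) = x"
proof -
  have i: "inv_into D sg (sg y) = y" if "y \<in> D" for y
    using bij_sg that by (simp add: bij_betw_inv_into_left)
  show "x \<in> D \<Longrightarrow> \<not> head M x \<Longrightarrow> pred (sg x) = x" by (simp add: pred_def i)
  show "x \<in> D \<Longrightarrow> \<not> head M x \<Longrightarrow> pred (ph x) = x" using i[of "al x"] by (simp add: pred_def sg_al)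
qed

text \<open>Regard a cycle \<open>X\<close> as a closed curve that follows the edges of
  \<open>W\<close> and rotates elsewhere. By \<open>separation\<close>, the component
  \<open>L\<close> to its left contains no \<open>al t\<close> with \<open>t\<close> in
  \<open>W\<close>. Dual steps cannot enter \<open>L\<close>, so it must contain the root-face. Then
  directed paths from outer vertices never reach a corner outside \<open>L\<close>, since they would
  have to arrive at a dart of \<open>X\<close>, and \<open>X\<close> contains neither heads nor
  root-face darts. This contradicts the accessibility of the end of an edge of
  \<open>W\<close>.\<close>

lemma acyclic_child: "acyclic child"
proof (rule acyclicI, rule allI, rule notI)
  fix x0 assume "(x0, x0) \<in> child\<^sup>+"
  define I where "I = {x \<in> D. \<not> head M x \<and> x \<notin> R}"
  have childI: "pred y = x \<and> x \<in> I \<and> y \<in> I" if "(y, x) \<in> child" for x y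
    using that pred_ph pred_sg sg_notin_R unfolding child_def I_def by auto
  have "\<exists>m>0. (pred ^^ m) y = x \<and> (\<forall>j\<le>m. (pred ^^ j) y \<in> I)" if "(y, x) \<in> child\<^sup>+" for x y
    using that
  proof (induction rule: trancl_induct)
    case (base z)
    then have "(pred ^^ 1) y = z \<and> (\<forall>j\<le>1. (pred ^^ j) y \<in> I)"
      using childI[OF base] by (auto simp: le_Suc_eq)
    then show ?case by (metis zero_less_one)
  next
    case (step z w)
    then obtain m where m: "m > 0" "(pred ^^ m) y = z" "\<forall>j\<le>m. (pred ^^ j) y \<in> I" by blast
    have "(pred ^^ Suc m) y = w \<and> (\<forall>j\<le>Suc m. (pred ^^ j) y \<in> I)"
      using childI[OF step(2)] m by (auto simp: le_Suc_eq)
    then show ?case by (metis zero_less_Suc)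
  qed
  then obtain m where m: "m > 0" "(pred ^^ m) x0 = x0" "\<And>j. j \<le> m \<Longrightarrow> (pred ^^ j) x0 \<in> I"
    using \<open>(x0, x0) \<in> child\<^sup>+\<close> by blast
  define X where "X = (\<lambda>j. (pred ^^ j) x0) ` {..<m}"
  have XI: "X \<subseteq> I" using m(3) by (auto simp: X_def)
  have x0: "x0 \<in> X" unfolding X_def by (rule image_eqI[of _ _ 0]) (use m in auto)
  have pX: "pred x \<in> X" if xX: "x \<in> X" for x
  proof -
    obtain j where j: "j < m" "x = (pred ^^ j) x0" using xX unfolding X_def by blast
    show ?thesis
    proof (cases "Suc j = m")
      case True
      then have "pred x = x0" using j m(2) by auto
      then show ?thesis using x0 by simp
    next
      case False
      then have "Suc j < m" "pred x = (pred ^^ Suc j) x0" using j by auto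
      then show ?thesis unfolding X_def by blast
    qed
  qed
  have sX: "\<exists>w\<in>X. pred w = x" if xX: "x \<in> X" for x
  proof -
    obtain j where j: "j < m" "x = (pred ^^ j) x0" using xX unfolding X_def by blast
    show ?thesis
    proof (cases j)
      case 0
      then have "x = (pred ^^ Suc (m - 1)) x0" using j m by simp
      then have "pred ((pred ^^ (m - 1)) x0) = x" by simp
      moreover have "(pred ^^ (m - 1)) x0 \<in> X" using m(1) by (simp add: X_def)
      ultimately show ?thesis by blast
    next
      case (Suc i)
      then have "pred ((pred ^^ i) x0) = x" "(pred ^^ i) x0 \<in> X" using j by (auto simp: X_def)
      then show ?thesis by blast
    qed
  qed
  have "pred ` X = X" using pX sX by blast
  then have injX: "inj_on pred X" by (intro eq_card_imp_inj_on) (auto simp: X_def)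
  have XD: "x \<in> D" "\<not> head M x" "x \<notin> R" if "x \<in> X" for x using XI that by (auto simp: I_def)
  define W where "W = {x \<in> X. ph x \<in> X}"
  have sgX: "sg x \<in> X" if x: "x \<in> X" "x \<notin> W" for x
  proof -
    obtain w where w: "w \<in> X" "pred w = x" using sX[OF x(1)] by blast
    then show ?thesis using pred(3)[of w] XD(1)[OF w(1)] x by (auto simp: W_def)
  qed
  have WD: "W \<subseteq> D" using XD by (auto simp: W_def)
  have XalW: "X \<inter> al ` W = {}"
  proof -
    have False if "x \<in> X" "w \<in> W" "x = al w" for x w
      using that XD(2)[of x] XD(1,2)[of w] by (simp add: W_def)
    then show ?thesis by blast
  qed
  have sep: "(t, al t) \<notin> avoid W" if "t \<in> W" for t
    by (rule separation[OF WD, of X]) (use XD sgX XalW that in \<open>auto simp: W_def\<close>)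
  have conn1: "(pred w, w) \<in> avoid W" if w: "w \<in> X" for w
  proof -
    let ?q = "pred w"
    have q: "?q \<in> X" "?q \<in> D" "\<not> head M ?q" using pX[OF w] XD by auto
    show ?thesis
    proof (cases "w = ph ?q")
      case True
      then show ?thesis using avoid_ph[OF q(2), of W] by simp
    next
      case False
      then have ws: "w = sg ?q" using pred(3)[of w] XD w by auto
      have "?q \<notin> W"
      proof
        assume "?q \<in> W"
        then have "ph ?q \<in> X" by (simp add: W_def)
        moreover have "pred (ph ?q) = pred w" using pred_ph[OF q(2,3)] by simp
        ultimately show False using injX w False by (metis inj_onD)
      qed
      moreover have "al ?q \<notin> W" using XD(2)[of "al ?q"] q by (auto simp: W_def)
      ultimately have "(?q, al ?q) \<in> avoid W" using avoid_al[OF WD q(2)] by blast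
      moreover have "(al ?q, w) \<in> avoid W" using avoid_ph[of "al ?q" W] q ph_al[of ?q] ws by simp
      ultimately show ?thesis by (rule avoid_trans)
    qed
  qed
  define L where "L = {y. (x0, y) \<in> avoid W}"
  have XL: "X \<subseteq> L"
  proof -
    have "(pred ^^ j) x0 \<in> L" if "j < m" for j
      using that
    proof (induction j)
      case (Suc j)
      have "(pred ^^ j) x0 \<in> X" using Suc.prems by (simp add: X_def)
      from avoid_sym[OF conn1[OF this]] have "((pred ^^ j) x0, (pred ^^ Suc j) x0) \<in> avoid W" by simp
      then show ?case using Suc avoid_trans by (auto simp: L_def)
    qed (simp add: L_def avoid_def)
    then show ?thesis by (auto simp: X_def)
  qed
  have L_ph: "ph y \<in> L \<longleftrightarrow> y \<in> L" if "y \<in> D" for y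
    using avoid_ph[OF that, of W] avoid_sym[of y "ph y" W] avoid_trans[of x0 _ W] unfolding L_def by blast
  have L_al: "al y \<in> L \<longleftrightarrow> y \<in> L" if "y \<in> D" "y \<notin> W" "al y \<notin> W" for y
    using avoid_al[OF WD that] avoid_sym[of y "al y" W] avoid_trans[of x0 _ W] unfolding L_def by blast
  have alW: "al t \<notin> L" if "t \<in> W" for t
  proof
    assume "al t \<in> L"
    then have "(x0, al t) \<in> avoid W" by (simp add: L_def)
    moreover have "(t, x0) \<in> avoid W" using XL that avoid_sym by (auto simp: L_def W_def)
    ultimately show False using sep[OF that] avoid_trans by blast
  qed
  \<comment> \<open>A cycle that only rotates would be a whole vertex consisting of tails.\<close>
  have "W \<noteq> {}"
  proof
    assume "W = {}"
    then have "vert M x0 \<subseteq> X" unfolding vert_def by (intro orb_subset) (use x0 sgX in auto)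
    then show False using vert_has_head[of x0] XD x0 by blast
  qed
  then obtain t where t: "t \<in> W" by blast
  show False
  proof (cases "root M \<in> L")
    case False
    have "y \<notin> L" if "(root M, y) \<in> (dual_step M)\<^sup>*" for y
      using that
    proof induction
      case (step y z)
      from step(2) consider "y \<in> D" "z = ph y" | "y \<in> D" "z = al y" "\<not> head M y"
        by (auto simp: dual_step_def)
      then show ?case
      proof cases
        case 1
        then show ?thesis using L_ph step.IH by simp
      next
        case 2
        have "y \<notin> W" using step.IH XL by (auto simp: W_def)
        moreover have "al y \<notin> W" using XD(2)[of "al y"] 2 by (auto simp: W_def)
        ultimately show ?thesis using L_al 2 step.IH by simp
      qed
    qed (rule False)
    then show False using dual x0 XL XD(1) unfolding dual_accessible_def by blast
  next
    case True
    then have RL: "R \<subseteq> L"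
    proof -
      have "R \<subseteq> L \<inter> D" unfolding root_face_def face_def
        by (rule orb_subset) (use True rt L_ph in auto)
      then show ?thesis by blast
    qed
    \<comment> \<open>Clockwise rotation enters \<open>L\<close> only across an edge of
      \<open>W\<close>, landing in \<open>X\<close>, and then runs through \<open>X\<close> until an
      edge of \<open>W\<close> leads out of \<open>L\<close> again.\<close>
    have rot: "u \<in> X" if u: "u \<in> L" "u \<in> D" and u': "u' \<in> vert M u" "u' \<notin> L" for u u'
    proof -
      have u'D: "u' \<in> D" using u' vert_closed[OF u(2)] by blast
      have "(sg ^^ k) u' \<in> L \<longrightarrow> (sg ^^ k) u' \<in> X" for k
      proof (induction k)
        case (Suc k)
        let ?z = "(sg ^^ k) u'"
        have z: "?z \<in> D" using funpow_closed[OF bij_sg u'D] .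
        show ?case
        proof
          assume "(sg ^^ Suc k) u' \<in> L"
          then have sz: "sg ?z \<in> L" by simp
          then have az: "al ?z \<in> L" using L_ph[of "al ?z"] z by (simp add: ph_al)
          have "sg ?z \<in> X"
          proof (cases "?z \<in> L")
            case True
            then have "?z \<in> X" using Suc by simp
            moreover have "?z \<notin> W" using alW az by blast
            ultimately show ?thesis by (rule sgX)
          next
            case False
            then have "?z \<notin> W" using XL by (auto simp: W_def)
            then have "al ?z \<in> W" using L_al[OF z] az False by blast
            then show ?thesis using z by (simp add: W_def ph_al)
          qed
          then show "(sg ^^ Suc k) u' \<in> X" by simp
        qed
      qed (use u' in simp)
      moreover have "u \<in> orb sg u'" using orb_sym[OF fin bij_sg u(2)] u'(1) by (simp add: vert_def)
      ultimately show ?thesis using u(1) by (auto simp: orb_def)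
    qed
    have "\<forall>y\<in>D. vert M y = v \<longrightarrow> y \<in> L" if "r \<in> R" "(vert M r, v) \<in> (dstep M)\<^sup>*" for r v
      using that(2)
    proof induction
      case base
      show ?case
      proof (intro ballI impI)
        fix y assume y: "y \<in> D" "vert M y = vert M r"
        show "y \<in> L"
        proof (rule ccontr)
          assume "y \<notin> L"
          moreover have "y \<in> vert M r" using y vert_eq_iff that(1) by simp
          ultimately have "r \<in> X" using rot[of r y] that(1) RL by auto
          then show False using XD that(1) by blast
        qed
      qed
    next
      case (step v w)
      then obtain s where s: "s \<in> D" "\<not> head M s" "v = vert M s" "w = vert M (al s)"
        by (auto simp: dstep_def)
      have "sg s \<in> L" using step.IH s vert_sg by simp
      then have as: "al s \<in> L" using L_ph[of "al s"] s by (simp add: ph_al)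
      show ?case
      proof (intro ballI impI)
        fix y assume y: "y \<in> D" "vert M y = w"
        show "y \<in> L"
        proof (rule ccontr)
          assume "y \<notin> L"
          moreover have "y \<in> vert M (al s)" using y vert_eq_iff s by simp
          ultimately have "al s \<in> X" using rot[of "al s" y] s as by auto
          then show False using XD(2)[of "al s"] s by simp
        qed
      qed
    qed
    moreover have tD: "t \<in> D" using t WD by blast
    moreover obtain r where "r \<in> R" "(vert M r, vert M (al t)) \<in> (dstep M)\<^sup>*"
      using acc tD al(1)[OF tD] unfolding accessible_def by blast
    ultimately have "al t \<in> L" by simp
    then show False using alW t by blast
  qed
qed

lemma wf_child: "wf child"
proof (rule finite_acyclic_wf[OF _ acyclic_child])
  have "child \<subseteq> D \<times> D" by (auto simp: child_def)
  then show "finite child" using fin finite_subset by blast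
qed

end

section \<open>Mobiles in terms of black darts\<close>

text \<open>For permutations of a finite set every backward step is a sequence of forward steps, so
  directed reachability is already symmetric.\<close>

lemma connected_darts_iff:
  assumes "finite D" "bij_betw a D D" "bij_betw s D D"
  shows "connected_darts D a s \<longleftrightarrow> (\<forall>x\<in>D. \<forall>y\<in>D. (x, y) \<in> eqv (gr a D \<union> gr s D))"
proof -
  let ?r = "gr a D \<union> gr s D"
  have r: "{(d, a d) | d. d \<in> D} \<union> {(d, s d) | d. d \<in> D} = ?r" by (simp add: gr_def)
  have rev: "(f x, x) \<in> ?r\<^sup>*" if f: "bij_betw f D D" "gr f D \<subseteq> ?r" and x: "x \<in> D" for f x
  proof -
    have "orb f (f x) \<subseteq> {y \<in> D. (f x, y) \<in> ?r\<^sup>*}"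
    proof (rule orb_subset)
      fix y assume y: "y \<in> {y \<in> D. (f x, y) \<in> ?r\<^sup>*}"
      then have "(y, f y) \<in> ?r" using f(2) by (auto simp: gr_def)
      then show "f y \<in> {y \<in> D. (f x, y) \<in> ?r\<^sup>*}"
        using y bij_betwE[OF f(1)] by (auto intro: rtrancl_into_rtrancl)
    qed (use x bij_betwE[OF f(1)] in auto)
    moreover have "x \<in> orb f (f x)"
      by (rule orb_sym[OF assms(1) f(1) x orb_step[OF orb_self]])
    ultimately show ?thesis by blast
  qed
  have "(x, y) \<in> ?r\<^sup>*" if "(x, y) \<in> eqv ?r" for x y
    using that unfolding eqv_def
  proof induction
    case (step y z)
    have "(y, z) \<in> ?r\<^sup>*"
    proof (cases "(y, z) \<in> ?r")
      case False
      then have "(z, y) \<in> ?r" using step(2) by simp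
      then consider "z \<in> D" "y = a z" | "z \<in> D" "y = s z" by (auto simp: gr_def)
      then show ?thesis by cases (use rev[OF assms(2)] rev[OF assms(3)] in auto)
    qed (rule r_into_rtrancl)
    then show ?case using step.IH by (rule rtrancl_trans[rotated])
  qed simp
  moreover have "(x, y) \<in> eqv ?r" if "(x, y) \<in> ?r\<^sup>*" for x y
    using that unfolding eqv_def by (rule rtrancl_mono[THEN subsetD, rotated]) auto
  ultimately show ?thesis unfolding connected_darts_def r by blast
qed

lemma orb_image:
  assumes "\<And>b. b \<in> B \<Longrightarrow> f b \<in> B \<and> g (f b) = f' (g b)" "x \<in> B"
  shows "orb f' (g x) = g ` orb f x"
proof -
  have "(f ^^ n) x \<in> B \<and> (f' ^^ n) (g x) = g ((f ^^ n) x)" for n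
    by (induction n) (use assms in auto)
  then show ?thesis by (auto simp: orb_def image_iff)
qed

lemma card_orb_image:
  assumes "\<And>b. b \<in> B \<Longrightarrow> f b \<in> B \<and> g (f b) = f' (g b)" "inj_on g B"
  shows "card (orb f' ` g ` B) = card (orb f ` B)"
proof -
  have "orb f' ` g ` B = (`) g ` orb f ` B"
    using orb_image[of B f g f'] assms(1) by (simp add: image_image cong: image_cong)
  moreover have "\<Union> (orb f ` B) \<subseteq> B" using orb_subset[of _ B f] assms(1) by blast
  then have "inj_on ((`) g) (orb f ` B)"
    using inj_on_image[of g "orb f ` B"] inj_on_subset[OF assms(2)] by blast
  ultimately show ?thesis by (simp add: card_image)
qed

text \<open>A mobile is determined by its black darts \<open>B\<close>, the set \<open>H\<close> of those which are not buds, the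
  rotation \<open>om\<close> around white vertices transported to \<open>H\<close>, and the rotation \<open>bl\<close> around black
  vertices.\<close>

definition amob :: "'a set \<Rightarrow> 'a set \<Rightarrow> ('a \<Rightarrow> 'a) \<Rightarrow> ('a \<Rightarrow> 'a) \<Rightarrow> bool" where
  "amob B H om bl \<longleftrightarrow> finite B \<and> H \<subseteq> B \<and> bij_betw om H H \<and> bij_betw bl B B \<and>
     (\<forall>x\<in>B. \<forall>y\<in>B. (x, y) \<in> eqv (gr om H \<union> gr bl B)) \<and>
     card (orb om ` H) + card (orb bl ` B) = card H + 1"

definition amob_iso where
  "amob_iso g B1 H1 om1 bl1 B2 H2 om2 bl2 \<longleftrightarrow> bij_betw g B1 B2 \<and>
     (\<forall>b\<in>B1. g b \<in> H2 \<longleftrightarrow> b \<in> H1) \<and> (\<forall>h\<in>H1. g (om1 h) = om2 (g h)) \<and>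
     (\<forall>b\<in>B1. g (bl1 b) = bl2 (g b))"

text \<open>The conditions that can be checked dart by dart. The tree property is established
  separately, in terms of \<open>amob\<close>.\<close>

definition premob :: "'m mobile \<Rightarrow> bool" where
  "premob T \<longleftrightarrow> finite (mdarts T) \<and>
     (\<forall>d\<in>mdarts T. malpha T d \<in> mdarts T \<and> malpha T (malpha T d) = d) \<and>
     bij_betw (msigma T) (mdarts T) (mdarts T) \<and>
     (\<forall>d\<in>mdarts T. mwhite T (msigma T d) = mwhite T d) \<and>
     (\<forall>d\<in>mdarts T. malpha T d \<noteq> d \<longrightarrow> mwhite T (malpha T d) \<noteq> mwhite T d) \<and>
     (\<forall>d\<in>mdarts T. malpha T d = d \<longrightarrow> \<not> mwhite T d)"

text \<open>A white dart is named by the black end of its edge; \<open>om\<close> is the white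
  rotation read at the black ends.\<close>

definition rep :: "'m mobile \<Rightarrow> 'b set \<Rightarrow> 'b set \<Rightarrow> ('b \<Rightarrow> 'b) \<Rightarrow> ('b \<Rightarrow> 'b) \<Rightarrow> ('b \<Rightarrow> 'm) \<Rightarrow> bool" where
  "rep T B H om bl e \<longleftrightarrow> bij_betw e B {d \<in> mdarts T. \<not> mwhite T d} \<and>
     H = {b \<in> B. malpha T (e b) \<noteq> e b} \<and>
     (\<forall>h\<in>H. om h \<in> H \<and> malpha T (e (om h)) = msigma T (malpha T (e h))) \<and>
     (\<forall>b\<in>B. bl b \<in> B \<and> e (bl b) = msigma T (e b))"

lemma is_pb_mobile_iff:
  "is_pb_mobile T \<longleftrightarrow> premob T \<and> connected_darts (mdarts T) (malpha T) (msigma T) \<and>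
     card (orb (msigma T) ` mdarts T) = num_edges T + 1"
  by (auto simp: is_pb_mobile_def premob_def)

locale represented =
  fixes T :: "'m mobile" and B H :: "'b set" and om bl :: "'b \<Rightarrow> 'b" and e :: "'b \<Rightarrow> 'm"
  assumes pre: "premob T" and rep: "rep T B H om bl e"
begin

abbreviation "a \<equiv> malpha T"
abbreviation "s \<equiv> msigma T"
abbreviation "Bl \<equiv> {d \<in> mdarts T. \<not> mwhite T d}"
abbreviation "Wh \<equiv> {d \<in> mdarts T. mwhite T d}"

definition node :: "'m \<Rightarrow> 'b" where
  "node d = inv_into B e (if mwhite T d then a d else d)"

lemma fin: "finite (mdarts T)" and bij_s: "bij_betw s (mdarts T) (mdarts T)"
  using pre by (auto simp: premob_def)

lemma a [simp]: "d \<in> mdarts T \<Longrightarrow> a d \<in> mdarts T" "d \<in> mdarts T \<Longrightarrow> a (a d) = d"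
  using pre by (auto simp: premob_def)

lemma s_closed [simp]: "d \<in> mdarts T \<Longrightarrow> s d \<in> mdarts T"
  using bij_s bij_betwE by blast

lemma white_s [simp]: "d \<in> mdarts T \<Longrightarrow> mwhite T (s d) = mwhite T d"
  using pre by (auto simp: premob_def)

lemma white_a: "d \<in> mdarts T \<Longrightarrow> mwhite T d \<Longrightarrow> \<not> mwhite T (a d)"
  using pre unfolding premob_def by metis

lemma bij_e: "bij_betw e B Bl" and H_def: "H = {b \<in> B. a (e b) \<noteq> e b}"
  and om: "h \<in> H \<Longrightarrow> om h \<in> H" "h \<in> H \<Longrightarrow> a (e (om h)) = s (a (e h))"
  and bl: "b \<in> B \<Longrightarrow> bl b \<in> B" "b \<in> B \<Longrightarrow> e (bl b) = s (e b)"
  using rep unfolding rep_def by blast+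

lemma HB: "h \<in> H \<Longrightarrow> h \<in> B"
  by (simp add: H_def)

lemma e_in: "b \<in> B \<Longrightarrow> e b \<in> mdarts T" "b \<in> B \<Longrightarrow> \<not> mwhite T (e b)"
  using bij_e bij_betwE by blast+

lemma finB: "finite B"
  using bij_betw_finite[OF bij_e] fin by simp

lemma inj_e: "inj_on e B"
  using bij_e by (simp add: bij_betw_def)

lemma ae: "h \<in> H \<Longrightarrow> mwhite T (a (e h))"
  using pre e_in[of h] unfolding premob_def by (auto simp: H_def)

lemma bij_ae: "bij_betw (\<lambda>h. a (e h)) H Wh"
  unfolding bij_betw_def
proof
  show "inj_on (\<lambda>h. a (e h)) H"
  proof (rule inj_onI)
    fix x y assume xy: "x \<in> H" "y \<in> H" "a (e x) = a (e y)"
    then have "e x = e y" using a(2) e_in(1) HB by metis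
    then show "x = y" using inj_e xy HB by (metis inj_onD)
  qed
  show "(\<lambda>h. a (e h)) ` H = Wh"
  proof
    show "(\<lambda>h. a (e h)) ` H \<subseteq> Wh" using ae e_in HB by auto
    show "Wh \<subseteq> (\<lambda>h. a (e h)) ` H"
    proof
      fix d assume d: "d \<in> Wh"
      then have ad: "a d \<in> Bl" using white_a by simp
      then obtain b where b: "b \<in> B" "e b = a d" using bij_e unfolding bij_betw_def by (metis imageE)
      then have "a (e b) = d" using d by simp
      moreover have "d \<noteq> a d" using ad d by auto
      ultimately have "b \<in> H" "d = a (e b)" using b by (simp_all add: H_def)
      then show "d \<in> (\<lambda>h. a (e h)) ` H" by blast
    qed
  qed
qed

lemma inj_ae: "inj_on (\<lambda>h. a (e h)) H"
  using bij_ae by (simp add: bij_betw_def)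

lemma bij_om: "bij_betw om H H"
proof -
  have "inj_on om H"
  proof (rule inj_onI)
    fix x y assume xy: "x \<in> H" "y \<in> H" "om x = om y"
    then have "s (a (e x)) = s (a (e y))" using om(2) by metis
    then have "a (e x) = a (e y)"
      using bij_s e_in(1) HB xy a(1) unfolding bij_betw_def by (metis inj_onD)
    then show "x = y" using inj_ae xy by (metis (mono_tags, lifting) inj_onD)
  qed
  moreover have "finite H" using finB finite_subset[of H B] HB by blast
  ultimately show ?thesis using endo_inj_surj[of H om] om(1) by (auto simp: bij_betw_def)
qed

lemma bij_bl: "bij_betw bl B B"
proof -
  have "inj_on bl B"
  proof (rule inj_onI)
    fix x y assume xy: "x \<in> B" "y \<in> B" "bl x = bl y"
    then have "s (e x) = s (e y)" using bl(2) by metis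
    then have "e x = e y"
      using bij_s e_in(1) xy unfolding bij_betw_def by (metis inj_onD)
    then show "x = y" using inj_e xy by (metis (mono_tags, lifting) inj_onD)
  qed
  then show ?thesis using endo_inj_surj[OF finB, of bl] bl(1) by (auto simp: bij_betw_def)
qed

lemma node_e: "b \<in> B \<Longrightarrow> node (e b) = b"
  using e_in inj_e by (simp add: node_def)

lemma node_ae: "h \<in> H \<Longrightarrow> node (a (e h)) = h"
  using ae e_in[OF HB] inj_e HB by (simp add: node_def)

lemma dart_cases:
  assumes "d \<in> mdarts T"
  obtains b where "b \<in> B" "d = e b" | h where "h \<in> H" "d = a (e h)"
proof (cases "mwhite T d")
  case True
  then have "d \<in> (\<lambda>h. a (e h)) ` H" using bij_ae assms by (simp add: bij_betw_def)
  then show ?thesis using that by blast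
next
  case False
  then have "d \<in> e ` B" using bij_e assms by (simp add: bij_betw_def)
  then show ?thesis using that by blast
qed

lemma num_edges_eq: "num_edges T = card H"
proof -
  have "{d \<in> mdarts T. a d \<noteq> d} = e ` H \<union> (\<lambda>h. a (e h)) ` H"
  proof
    show "{d \<in> mdarts T. a d \<noteq> d} \<subseteq> e ` H \<union> (\<lambda>h. a (e h)) ` H"
    proof
      fix d assume d: "d \<in> {d \<in> mdarts T. a d \<noteq> d}"
      then have "d \<in> mdarts T" by simp
      then show "d \<in> e ` H \<union> (\<lambda>h. a (e h)) ` H"
        by (cases rule: dart_cases) (use d in \<open>auto simp: H_def\<close>)
    qed
    have "a (a (e h)) \<noteq> a (e h)" if "h \<in> H" for h
    proof -
      have "a (e h) \<noteq> e h" using that by (simp add: H_def)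
      then show ?thesis using a(2)[OF e_in(1)[OF HB[OF that]]] by metis
    qed
    then show "e ` H \<union> (\<lambda>h. a (e h)) ` H \<subseteq> {d \<in> mdarts T. a d \<noteq> d}"
    proof -
      have "a (e h) \<noteq> e h" if "h \<in> H" for h using that by (simp add: H_def)
      then have "e h \<in> {d \<in> mdarts T. a d \<noteq> d}" "a (e h) \<in> {d \<in> mdarts T. a d \<noteq> d}" if "h \<in> H" for h
        using that e_in(1)[OF HB] \<open>\<And>h. h \<in> H \<Longrightarrow> a (a (e h)) \<noteq> a (e h)\<close> by simp_all
      then show ?thesis by blast
    qed
  qed
  moreover have "e ` H \<inter> (\<lambda>h. a (e h)) ` H = {}"
  proof -
    have False if "x \<in> H" "h \<in> H" "e x = a (e h)" for x h
      using ae[OF that(2)] e_in(2)[OF HB[OF that(1)]] that(3) by simp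
    then show ?thesis by blast
  qed
  moreover have "H \<subseteq> B" using HB by blast
  then have "card (e ` H) = card H" "card ((\<lambda>h. a (e h)) ` H) = card H" "finite H"
    using card_image[OF inj_on_subset[OF inj_e]] card_image[OF inj_ae] finite_subset[OF _ finB]
    by blast+
  ultimately show ?thesis by (simp add: num_edges_def card_Un_disjoint)
qed

lemma num_buds_eq: "num_buds T = card (B - H)"
proof -
  have "{d \<in> mdarts T. a d = d} = e ` (B - H)"
  proof
    show "{d \<in> mdarts T. a d = d} \<subseteq> e ` (B - H)"
    proof
      fix d assume d: "d \<in> {d \<in> mdarts T. a d = d}"
      then have "d \<in> mdarts T" by simp
      then show "d \<in> e ` (B - H)"
      proof (cases rule: dart_cases)
        case (2 h)
        then have "a (e h) = e h" using d a(2)[OF e_in(1)[OF HB]] by auto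
        then show ?thesis using 2 by (simp add: H_def)
      qed (use d in \<open>auto simp: H_def\<close>)
    qed
  qed (use e_in in \<open>auto simp: H_def\<close>)
  then show ?thesis unfolding num_buds_def
    using card_image[OF inj_on_subset[OF inj_e], of "B - H"] by auto
qed

lemma excess_eq: "excess T = int (card H) - int (card (B - H))"
  by (simp add: excess_def num_edges_eq num_buds_eq)

lemma card_vertices: "card (orb s ` mdarts T) = card (orb om ` H) + card (orb bl ` B)"
proof -
  have "mdarts T = Wh \<union> Bl" by auto
  also have "Wh = (\<lambda>h. a (e h)) ` H" using bij_ae by (simp add: bij_betw_def)
  also have "Bl = e ` B" using bij_e by (simp add: bij_betw_def)
  finally have "orb s ` mdarts T = orb s ` (\<lambda>h. a (e h)) ` H \<union> orb s ` e ` B" by (simp add: image_Un)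
  moreover have "card (orb s ` (\<lambda>h. a (e h)) ` H) = card (orb om ` H)"
    by (rule card_orb_image[OF _ inj_ae]) (use om in auto)
  moreover have "card (orb s ` e ` B) = card (orb bl ` B)"
    by (rule card_orb_image[OF _ inj_e]) (use bl in auto)
  moreover have "orb s ` (\<lambda>h. a (e h)) ` H \<inter> orb s ` e ` B = {}"
  proof -
    have False if hb: "h \<in> H" "b \<in> B" "orb s (a (e h)) = orb s (e b)" for h b
    proof -
      have "orb s (e b) \<subseteq> Bl" by (rule orb_subset) (use hb e_in in auto)
      moreover have "a (e h) \<in> orb s (e b)" using orb_self hb(3) by metis
      ultimately show False using ae hb by blast
    qed
    then show ?thesis by blast
  qed
  moreover have "finite H" "finite B" using finB finite_subset[of H B] HB by blast+
  ultimately show ?thesis by (simp add: card_Un_disjoint)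
qed

lemma connected_iff:
  "connected_darts (mdarts T) a s \<longleftrightarrow> (\<forall>x\<in>B. \<forall>y\<in>B. (x, y) \<in> eqv (gr om H \<union> gr bl B))"
proof -
  let ?S = "gr om H \<union> gr bl B" and ?R = "gr a (mdarts T) \<union> gr s (mdarts T)"
  have R: "(d, a d) \<in> eqv ?R" "(d, s d) \<in> eqv ?R" if "d \<in> mdarts T" for d
    using that by (auto intro!: eqv_base)
  have "(node x, node y) \<in> eqv ?S" if xy: "(x, y) \<in> eqv ?R" "x \<in> mdarts T" for x y
  proof -
    have "y \<in> {d \<in> mdarts T. (node x, node d) \<in> eqv ?S}"
    proof (rule eqv_closed[OF xy(1)])
      fix u v assume "(u, v) \<in> ?R"
      then have u: "u \<in> mdarts T" "v = a u \<or> v = s u" by (auto simp: gr_def)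
      have "(node u, node (a u)) \<in> eqv ?S"
      proof (cases rule: dart_cases[OF u(1)])
        case (1 b)
        show ?thesis
        proof (cases "b \<in> H")
          case False
          then show ?thesis using 1 by (simp add: H_def)
        qed (use 1 node_e node_ae in simp)
      qed (use node_e node_ae HB e_in in simp)
      moreover have "(node u, node (s u)) \<in> eqv ?S"
      proof (cases rule: dart_cases[OF u(1)])
        case (1 b)
        then have "s u = e (bl b)" using bl by simp
        then have "node u = b" "node (s u) = bl b" using node_e[of "bl b"] node_e bl(1) 1 by simp_all
        then show ?thesis using 1 by (auto intro: eqv_base)
      next
        case (2 h)
        then have "s u = a (e (om h))" using om by simp
        then have "node u = h" "node (s u) = om h" using node_ae[of "om h"] node_ae om(1) 2 by simp_all
        then show ?thesis using 2 by (auto intro: eqv_base)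
      qed
      ultimately have uv: "(node u, node v) \<in> eqv ?S" using u(2) by auto
      have "v \<in> mdarts T" using u by auto
      then show "u \<in> {d \<in> mdarts T. (node x, node d) \<in> eqv ?S} \<longleftrightarrow>
          v \<in> {d \<in> mdarts T. (node x, node d) \<in> eqv ?S}"
        using u(1) eqv_trans[OF _ uv] eqv_trans[OF _ eqv_sym[OF uv]] by blast
    qed (use xy in simp)
    then show ?thesis by simp
  qed
  then have 1: "(x, y) \<in> eqv ?S" if "x \<in> B" "y \<in> B" "(e x, e y) \<in> eqv ?R" for x y
    using that node_e e_in by metis
  have 2: "(e x, e y) \<in> eqv ?R" if xy: "(x, y) \<in> eqv ?S" "x \<in> B" for x y
  proof -
    have "y \<in> {y \<in> B. (e x, e y) \<in> eqv ?R}"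
    proof (rule eqv_closed[OF xy(1)])
      fix u v assume "(u, v) \<in> ?S"
      then consider "u \<in> H" "v = om u" | "u \<in> B" "v = bl u" by (auto simp: gr_def)
      then have "u \<in> B \<and> v \<in> B \<and> (e u, e v) \<in> eqv ?R"
      proof cases
        case 1
        have D: "e u \<in> mdarts T" "e v \<in> mdarts T" using 1 e_in HB om by auto
        have "(e u, a (e u)) \<in> eqv ?R" "(a (e u), s (a (e u))) \<in> eqv ?R" using R D by auto
        then have "(e u, a (e v)) \<in> eqv ?R" using om(2)[OF 1(1)] 1 eqv_trans by metis
        moreover have "(a (e v), e v) \<in> eqv ?R" using R(1)[OF D(2)] by (rule eqv_sym)
        ultimately have "(e u, e v) \<in> eqv ?R" by (rule eqv_trans)
        then show ?thesis using 1 om HB by auto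
      next
        case 2
        then show ?thesis using R(2)[of "e u"] e_in bl by auto
      qed
      then have uv: "u \<in> B" "v \<in> B" "(e u, e v) \<in> eqv ?R" by auto
      then show "u \<in> {y \<in> B. (e x, e y) \<in> eqv ?R} \<longleftrightarrow> v \<in> {y \<in> B. (e x, e y) \<in> eqv ?R}"
        using eqv_trans[OF _ uv(3)] eqv_trans[OF _ eqv_sym[OF uv(3)]] by blast
    qed (use xy in simp)
    then show ?thesis by simp
  qed
  have 3: "\<exists>b\<in>B. (d, e b) \<in> eqv ?R" if "d \<in> mdarts T" for d
  proof (cases rule: dart_cases[OF that])
    case (1 b)
    have "(d, e b) \<in> eqv ?R" unfolding 1(2) by (rule eqv_refl)
    then show ?thesis using 1(1) by blast
  next
    case (2 h)
    then have "(d, e h) \<in> eqv ?R" using eqv_sym[OF R(1)[OF e_in(1)[OF HB]]] by simp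
    then show ?thesis using HB[OF 2(1)] by blast
  qed
  have "bij_betw a (mdarts T) (mdarts T)" by (rule bij_betw_byWitness[where f' = a]) auto
  note c = connected_darts_iff[OF fin this bij_s]
  show ?thesis unfolding c
  proof
    assume "\<forall>x\<in>mdarts T. \<forall>y\<in>mdarts T. (x, y) \<in> eqv ?R"
    then show "\<forall>x\<in>B. \<forall>y\<in>B. (x, y) \<in> eqv ?S" using 1 e_in by blast
  next
    assume h: "\<forall>x\<in>B. \<forall>y\<in>B. (x, y) \<in> eqv ?S"
    show "\<forall>x\<in>mdarts T. \<forall>y\<in>mdarts T. (x, y) \<in> eqv ?R"
    proof (intro ballI)
      fix x y assume "x \<in> mdarts T" "y \<in> mdarts T"
      then obtain b c where b: "b \<in> B" "(x, e b) \<in> eqv ?R" and c: "c \<in> B" "(y, e c) \<in> eqv ?R"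
        using 3 by metis
      have "(e b, e c) \<in> eqv ?R" using 2 h b c by blast
      from eqv_trans[OF eqv_trans[OF b(2) this] eqv_sym[OF c(2)]] show "(x, y) \<in> eqv ?R" .
    qed
  qed
qed

lemma is_pb_mobile_iff_amob: "is_pb_mobile T \<longleftrightarrow> amob B H om bl"
proof -
  have "H \<subseteq> B" using HB by blast
  then show ?thesis
    unfolding is_pb_mobile_iff amob_def connected_iff card_vertices num_edges_eq
    by (simp only: pre finB bij_om bij_bl simp_thms)
qed

end

text \<open>Every white dart is the partner of a black one, so an isomorphism is determined by its
  effect on black darts and extends from them.\<close>

lemma mobile_iso_iff:
  assumes "represented T1 B1 H1 om1 bl1 e1" "represented T2 B2 H2 om2 bl2 e2"
  shows "mobile_iso T1 T2 \<longleftrightarrow> (\<exists>g. amob_iso g B1 H1 om1 bl1 B2 H2 om2 bl2)"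
proof -
  interpret X: represented T1 B1 H1 om1 bl1 e1 by (rule assms(1))
  interpret Y: represented T2 B2 H2 om2 bl2 e2 by (rule assms(2))
  show ?thesis
  proof
    assume "mobile_iso T1 T2"
    then obtain G where G: "bij_betw G (mdarts T1) (mdarts T2)"
      "\<And>d. d \<in> mdarts T1 \<Longrightarrow> G (X.a d) = Y.a (G d)"
      "\<And>d. d \<in> mdarts T1 \<Longrightarrow> G (X.s d) = Y.s (G d)"
      "\<And>d. d \<in> mdarts T1 \<Longrightarrow> mwhite T2 (G d) = mwhite T1 d"
      unfolding mobile_iso_def by blast
    have Gin: "G d \<in> mdarts T2" if "d \<in> mdarts T1" for d using G(1) that bij_betwE by blast
    have "G ` X.Bl = Y.Bl"
    proof
      show "G ` X.Bl \<subseteq> Y.Bl" using Gin G(4) by auto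
      show "Y.Bl \<subseteq> G ` X.Bl"
      proof
        fix d assume d: "d \<in> Y.Bl"
        then obtain c where "c \<in> mdarts T1" "d = G c" using G(1) unfolding bij_betw_def by blast
        then show "d \<in> G ` X.Bl" using G(4) d by auto
      qed
    qed
    moreover have "inj_on G X.Bl" using G(1) unfolding bij_betw_def by (auto intro: inj_on_subset)
    ultimately have "bij_betw G X.Bl Y.Bl" by (simp add: bij_betw_def)
    then have bij: "bij_betw (inv_into B2 e2 \<circ> (G \<circ> e1)) B1 B2"
      by (rule bij_betw_trans[OF bij_betw_trans[OF X.bij_e] bij_betw_inv_into[OF Y.bij_e]])
    define g where "g = inv_into B2 e2 \<circ> (G \<circ> e1)"
    have gB: "g b \<in> B2" if "b \<in> B1" for b using bij that bij_betwE unfolding g_def by blast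
    have eg: "e2 (g b) = G (e1 b)" if "b \<in> B1" for b
    proof -
      have "G (e1 b) \<in> e2 ` B2"
        using Y.bij_e X.e_in that Gin G(4) unfolding bij_betw_def by auto
      then show ?thesis by (simp add: g_def f_inv_into_f)
    qed
    have e2: "x = y" if "x \<in> B2" "y \<in> B2" "e2 x = e2 y" for x y
      using Y.inj_e that by (metis inj_onD)
    have "amob_iso g B1 H1 om1 bl1 B2 H2 om2 bl2"
      unfolding amob_iso_def
    proof (intro conjI ballI)
      show "bij_betw g B1 B2" using bij by (simp add: g_def)
      show gH: "g b \<in> H2 \<longleftrightarrow> b \<in> H1" if b: "b \<in> B1" for b
      proof -
        have "g b \<in> H2 \<longleftrightarrow> Y.a (e2 (g b)) \<noteq> e2 (g b)" unfolding Y.H_def using gB[OF b] by blast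
        also have "\<dots> \<longleftrightarrow> G (X.a (e1 b)) \<noteq> G (e1 b)" using eg[OF b] G(2) X.e_in b by simp
        also have "\<dots> \<longleftrightarrow> X.a (e1 b) \<noteq> e1 b"
          using G(1) X.e_in[OF b] X.a(1) unfolding bij_betw_def by (metis inj_onD)
        also have "\<dots> \<longleftrightarrow> b \<in> H1" unfolding X.H_def using b by blast
        finally show ?thesis .
      qed
      show "g (om1 h) = om2 (g h)" if h: "h \<in> H1" for h
      proof -
        have B: "h \<in> B1" "om1 h \<in> B1" "g h \<in> H2" using X.HB X.om h gH by auto
        have D: "e1 h \<in> mdarts T1" "e1 (om1 h) \<in> mdarts T1" using X.e_in B by auto
        have "Y.a (e2 (g (om1 h))) = G (X.a (e1 (om1 h)))" using eg B D G(2) by simp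
        also have "\<dots> = Y.s (Y.a (e2 (g h)))" using X.om h eg B D G(2,3) by simp
        also have "\<dots> = Y.a (e2 (om2 (g h)))" using Y.om B by simp
        finally have "e2 (g (om1 h)) = e2 (om2 (g h))"
          using Y.a(2) Y.e_in(1) gB[OF B(2)] Y.HB Y.om(1)[OF B(3)] by metis
        then show ?thesis using e2 gB[OF B(2)] Y.HB Y.om(1)[OF B(3)] by blast
      qed
      show "g (bl1 b) = bl2 (g b)" if b: "b \<in> B1" for b
      proof -
        have "e2 (g (bl1 b)) = e2 (bl2 (g b))"
          using eg[OF b] eg[OF X.bl(1)[OF b]] X.bl(2)[OF b] Y.bl(2)[OF gB[OF b]] G(3) X.e_in[OF b] by simp
        then show ?thesis using e2 gB b X.bl(1) Y.bl(1) by blast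
      qed
    qed
    then show "\<exists>g. amob_iso g B1 H1 om1 bl1 B2 H2 om2 bl2" by blast
  next
    assume "\<exists>g. amob_iso g B1 H1 om1 bl1 B2 H2 om2 bl2"
    then obtain g where bij: "bij_betw g B1 B2" and gH: "\<And>b. b \<in> B1 \<Longrightarrow> g b \<in> H2 \<longleftrightarrow> b \<in> H1"
      and gom: "\<And>h. h \<in> H1 \<Longrightarrow> g (om1 h) = om2 (g h)" and gbl: "\<And>b. b \<in> B1 \<Longrightarrow> g (bl1 b) = bl2 (g b)"
      unfolding amob_iso_def by blast
    have gB: "g b \<in> B2" if "b \<in> B1" for b using bij that bij_betwE by blast
    have gHI: "g h \<in> H2" if "h \<in> H1" for h using gH[OF X.HB[OF that]] that by simp
    have gi: "x = y" if "x \<in> B1" "y \<in> B1" "g x = g y" for x y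
      using bij that unfolding bij_betw_def by (metis inj_onD)
    define G where "G d = (if mwhite T1 d then Y.a (e2 (g (X.node d))) else e2 (g (X.node d)))" for d
    have Ge: "G (e1 b) = e2 (g b)" if "b \<in> B1" for b
      using that X.e_in X.node_e by (simp add: G_def)
    have Ga: "G (X.a (e1 h)) = Y.a (e2 (g h))" if "h \<in> H1" for h
      using that X.ae X.node_ae by (simp add: G_def)
    have w: "mwhite T2 (G d) = mwhite T1 d \<and> G d \<in> mdarts T2" if "d \<in> mdarts T1" for d
    proof (cases rule: X.dart_cases[OF that])
      case (1 b)
      then show ?thesis using Ge[OF 1(1)] Y.e_in[OF gB[OF 1(1)]] X.e_in[OF 1(1)] by simp
    next
      case (2 h)
      then show ?thesis using Ga[OF 2(1)] Y.ae[OF gHI[OF 2(1)]] X.ae[OF 2(1)]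
          Y.e_in(1)[OF Y.HB[OF gHI[OF 2(1)]]] by simp
    qed
    have inj: "inj_on G (mdarts T1)"
    proof (rule inj_onI)
      fix x y assume xy: "x \<in> mdarts T1" "y \<in> mdarts T1" "G x = G y"
      then have col: "mwhite T1 x = mwhite T1 y" using w by metis
      show "x = y"
      proof (cases rule: X.dart_cases[OF xy(1)])
        case x: (1 b)
        show ?thesis
        proof (cases rule: X.dart_cases[OF xy(2)])
          case y: (1 c)
          have "e2 (g b) = e2 (g c)" using xy(3) Ge x y by simp
          then have "g b = g c" using Y.inj_e gB x y by (metis inj_onD)
          then show ?thesis using gi[OF x(1) y(1)] x y by simp
        next
          case y: (2 h)
          then show ?thesis using col X.ae[OF y(1)] X.e_in[OF x(1)] x by simp
        qed
      next
        case x: (2 b)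
        show ?thesis
        proof (cases rule: X.dart_cases[OF xy(2)])
          case y: (1 c)
          then show ?thesis using col X.ae[OF x(1)] X.e_in[OF y(1)] x by simp
        next
          case y: (2 c)
          have "Y.a (e2 (g b)) = Y.a (e2 (g c))" using xy(3) Ga x y by simp
          then have "g b = g c" using inj_onD[OF Y.inj_ae] gHI x y by simp
          then show ?thesis using gi[OF X.HB[OF x(1)] X.HB[OF y(1)]] x y by simp
        qed
      qed
    qed
    have surj: "d \<in> G ` mdarts T1" if "d \<in> mdarts T2" for d
    proof (cases rule: Y.dart_cases[OF that])
      case (1 b)
      then obtain c where c: "c \<in> B1" "b = g c" using bij unfolding bij_betw_def by blast
      then have "d = G (e1 c)" using Ge 1 by simp
      then show ?thesis using X.e_in c by blast
    next
      case (2 h)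
      then obtain c where c: "c \<in> B1" "h = g c" using bij Y.HB unfolding bij_betw_def by blast
      then have cH: "c \<in> H1" using gH 2 by simp
      then have "d = G (X.a (e1 c))" using Ga 2 c by simp
      then show ?thesis using X.e_in X.a(1) c by blast
    qed
    have "bij_betw G (mdarts T1) (mdarts T2)"
      unfolding bij_betw_def using inj w surj by blast
    moreover have "G (X.a d) = Y.a (G d) \<and> G (X.s d) = Y.s (G d)" if "d \<in> mdarts T1" for d
    proof (cases rule: X.dart_cases[OF that])
      case (1 b)
      have "G (X.a d) = Y.a (G d)"
      proof (cases "b \<in> H1")
        case True
        then show ?thesis using Ga[OF True] Ge[OF 1(1)] 1 by simp
      next
        case False
        then have "X.a (e1 b) = e1 b" using 1 unfolding X.H_def by blast
        moreover have "g b \<notin> H2" using gH 1 False by simp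
        then have "Y.a (e2 (g b)) = e2 (g b)" using gB[OF 1(1)] unfolding Y.H_def by blast
        ultimately show ?thesis using Ge[OF 1(1)] 1 by simp
      qed
      moreover have "X.s d = e1 (bl1 b)" using X.bl 1 by simp
      then have "G (X.s d) = Y.s (G d)"
        using Ge[OF 1(1)] Ge[OF X.bl(1)[OF 1(1)]] gbl[OF 1(1)] Y.bl(2)[OF gB[OF 1(1)]] 1(2) by simp
      ultimately show ?thesis by simp
    next
      case (2 h)
      have D: "e1 h \<in> mdarts T1" "e2 (g h) \<in> mdarts T2"
        using X.e_in[OF X.HB[OF 2(1)]] Y.e_in[OF Y.HB[OF gHI[OF 2(1)]]] by auto
      have "G (X.a d) = Y.a (G d)" using Ge[OF X.HB[OF 2(1)]] Ga[OF 2(1)] 2(2) D by simp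
      moreover have "X.s d = X.a (e1 (om1 h))" using X.om 2 by simp
      then have "G (X.s d) = Y.s (G d)"
        using Ga[OF 2(1)] Ga[OF X.om(1)[OF 2(1)]] gom[OF 2(1)] Y.om(2)[OF gHI[OF 2(1)]] 2(2) by simp
      ultimately show ?thesis by simp
    qed
    ultimately show "mobile_iso T1 T2" unfolding mobile_iso_def using w by blast
  qed
qed

text \<open>Numbering the black darts moves a mobile over any type to the type \<open>nat\<close> of
  the orientations sought, and leaves the numbers from \<open>N\<close> on free for new
  darts.\<close>

lemma ex_nat_rep:
  assumes "premob T"
  shows "\<exists>N H om bl e. rep T {..<N :: nat} H om bl e"
proof -
  let ?a = "malpha T" and ?s = "msigma T"
  let ?Bl = "{d \<in> mdarts T. \<not> mwhite T d}"
  have "finite ?Bl" using assms by (simp add: premob_def)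
  then obtain e where e: "bij_betw e {..<card ?Bl} ?Bl"
    using ex_bij_betw_nat_finite by (metis atLeast0LessThan)
  let ?B = "{..<card ?Bl}"
  define i where "i = inv_into ?B e"
  have ei: "e (i d) = d \<and> i d \<in> ?B" if "d \<in> ?Bl" for d
  proof -
    have "d \<in> e ` ?B" using that e by (simp only: bij_betw_def)
    then show ?thesis unfolding i_def using f_inv_into_f[of d e ?B] inv_into_into[of d e ?B] by simp
  qed
  have a: "?a d \<in> mdarts T" "?a (?a d) = d" "?s d \<in> mdarts T" "mwhite T (?s d) = mwhite T d"
      "?a d \<noteq> d \<Longrightarrow> mwhite T (?a d) \<noteq> mwhite T d" "?a d = d \<Longrightarrow> \<not> mwhite T d"
    if "d \<in> mdarts T" for d
    using assms that bij_betwE[of ?s "mdarts T" "mdarts T"] unfolding premob_def by simp_all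
  have e_in: "e b \<in> mdarts T" "\<not> mwhite T (e b)" if "b \<in> ?B" for b
    using bij_betwE[OF e] that by blast+
  define H where "H = {b \<in> ?B. ?a (e b) \<noteq> e b}"
  define om where "om h = i (?a (?s (?a (e h))))" for h
  define bl where "bl b = i (?s (e b))" for b
  have "om h \<in> H \<and> ?a (e (om h)) = ?s (?a (e h))" if h: "h \<in> H" for h
  proof -
    have b: "h \<in> ?B" "?a (e h) \<noteq> e h" using h by (auto simp: H_def)
    let ?w = "?s (?a (e h))"
    have w: "?w \<in> mdarts T" "mwhite T ?w" using a e_in[OF b(1)] b(2) by simp_all
    have aw: "?a ?w \<in> ?Bl" using a(1)[OF w(1)] a(5,6)[OF w(1)] w(2) by auto
    have eo: "e (om h) = ?a ?w" "om h \<in> ?B" using ei[OF aw] by (auto simp: om_def)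
    then have "?a (e (om h)) = ?w" using a(2)[OF w(1)] by simp
    moreover have "?w \<noteq> e (om h)" using w(2) aw eo(1) by auto
    ultimately show ?thesis using eo(2) by (simp add: H_def)
  qed
  moreover have "bl b \<in> ?B \<and> e (bl b) = ?s (e b)" if b: "b \<in> ?B" for b
    using ei[of "?s (e b)"] a(3,4) e_in[OF b] by (simp add: bl_def)
  ultimately have "rep T ?B H om bl e"
    using e unfolding rep_def H_def by blast
  then show ?thesis by blast
qed

text \<open>The fixed points of \<open>om\<close> are the white leaves; removing \<open>A\<close> from \<open>H\<close> turns them into buds.\<close>

lemma amob_remove_leaves:
  assumes A: "A \<subseteq> H" "\<And>a. a \<in> A \<Longrightarrow> om a = a" and H: "H \<subseteq> B" and finB: "finite B"
  shows "amob B (H - A) om bl \<longleftrightarrow> amob B H om bl"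
proof -
  have A': "bij_betw om A A" using A(2) by (intro bij_betw_involution) simp
  have bij: "bij_betw om (H - A) (H - A) \<longleftrightarrow> bij_betw om H H"
  proof
    assume "bij_betw om (H - A) (H - A)"
    moreover have "(H - A) \<union> A = H" "(H - A) \<inter> A = {}" using A(1) by blast+
    ultimately show "bij_betw om H H" using bij_betw_combine[OF _ A', of "H - A" "H - A"] by simp
  next
    assume "bij_betw om H H"
    from bij_betw_DiffI[OF this A' A(1) A(1)] show "bij_betw om (H - A) (H - A)" .
  qed
  have eqv: "eqv (gr om (H - A) \<union> gr bl B) = eqv (gr om H \<union> gr bl B)"
  proof (rule eqv_eqI)
    fix x y assume "(x, y) \<in> gr om H \<union> gr bl B"
    then have "x = y \<or> (x, y) \<in> gr om (H - A) \<union> gr bl B"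
      using A(2) by (cases "x \<in> A") (auto simp: gr_def)
    then show "(x, y) \<in> eqv (gr om (H - A) \<union> gr bl B)"
      by (rule disjE) (simp, rule eqv_base)
  qed (auto intro!: eqv_base simp: gr_def)
  have cH: "card H = card (H - A) + card A"
    using card_Diff_subset[of A H] A(1) H finB finite_subset[of _ B] card_mono[of H A] by force
  \<comment> \<open>A removed fixed point was a white vertex by itself, so vertices and edges
    decrease by the same number and the tree equation persists.\<close>
  have orbs: "card (orb om ` H) = card (orb om ` (H - A)) + card A" if "bij_betw om (H - A) (H - A)"
  proof -
    have o: "orb om a = {a}" if "a \<in> A" for a
      using orb_subset[of a "{a}" om] A(2)[OF that] orb_self[of a om] by blast
    have "H = (H - A) \<union> A" using A(1) by blast
    then have "orb om ` H = orb om ` (H - A) \<union> orb om ` A" by (metis image_Un)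
    moreover have "orb om ` (H - A) \<inter> orb om ` A = {}"
    proof -
      have False if x: "x \<in> H - A" "a \<in> A" "orb om x = orb om a" for x a
      proof -
        have "x \<in> orb om a" using orb_self[of x om] x(3) by simp
        then show False using o[OF x(2)] x by simp
      qed
      then show ?thesis by blast
    qed
    moreover have "orb om ` A = (\<lambda>a. {a}) ` A" using o by simp
    then have "card (orb om ` A) = card A" by (simp add: card_image)
    moreover have "finite H" using H finB finite_subset by blast
    then have "finite (H - A)" "finite A" using A(1) finite_subset by auto
    ultimately show ?thesis by (simp add: card_Un_disjoint)
  qed
  have "H - A \<subseteq> B" using H by blast
  then show ?thesis unfolding amob_def bij eqv using orbs cH H bij by auto
qed

section \<open>The mobile of a clockwise-minimal accessible orientation\<close>

text \<open>The corners of a face occur around its black vertex in the order of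
  \<open>phi_inv\<close>; this lemma identifies the black vertices with faces.\<close>

lemma orb_inverse:
  assumes "finite D" "bij_betw f D D" "\<And>x. x \<in> D \<Longrightarrow> g x \<in> D \<and> f (g x) = x" "x \<in> D"
  shows "orb g x = orb f x"
proof -
  have "inj_on g D" by (rule inj_on_inverseI[of _ f]) (use assms in auto)
  then have "bij_betw g D D"
    using endo_inj_surj[OF assms(1), of g] assms(3) by (auto simp: bij_betw_def)
  note g = this
  have gf: "g (f y) = y" if "y \<in> D" for y
    using that assms(2,3) bij_betwE[OF assms(2)] unfolding bij_betw_def by (metis inj_onD)
  have fx: "orb f x \<subseteq> D" "orb g x \<subseteq> D" using orb_closed assms g by metis+
  have "orb g x \<subseteq> orb f x"
  proof (rule orb_subset[OF orb_self])
    fix y assume y: "y \<in> orb f x"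
    then have yD: "y \<in> D" using fx by blast
    have "f (g y) \<in> orb f x" using y assms(3)[OF yD] by simp
    then show "g y \<in> orb f x"
      using perm_closed_iff[OF assms(1,2), of "orb f x" "g y"] orb_step[of _ f x] assms(3)[OF yD] by blast
  qed
  moreover have "orb f x \<subseteq> orb g x"
  proof (rule orb_subset[OF orb_self])
    fix y assume y: "y \<in> orb g x"
    then have yD: "y \<in> D" using fx by blast
    have "g (f y) \<in> orb g x" using y gf[OF yD] by simp
    then show "f y \<in> orb g x"
      using perm_closed_iff[OF assms(1) g, of "orb g x" "f y"] orb_step[of _ g x] bij_betwE[OF assms(2)] yD by blast
  qed
  ultimately show ?thesis by blast
qed

context fro
begin

abbreviation "H \<equiv> {d \<in> D. head M d}"
abbreviation "nh \<equiv> next_in (\<lambda>d. d \<in> H) sg"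
abbreviation "bl \<equiv> phi_inv M"

lemma bl [simp]: "d \<in> D \<Longrightarrow> bl d \<in> D" "d \<in> D \<Longrightarrow> ph (bl d) = d" "d \<in> D \<Longrightarrow> bl (ph d) = d"
proof -
  have i: "inv_into D sg d \<in> D" "sg (inv_into D sg d) = d" if "d \<in> D" for d
    using that bij_sg by (auto simp: bij_betw_def f_inv_into_f inv_into_into)
  show "d \<in> D \<Longrightarrow> bl d \<in> D" "d \<in> D \<Longrightarrow> ph (bl d) = d" using i by (auto simp: phi_inv_def ph_al)
  have "inv_into D sg (sg y) = y" if "y \<in> D" for y
    using bij_sg that by (simp add: bij_betw_inv_into_left)
  from this[of "al d"] show "d \<in> D \<Longrightarrow> bl (ph d) = d" by (simp add: phi_inv_def sg_al)
qed

lemma bl_notin_R: "d \<in> D - R \<Longrightarrow> bl d \<in> D - R"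
  using R_ph[of "bl d"] by simp

lemma bij_bl: "bij_betw bl (D - R) (D - R)"
  by (rule bij_betw_byWitness[where f' = ph]) (use bl_notin_R in auto)

text \<open>Common to both constructions. The hypotheses leave exactly the black darts
  \<open>D - R\<close>, and this set is preserved by \<open>bl\<close>, so the first return to it is
  \<open>bl\<close> itself.\<close>

lemma local_transform_rep:
  assumes hdd: "\<And>d. d \<in> D - R \<Longrightarrow> hdd d \<Longrightarrow> vert M d \<notin> V"
    and R: "\<And>d. d \<in> D \<Longrightarrow> hdd d \<Longrightarrow> vert M d \<notin> V \<Longrightarrow> d \<notin> R"
  defines "H' \<equiv> {d \<in> D. hdd d \<and> vert M d \<notin> V}"
  shows "represented (local_transform M hdd V) (D - R) H' (next_in (\<lambda>d. d \<in> H') sg) bl (\<lambda>d. (d, False))"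
proof -
  let ?T = "local_transform M hdd V" and ?n = "next_in (\<lambda>d. d \<in> H') sg"
  have H'_D: "H' \<subseteq> D - R" using R by (auto simp: H'_def)
  then have "H' \<subseteq> D" by blast
  note n = bij_next_in[OF fin bij_sg this]
  have PB: "(d \<in> D \<and> d \<notin> R \<and> (hdd d \<longrightarrow> vert M d \<notin> V)) \<longleftrightarrow> d \<in> D - R" for d using hdd by blast
  have PW: "(d \<in> D \<and> hdd d \<and> vert M d \<notin> V) \<longleftrightarrow> d \<in> H'" for d by (simp add: H'_def)
  have hdd_H': "hdd d \<longleftrightarrow> d \<in> H'" if "d \<in> D - R" for d using that hdd by (auto simp: H'_def)
  have md: "mdarts ?T = {(h, True) | h. h \<in> H'} \<union> {(d, False) | d. d \<in> D - R}"
    and ma: "malpha ?T (d, True) = (d, False)"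
      "malpha ?T (d, False) = (if hdd d then (d, True) else (d, False))"
    and mw: "mwhite ?T (d, b) = b"
    and ms0: "msigma ?T (d, True) = (?n d, True)"
      "msigma ?T (d, False) = (next_in (\<lambda>d. d \<in> D - R) bl d, False)" for d b
    unfolding local_transform_def Let_def PB PW by simp_all
  have ms: "msigma ?T (d, False) = (bl d, False)" if "d \<in> D - R" for d
    using ms0(2)[of d] next_in_eqI[of 1 "\<lambda>d. d \<in> D - R" bl d] bl_notin_R[OF that] by simp
  have fin': "finite (mdarts ?T)"
  proof -
    have "mdarts ?T \<subseteq> D \<times> UNIV" unfolding md using H'_D by auto
    moreover have "finite (D \<times> (UNIV :: bool set))" using fin by simp
    ultimately show ?thesis by (rule finite_subset)
  qed
  have nin: "?n d \<in> H'" if "d \<in> H'" for d using bij_betwE[OF n] that by blast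
  have "msigma ?T ` mdarts ?T \<subseteq> mdarts ?T"
    unfolding md using ms ms0 nin bl_notin_R by auto
  moreover have "inj_on (msigma ?T) (mdarts ?T)"
  proof (rule inj_onI)
    fix x y assume xy: "x \<in> mdarts ?T" "y \<in> mdarts ?T" "msigma ?T x = msigma ?T y"
    obtain c b c' b' where p: "x = (c, b)" "y = (c', b')" by (metis surj_pair)
    have "inj_on ?n H'" "inj_on bl (D - R)" using n bij_bl by (auto simp: bij_betw_def)
    then show "x = y"
      using xy unfolding p md by (cases b; cases b') (auto simp: ms ms0(1) dest: inj_onD)
  qed
  ultimately have "bij_betw (msigma ?T) (mdarts ?T) (mdarts ?T)"
    using endo_inj_surj[OF fin'] by (simp add: bij_betw_def)
  moreover have "malpha ?T d \<in> mdarts ?T \<and> malpha ?T (malpha ?T d) = d \<and>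
      mwhite ?T (msigma ?T d) = mwhite ?T d \<and>
      (malpha ?T d \<noteq> d \<longrightarrow> mwhite ?T (malpha ?T d) \<noteq> mwhite ?T d) \<and>
      (malpha ?T d = d \<longrightarrow> \<not> mwhite ?T d)" if "d \<in> mdarts ?T" for d
  proof -
    from that consider h where "d = (h, True)" "h \<in> H'" | c where "d = (c, False)" "c \<in> D - R"
      unfolding md by blast
    then show ?thesis
    proof cases
      case 1
      then have "h \<in> D - R" using H'_D by blast
      then show ?thesis using 1 hdd_H'[of h] by (simp add: ma mw ms0 md)
    next
      case 2
      then show ?thesis using hdd_H'[of c] by (simp add: ma mw ms md)
    qed
  qed
  ultimately have pre: "premob ?T" unfolding premob_def using fin' by blast
  have "{d \<in> mdarts ?T. \<not> mwhite ?T d} = (\<lambda>d. (d, False)) ` (D - R)"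
    unfolding md by (auto simp: mw)
  then have c1: "bij_betw (\<lambda>d. (d, False)) (D - R) {d \<in> mdarts ?T. \<not> mwhite ?T d}"
    by (simp add: bij_betw_def inj_on_def)
  have c2: "H' = {b \<in> D - R. malpha ?T (b, False) \<noteq> (b, False)}"
    using hdd_H' H'_D by (auto simp: ma)
  have c3: "\<forall>h\<in>H'. ?n h \<in> H' \<and> malpha ?T (?n h, False) = msigma ?T (malpha ?T (h, False))"
  proof
    fix h assume h: "h \<in> H'"
    have "hdd h" "hdd (?n h)" using h nin[OF h] by (auto simp: H'_def)
    then show "?n h \<in> H' \<and> malpha ?T (?n h, False) = msigma ?T (malpha ?T (h, False))"
      using nin[OF h] by (simp add: ma ms0)
  qed
  have c4: "\<forall>b\<in>D - R. bl b \<in> D - R \<and> (bl b, False) = msigma ?T (b, False)"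
    using bl_notin_R ms by simp
  have "rep ?T (D - R) H' ?n bl (\<lambda>d. (d, False))"
    unfolding rep_def by (intro conjI c1 c2 c3 c4)
  with pre show ?thesis by (rule represented.intro)
qed

end

context cw_fro
begin

lemma H_notin_R: "h \<in> H \<Longrightarrow> h \<in> D - R"
  using head_notin_R by blast

lemma Phi_plus_rep: "represented (Phi_plus M) (D - R) H nh bl (\<lambda>d. (d, False))"
proof -
  have "represented (local_transform M (head M) {}) (D - R) {d \<in> D. head M d \<and> vert M d \<notin> {}}
    (next_in (\<lambda>d. d \<in> {d \<in> D. head M d \<and> vert M d \<notin> {}}) sg) bl (\<lambda>d. (d, False))"
    by (rule local_transform_rep) (use head_notin_R in auto)
  moreover have "{d \<in> D. head M d \<and> vert M d \<notin> {}} = H" by simp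
  ultimately show ?thesis unfolding Phi_plus_def by (simp only:)
qed

text \<open>For a tail this names the sector, between consecutive heads around the vertex, in which
  the tail lies.\<close>

definition first :: "'a \<Rightarrow> 'a" where
  "first x = (if head M x then x else nh x)"

lemma nh_eq: "x \<in> D \<Longrightarrow> nh x = first (sg x)"
proof -
  assume x: "x \<in> D"
  obtain h where h: "h \<in> vert M x" "head M h" using vert_has_head[OF x] by blast
  then obtain n where n: "h = (sg ^^ n) x" by (auto simp: vert_def orb_def)
  obtain k where k: "k > 0" "(sg ^^ k) x = x" using funpow_return[OF fin bij_sg x] by blast
  have "(sg ^^ (n + k)) x = h" using n k by (simp add: funpow_add)
  then have "n + k > 0" "(sg ^^ (n + k)) x \<in> H" using k h vert_closed[OF x] by auto
  from next_in_step[of "n + k" "\<lambda>d. d \<in> H" sg x, OF this]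
  show ?thesis using x by (simp add: first_def)
qed

lemma first_tail: "x \<in> D \<Longrightarrow> \<not> head M x \<Longrightarrow> first x = first (sg x)"
  using nh_eq by (simp add: first_def)

lemma bij_nh: "bij_betw nh H H"
  by (rule bij_next_in[OF fin bij_sg]) auto

text \<open>Induction from the children. The dart \<open>ph x\<close> is at the same black vertex as
  \<open>x\<close> and sees \<open>nh (al x)\<close>, which joins \<open>x\<close> to its partner
  \<open>al x\<close>. From the partner, \<open>sg x = ph (al x)\<close> leads on to
  \<open>first x\<close>.\<close>

lemma tail_connected:
  assumes "x \<in> D - R" "\<not> head M x"
  defines "S \<equiv> gr nh H \<union> gr bl (D - R)"
  shows "(x, al x) \<in> eqv S \<and> (x, first x) \<in> eqv S"
  using wf_child assms(1,2)
proof (induction x rule: wf_induct_rule)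
  case (less x)
  have ph: "(y, ph y) \<in> eqv S" if "y \<in> D - R" for y
  proof -
    have "(ph y, bl (ph y)) \<in> S" unfolding S_def using that by (intro UnI2 gr_I) simp
    then show ?thesis using that by (simp add: eqv_base eqv_sym)
  qed
  have nhS: "(h, nh h) \<in> eqv S" if "h \<in> H" for h
    using that unfolding S_def by (intro eqv_base) blast
  have *: "(y, first y) \<in> eqv S" if "y \<in> D - R" "y = ph x \<or> y = sg x" for y
  proof (cases "head M y")
    case True
    then show ?thesis by (simp add: first_def)
  next
    case False
    then have "(y, x) \<in> child" using that less.prems by (auto simp: child_def)
    then show ?thesis using less.IH that False by blast
  qed
  have x: "x \<in> D" "x \<notin> R" using less.prems by auto
  have ax: "al x \<in> D - R" "al x \<in> H" using less.prems head_notin_R[of "al x"] by auto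
  have "(x, first (ph x)) \<in> eqv S"
    using eqv_trans[OF ph[OF less.prems(1)] *[of "ph x"]] less.prems by simp
  moreover have "first (ph x) = nh (al x)" using nh_eq[of "al x"] ax by (simp add: sg_al)
  ultimately have 1: "(x, al x) \<in> eqv S" using eqv_trans eqv_sym[OF nhS[OF ax(2)]] by metis
  have "(al x, sg x) \<in> eqv S" using ph[OF ax(1)] x ph_al by simp
  moreover have "(sg x, first (sg x)) \<in> eqv S" using * sg_notin_R[of x] less.prems by simp
  ultimately have "(x, first (sg x)) \<in> eqv S" using eqv_trans[OF eqv_trans[OF 1]] by blast
  then show ?case using 1 first_tail[OF x(1)] less.prems(2) by simp
qed

text \<open>The map is connected, and by \<open>tail_connected\<close> each of its edges can be
  replaced by a path in the mobile.\<close>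

lemma mobile_connected:
  defines "S \<equiv> gr nh H \<union> gr bl (D - R)"
  assumes "x \<in> D - R" "y \<in> D - R"
  shows "(x, y) \<in> eqv S"
proof -
  have ph: "(y, ph y) \<in> eqv S" if "y \<in> D - R" for y
  proof -
    have "(ph y, bl (ph y)) \<in> S" unfolding S_def using that by (intro UnI2 gr_I) simp
    then show ?thesis using that by (simp add: eqv_base eqv_sym)
  qed
  note tail = tail_connected[folded S_def]
  \<comment> \<open>The black vertex of the root-face is missing, so a root-face dart is represented
    by the head of its edge.\<close>
  define node where "node d = (if d \<in> R then al d else d)" for d
  have n_al: "(node d, node (al d)) \<in> eqv S" if d: "d \<in> D" for d
  proof (cases "d \<in> R \<or> al d \<in> R")
    case True
    have "d \<in> R \<Longrightarrow> al d \<notin> R" using tails_R[of d] head_notin_R[of "al d"] d by simp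
    then have "node d = node (al d)" using True d by (auto simp: node_def)
    then show ?thesis by simp
  next
    case False
    then have n: "node d = d" "node (al d) = al d" by (auto simp: node_def)
    show ?thesis
    proof (cases "head M d")
      case True
      then have "(al d, al (al d)) \<in> eqv S" using tail[of "al d"] False d by simp
      then show ?thesis using n d eqv_sym by simp
    next
      case f: False
      then show ?thesis using n tail[of d] False d by simp
    qed
  qed
  have n_ph: "(node d, node (ph d)) \<in> eqv S" if d: "d \<in> D" for d
  proof (cases "d \<in> R")
    case False
    then show ?thesis using ph[of d] d by (simp add: node_def)
  next
    case True
    \<comment> \<open>Consecutive outer edges meet at a vertex where \<open>?r\<close> follows
      \<open>?h\<close>. The head \<open>al ?r\<close> is joined through \<open>sg ?r\<close> to the
      first head after \<open>?r\<close>, which is also the successor of \<open>?h\<close>.\<close>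
    let ?h = "al d" and ?r = "ph d"
    have h: "?h \<in> H" using tails_R True d by simp
    have r: "?r \<in> R" "\<not> head M ?r" "?r \<in> D" using True tails_R[of ?r] d by auto
    have ar: "al ?r \<in> D - R" using head_notin_R[of "al ?r"] r by simp
    have sr: "sg ?r \<in> D - R" using sg_notin_R r by simp
    have "(al ?r, sg ?r) \<in> eqv S" using ph[OF ar] r ph_al by simp
    moreover have "(sg ?r, first (sg ?r)) \<in> eqv S"
    proof (cases "head M (sg ?r)")
      case True
      then show ?thesis by (simp add: first_def)
    qed (use tail sr in blast)
    ultimately have "(al ?r, first (sg ?r)) \<in> eqv S" by (rule eqv_trans)
    moreover have "first (sg ?r) = nh ?h"
      using first_tail[OF r(3,2)] nh_eq[of ?h] h by (simp add: sg_al)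
    moreover have "(?h, nh ?h) \<in> eqv S" using h unfolding S_def by (intro eqv_base) blast
    ultimately have "(?h, al ?r) \<in> eqv S" using eqv_trans[OF _ eqv_sym] by metis
    then show ?thesis using True r by (simp add: node_def)
  qed
  have "D \<subseteq> {d \<in> D. (node (root M), node d) \<in> eqv S}"
  proof (rule connected_induct[of "root M"])
    fix d assume d: "d \<in> D" "d \<in> {d \<in> D. (node (root M), node d) \<in> eqv S}"
    then have 1: "(node (root M), node (al d)) \<in> eqv S" using eqv_trans[OF _ n_al[OF d(1)]] by blast
    then show "al d \<in> {d \<in> D. (node (root M), node d) \<in> eqv S}" using d by simp
    have "(node (al d), node (sg d)) \<in> eqv S" using n_ph[of "al d"] d by (simp add: ph_al)
    then show "sg d \<in> {d \<in> D. (node (root M), node d) \<in> eqv S}" using eqv_trans[OF 1] d by simp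
  qed (use rt in auto)
  moreover have "node x = x" "node y = y" "x \<in> D" "y \<in> D" using assms(2,3) by (simp_all add: node_def)
  ultimately have 1: "(node (root M), x) \<in> eqv S" and 2: "(node (root M), y) \<in> eqv S" by fastforce+
  show ?thesis by (rule eqv_trans[OF eqv_sym[OF 1] 2])
qed

lemma card_D: "card D = 2 * card H"
proof -
  have "bij_betw al H (D - H)"
    by (rule bij_betw_byWitness[where f' = al]) auto
  then have "card H = card (D - H)" by (rule bij_betw_same_card)
  moreover have "card D = card H + card (D - H)"
  proof -
    have "card (H \<union> (D - H)) = card H + card (D - H)" using fin by (intro card_Un_disjoint) auto
    moreover have "H \<union> (D - H) = D" by blast
    ultimately show ?thesis by simp
  qed
  ultimately show ?thesis by simp
qed

text \<open>Heads and tails are equinumerous, and the buds are the tails off the root-face. What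
  remains in the difference are the tails on the root-face.\<close>

lemma excess_plus: "int (card H) - int (card (D - R - H)) = int (outer_degree M)"
proof -
  have "D = H \<union> R \<union> (D - R - H)" using R_D by blast
  moreover have "H \<inter> R = {}" using head_notin_R by blast
  moreover have "finite R" "finite H" using fin R_sub finite_subset by auto
  moreover have "card (H \<union> R \<union> (D - R - H)) = card (H \<union> R) + card (D - R - H)"
    using fin R_sub finite_subset by (intro card_Un_disjoint) auto
  ultimately have "card D = card H + card R + card (D - R - H)"
    using card_Un_disjoint[of H R] by simp
  then show ?thesis using card_D by (simp add: outer_degree_def)
qed

text \<open>White vertices are the vertices of the map, each of which has a head, and black vertices
  are the faces other than the root-face. Euler's relation thus gives one more vertex than
  edges.\<close>

lemma amob_plus: "amob (D - R) H nh bl"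
proof -
  have "card (orb nh ` H) = card (vert M ` D)"
  proof -
    have "card (orb nh ` H) = card (vert M ` H)"
      using card_orb_next_in[OF fin bij_sg, of H] by (simp add: vert_def image_def)
    moreover have "vert M ` H = vert M ` D"
    proof
      show "vert M ` D \<subseteq> vert M ` H"
      proof
        fix v assume "v \<in> vert M ` D"
        then obtain d where d: "d \<in> D" "v = vert M d" by blast
        then obtain h where "h \<in> vert M d" "head M h" using vert_has_head by blast
        then show "v \<in> vert M ` H" using vert_eq_iff[OF d(1), of h] vert_closed[OF d(1)] d by blast
      qed
    qed auto
    ultimately show ?thesis by simp
  qed
  moreover have "card (orb bl ` (D - R)) + 1 = card (face M ` D)"
  proof -
    have "orb bl d = face M d" if "d \<in> D - R" for d
      unfolding face_def by (rule orb_inverse[OF fin bij_ph]) (use that in auto)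
    then have "orb bl ` (D - R) = face M ` (D - R)" by simp
    moreover have "face M ` D = insert R (face M ` (D - R))"
    proof -
      have "face M ` R = {R}" using face_R root_in_R by blast
      moreover have "D = R \<union> (D - R)" using R_sub by blast
      ultimately show ?thesis by (metis image_Un insert_is_Un)
    qed
    moreover have "R \<notin> face M ` (D - R)"
    proof
      assume "R \<in> face M ` (D - R)"
      then obtain d where "d \<in> D - R" "R = face M d" by blast
      then show False using orb_self[of d ph] unfolding face_def by blast
    qed
    ultimately show ?thesis using fin by simp
  qed
  moreover have "card (vert M ` D) + card (face M ` D) = card D div 2 + 2"
    using is_fro by (simp add: is_fro_def)
  ultimately have "card (orb nh ` H) + card (orb bl ` (D - R)) = card H + 1"
    using card_D by simp
  moreover have "H \<subseteq> D - R" using H_notin_R by blast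
  ultimately show ?thesis unfolding amob_def using fin bij_nh bij_bl mobile_connected by blast
qed

lemma Phi_plus_mobile:
  "is_pb_mobile (Phi_plus M)" "excess (Phi_plus M) = int (outer_degree M)" "outer_degree M > 0"
proof -
  interpret T: represented "Phi_plus M" "D - R" H nh bl "\<lambda>d. (d, False)" by (rule Phi_plus_rep)
  show "is_pb_mobile (Phi_plus M)" using T.is_pb_mobile_iff_amob amob_plus by simp
  show "excess (Phi_plus M) = int (outer_degree M)" using T.excess_eq excess_plus by simp
  have "finite R" using R_sub fin finite_subset by blast
  then show "outer_degree M > 0" unfolding outer_degree_def using root_in_R card_gt_0_iff by blast
qed

end

section \<open>Recovering the orientation from its mobile\<close>

text \<open>The second conjunct serves for \<open>Phi_minus\<close>, where the heads of outer edges
  have turned into buds and must be tracked too.\<close>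

lemma amob_iso_of_fro_iso:
  assumes "cw_fro M1" "cw_fro M2" and iso: "fro_iso M1 M2"
  shows "\<exists>g. amob_iso g (darts M1 - root_face M1) {d \<in> darts M1. head M1 d}
      (next_in (\<lambda>d. d \<in> {d \<in> darts M1. head M1 d}) (sigma M1)) (phi_inv M1)
      (darts M2 - root_face M2) {d \<in> darts M2. head M2 d}
      (next_in (\<lambda>d. d \<in> {d \<in> darts M2. head M2 d}) (sigma M2)) (phi_inv M2) \<and>
    (\<forall>b\<in>darts M1. alpha M2 (g b) \<in> root_face M2 \<longleftrightarrow> alpha M1 b \<in> root_face M1)"
proof -
  interpret X: cw_fro M1 by (rule assms(1))
  interpret Y: cw_fro M2 by (rule assms(2))
  obtain g where g: "bij_betw g X.D Y.D" "\<And>d. d \<in> X.D \<Longrightarrow> g (X.al d) = Y.al (g d)"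
    "\<And>d. d \<in> X.D \<Longrightarrow> g (X.sg d) = Y.sg (g d)" "\<And>d. d \<in> X.D \<Longrightarrow> head M2 (g d) = head M1 d"
    "g (root M1) \<in> Y.R"
    using iso unfolding fro_iso_def by blast
  have gD: "g d \<in> Y.D" if "d \<in> X.D" for d using bij_betwE[OF g(1)] that by blast
  have gi: "x = y" if "x \<in> X.D" "y \<in> X.D" "g x = g y" for x y
    using g(1) that unfolding bij_betw_def by (metis inj_onD)
  have gph: "g (X.ph d) = Y.ph (g d)" if "d \<in> X.D" for d
    using g(3)[of "X.al d"] g(2)[OF that] that by (simp add: X.sg_al Y.sg_al)
  have gR: "g ` X.R = Y.R"
  proof -
    have "orb Y.ph (g (root M1)) = g ` orb X.ph (root M1)"
      by (rule orb_image[of X.D]) (use gph X.rt in auto)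
    then show ?thesis using Y.face_R[OF g(5)] by (simp add: face_def root_face_def)
  qed
  have gR': "g d \<in> Y.R \<longleftrightarrow> d \<in> X.R" if "d \<in> X.D" for d
    unfolding gR[symmetric] using gi that X.R_D by blast
  have fp: "(Y.sg ^^ k) (g h) = g ((X.sg ^^ k) h)" if "h \<in> X.D" for h k
    using that g(3) funpow_closed[OF X.bij_sg] by (induction k) auto
  have "amob_iso g (X.D - X.R) X.H X.nh X.bl (Y.D - Y.R) Y.H Y.nh Y.bl"
    unfolding amob_iso_def
  proof (intro conjI ballI)
    have "inj_on g X.R" using g(1) X.R_sub unfolding bij_betw_def by (blast intro: inj_on_subset)
    then have "bij_betw g X.R Y.R" using gR by (simp add: bij_betw_def)
    then show "bij_betw g (X.D - X.R) (Y.D - Y.R)"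
      by (rule bij_betw_DiffI[OF g(1) _ X.R_sub Y.R_sub])
    show "g b \<in> Y.H \<longleftrightarrow> b \<in> X.H" if "b \<in> X.D - X.R" for b
      using that g(4) gD by auto
    show "g (X.nh h) = Y.nh (g h)" if h: "h \<in> X.H" for h
    proof -
      have "(Y.sg ^^ k) (g h) \<in> Y.H \<longleftrightarrow> (X.sg ^^ k) h \<in> X.H" for k
        using fp[of h k] h gD g(4) funpow_closed[OF X.bij_sg] by auto
      then show ?thesis unfolding next_in_def using fp[of h] h by simp
    qed
    show "g (X.bl b) = Y.bl (g b)" if b: "b \<in> X.D - X.R" for b
    proof -
      have "Y.bl (Y.ph (g (X.bl b))) = Y.bl (g b)" using gph[of "X.bl b"] b by simp
      then show ?thesis using b gD by simp
    qed
  qed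
  moreover have "Y.al (g b) \<in> Y.R \<longleftrightarrow> X.al b \<in> X.R" if "b \<in> X.D" for b
    using g(2)[OF that] gR'[of "X.al b"] that by simp
  ultimately show ?thesis by blast
qed

text \<open>The partner of a tail is recovered from the mobile by induction on the forest \<open>child\<close>: the white
  corner which it faces is the first one met when rotating through the partners of its children.\<close>

lemma fro_iso_of_amob_iso:
  assumes "cw_fro M1" "cw_fro M2"
    and iso: "amob_iso g (darts M1 - root_face M1) {d \<in> darts M1. head M1 d}
      (next_in (\<lambda>d. d \<in> {d \<in> darts M1. head M1 d}) (sigma M1)) (phi_inv M1)
      (darts M2 - root_face M2) {d \<in> darts M2. head M2 d}
      (next_in (\<lambda>d. d \<in> {d \<in> darts M2. head M2 d}) (sigma M2)) (phi_inv M2)"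
  shows "fro_iso M1 M2"
proof -
  interpret X: cw_fro M1 by (rule assms(1))
  interpret Y: cw_fro M2 by (rule assms(2))
  have g: "bij_betw g (X.D - X.R) (Y.D - Y.R)"
    and gH: "\<And>b. b \<in> X.D - X.R \<Longrightarrow> g b \<in> Y.H \<longleftrightarrow> b \<in> X.H"
    and gnh: "\<And>h. h \<in> X.H \<Longrightarrow> g (X.nh h) = Y.nh (g h)"
    and gbl: "\<And>b. b \<in> X.D - X.R \<Longrightarrow> g (X.bl b) = Y.bl (g b)"
    using iso unfolding amob_iso_def by blast+
  have gD: "g b \<in> Y.D" "g b \<notin> Y.R" if "b \<in> X.D" "b \<notin> X.R" for b using bij_betwE[OF g] that by blast+
  have gi: "x = y" if "x \<in> X.D" "y \<in> X.D" "x \<notin> X.R" "y \<notin> X.R" "g x = g y" for x y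
    using g that unfolding bij_betw_def inj_on_def by blast
  have img: "g ` (X.D - X.R) = Y.D - Y.R" using g unfolding bij_betw_def by (rule conjunct2)
  have ghead: "head M2 (g b) \<longleftrightarrow> head M1 b" if "b \<in> X.D" "b \<notin> X.R" for b
    using gH[of b] gD[OF that] that by simp
  have gph: "g (X.ph x) = Y.ph (g x)" if x: "x \<in> X.D" "x \<notin> X.R" for x
  proof -
    have "g x = Y.bl (g (X.ph x))" using gbl[of "X.ph x"] x by simp
    then show ?thesis using Y.bl(2)[of "g (X.ph x)"] gD(1)[of "X.ph x"] x by simp
  qed
  have first_head: "Y.first (g y) = g (X.first y)" if "y \<in> X.D" "y \<notin> X.R" "head M1 y" for y
    using that ghead[of y] by (simp add: X.first_def Y.first_def)
  have nh_inj: "x = y" if "x \<in> Y.H" "y \<in> Y.H" "Y.nh x = Y.nh y" for x y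
    using Y.bij_nh that unfolding bij_betw_def inj_on_def by blast
  have tail: "Y.al (g x) = g (X.al x) \<and> Y.first (g x) = g (X.first x)"
    if "x \<in> X.D" "x \<notin> X.R" "\<not> head M1 x" for x
    using X.wf_child that
  proof (induction x rule: wf_induct_rule)
    case (less x)
    note x = less.prems
    have F: "Y.first (g y) = g (X.first y)" if "y \<in> X.D" "y \<notin> X.R" "y = X.ph x \<or> y = X.sg x" for y
    proof (cases "head M1 y")
      case False
      then have "(y, x) \<in> X.child" using that x by (auto simp: X.child_def)
      then show ?thesis using less.IH that False by blast
    qed (use first_head that in blast)
    have ax: "X.al x \<in> X.D" "X.al x \<notin> X.R" "X.al x \<in> X.H" using X.head_notin_R[of "X.al x"] x by simp_all
    have gx: "g x \<in> Y.D" "\<not> head M2 (g x)" using gD ghead x by auto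
    \<comment> \<open>The dart \<open>ph x\<close> comes right after \<open>al x\<close> in the
      rotation, so the head it sees is the successor of the partner. As \<open>nh\<close> is
      injective, the partner itself is recovered.\<close>
    have "Y.nh (Y.al (g x)) = Y.first (g (X.ph x))"
      using Y.nh_eq[of "Y.al (g x)"] gx gph[OF x(1,2)] by (simp add: Y.sg_al)
    also have "\<dots> = g (X.first (X.ph x))" using F x by simp
    also have "\<dots> = Y.nh (g (X.al x))"
      using X.nh_eq[of "X.al x"] gnh[OF ax(3)] ax(1) by (simp add: X.sg_al)
    finally have al: "Y.al (g x) = g (X.al x)"
      by (rule nh_inj[rotated 2]) (use gx gD[OF ax(1,2)] ghead[OF ax(1,2)] ax in simp_all)
    have "Y.sg (g x) = Y.ph (Y.al (g x))" using gx by (simp add: Y.ph_al)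
    also have "\<dots> = g (X.sg x)" using al gph[OF ax(1,2)] x by (simp add: X.ph_al)
    finally have "Y.first (g x) = g (X.first x)"
      using Y.first_tail[OF gx] X.first_tail[OF x(1,3)] F[of "X.sg x"] X.sg_notin_R x by simp
    then show ?case using al by simp
  qed
  have firstg: "Y.first (g y) = g (X.first y)" if "y \<in> X.D" "y \<notin> X.R" for y
    using that tail first_head by blast
  \<comment> \<open>The partners of the tails off the root-face are now known. The heads that are
    left over on either side are the outer ones.\<close>
  have outer: "Y.al (g b) \<in> Y.R \<longleftrightarrow> X.al b \<in> X.R" if b: "b \<in> X.D" "head M1 b" for b
  proof -
    have bR: "b \<notin> X.R" using X.head_notin_R b by blast
    note gb = gD[OF b(1) bR]
    show ?thesis
    proof
      assume r: "Y.al (g b) \<in> Y.R"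
      show "X.al b \<in> X.R"
      proof (rule ccontr)
        assume "X.al b \<notin> X.R"
        then have "Y.al (g (X.al b)) = g b" "g (X.al b) \<in> Y.D" "g (X.al b) \<notin> Y.R"
          using tail[of "X.al b"] b gD[of "X.al b"] by auto
        then show False using r by (metis Y.al(2))
      qed
    next
      assume r: "X.al b \<in> X.R"
      show "Y.al (g b) \<in> Y.R"
      proof (rule ccontr)
        assume n: "Y.al (g b) \<notin> Y.R"
        have "Y.al (g b) \<in> g ` (X.D - X.R)" unfolding img by (intro DiffI Y.al(1) gb(1) n)
        then obtain y where y: "y \<in> X.D" "y \<notin> X.R" "g y = Y.al (g b)" by auto
        have hy: "\<not> head M1 y"
          unfolding ghead[OF y(1,2), symmetric] y(3) using ghead[OF b(1) bR] b(2) gb(1) by simp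
        then have ay: "X.al y \<in> X.D" "X.al y \<notin> X.R" using X.head_notin_R[of "X.al y"] y(1) by simp_all
        have "Y.al (Y.al (g b)) = g (X.al y)" using conjunct1[OF tail[OF y(1,2) hy]] y(3) by simp
        then have "g b = g (X.al y)" using Y.al(2)[OF gb(1)] by simp
        then have "b = X.al y" by (rule gi[OF b(1) ay(1) bR ay(2)])
        then have "X.al b = y" using y(1) by simp
        then show False using r y(2) by simp
      qed
    qed
  qed
  \<comment> \<open>Root-face darts have no counterpart in the mobile; each is sent to the dart
    opposite the image of its head.\<close>
  define k where "k x = (if x \<in> X.R then Y.al (g (X.al x)) else g x)" for x
  have aR: "X.al r \<in> X.D" "X.al r \<notin> X.R" "head M1 (X.al r)" if "r \<in> X.R" for r
    using that X.tails_R X.head_notin_R[of "X.al r"] by auto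
  have kR: "k r \<in> Y.R" if "r \<in> X.R" for r
    using outer[OF aR(1,3)[OF that]] that by (simp add: k_def)
  have bijR: "bij_betw k X.R Y.R"
    unfolding bij_betw_def
  proof
    show "inj_on k X.R"
    proof (rule inj_onI)
      fix x y assume xy: "x \<in> X.R" "y \<in> X.R" "k x = k y"
      then have "Y.al (Y.al (g (X.al x))) = Y.al (Y.al (g (X.al y)))" by (simp add: k_def)
      then have "g (X.al x) = g (X.al y)"
        using Y.al(2)[OF gD(1)[OF aR(1,2)[OF xy(1)]]] Y.al(2)[OF gD(1)[OF aR(1,2)[OF xy(2)]]] by simp
      then have "X.al x = X.al y"
        by (rule gi[OF aR(1)[OF xy(1)] aR(1)[OF xy(2)] aR(2)[OF xy(1)] aR(2)[OF xy(2)]])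
      then have "X.al (X.al x) = X.al (X.al y)" by simp
      then show "x = y" using xy by simp
    qed
    show "k ` X.R = Y.R"
    proof
      show "Y.R \<subseteq> k ` X.R"
      proof
        fix r assume r: "r \<in> Y.R"
        have ar: "Y.al r \<in> Y.D" "Y.al r \<notin> Y.R" "head M2 (Y.al r)"
          using r Y.tails_R Y.head_notin_R[of "Y.al r"] by auto
        then have "Y.al r \<in> g ` (X.D - X.R)" unfolding img by simp
        then obtain b where b: "b \<in> X.D" "b \<notin> X.R" "g b = Y.al r" by auto
        then have hb: "head M1 b" using ghead[OF b(1,2)] ar(3) by simp
        have "Y.al (g b) = r" using b(3) r by simp
        then have "X.al b \<in> X.R" "k (X.al b) = r" using outer[OF b(1) hb] r b by (auto simp: k_def)
        then show "r \<in> k ` X.R" by blast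
      qed
    qed (use kR in blast)
  qed
  have "bij_betw k (X.D - X.R) (Y.D - Y.R)"
    using g bij_betw_cong[of "X.D - X.R" k g] by (simp add: k_def)
  from bij_betw_combine[OF bijR this]
  have bijk: "bij_betw k X.D Y.D" using X.R_sub Y.R_sub by (simp add: Un_absorb1)
  have kal: "k (X.al x) = Y.al (k x)" if x: "x \<in> X.D" for x
  proof -
    consider "x \<in> X.R" | "x \<notin> X.R" "\<not> head M1 x" | "x \<notin> X.R" "head M1 x" "X.al x \<in> X.R"
      | "x \<notin> X.R" "head M1 x" "X.al x \<notin> X.R" by blast
    then show ?thesis
    proof cases
      case 1
      then show ?thesis using aR[OF 1] gD by (simp add: k_def)
    next
      case 2
      then show ?thesis using tail[OF x 2] X.head_notin_R[of "X.al x"] x by (simp add: k_def)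
    next
      case 3
      then show ?thesis using x by (simp add: k_def)
    next
      case 4
      then have "Y.al (g (X.al x)) = g x" using tail[of "X.al x"] x by simp
      then have "Y.al (g x) = g (X.al x)" using Y.al(2) gD(1)[of "X.al x"] 4 x by (metis X.al(1))
      then show ?thesis using 4 by (simp add: k_def)
    qed
  qed
  have kph: "k (X.ph x) = Y.ph (k x)" if x: "x \<in> X.D" for x
  proof (cases "x \<in> X.R")
    case False
    then show ?thesis using gph[OF x False] x by (simp add: k_def)
  next
    case True
    let ?r = "X.ph x"
    have r: "?r \<in> X.R" "?r \<in> X.D" "\<not> head M1 ?r" using True x X.tails_R[of ?r] by auto
    note ar = aR[OF r(1)] and ax = aR[OF True]
    have kr: "k ?r \<in> Y.R" using kR[OF r(1)] .
    then have krD: "k ?r \<in> Y.D" "\<not> head M2 (k ?r)" using Y.tails_R by auto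
    have akr: "Y.al (k ?r) = g (X.al ?r)" using r gD[OF ar(1,2)] by (simp add: k_def)
    have "Y.sg (k ?r) = Y.ph (g (X.al ?r))" using Y.ph_al[OF krD(1)] akr by simp
    also have "\<dots> = g (X.sg ?r)" using gph[OF ar(1,2)] r by (simp add: X.ph_al)
    finally have "Y.first (k ?r) = Y.first (g (X.sg ?r))" using Y.first_tail[OF krD] by simp
    also have "\<dots> = g (X.first (X.sg ?r))" using firstg X.sg_notin_R r by simp
    also have "\<dots> = g (X.nh (X.al x))"
      using X.first_tail[OF r(2,3)] X.nh_eq[of "X.al x"] ax by (simp add: X.sg_al)
    also have "\<dots> = Y.nh (g (X.al x))" using gnh ax by simp
    finally have 1: "Y.first (k ?r) = Y.nh (g (X.al x))" .
    \<comment> \<open>The dart before \<open>k ?r\<close> on the root-face. It equals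
      \<open>k x\<close>, because the heads of the two edges have the same successor under
      \<open>nh\<close>.\<close>
    let ?s = "Y.bl (k ?r)"
    have s: "?s \<in> Y.R" "?s \<in> Y.D" "Y.ph ?s = k ?r" using kr krD(1) Y.R_ph[of ?s] by auto
    have "Y.first (k ?r) = Y.nh (Y.al ?s)" using Y.nh_eq[of "Y.al ?s"] s by (simp add: Y.sg_al)
    with 1 have "Y.nh (Y.al ?s) = Y.nh (g (X.al x))" by simp
    then have "Y.al ?s = g (X.al x)"
      by (rule nh_inj[rotated 2]) (use s Y.tails_R gD[OF ax(1,2)] ghead[OF ax(1,2)] ax in simp_all)
    then have "?s = k x" using Y.al(2)[OF s(2)] True by (simp add: k_def)
    then show ?thesis using s(3) by simp
  qed
  have "k (X.sg x) = Y.sg (k x)" if x: "x \<in> X.D" for x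
    using kph[of "X.al x"] kal[OF x] x bij_betwE[OF bijk] by (simp add: X.ph_al Y.ph_al)
  moreover have "head M2 (k x) = head M1 x" if "x \<in> X.D" for x
  proof (cases "x \<in> X.R")
    case True
    then show ?thesis using kR[OF True] X.tails_R Y.tails_R by blast
  qed (use that ghead in \<open>simp add: k_def\<close>)
  ultimately show ?thesis
    unfolding fro_iso_def using bijk kal kR[OF X.root_in_R] by blast
qed

section \<open>Parenthesis matching along a cycle\<close>

lemma orb_period:
  assumes "finite D" "bij_betw f D D" "x \<in> D"
  obtains p where "p > 0" "(f ^^ p) x = x" "bij_betw (\<lambda>j. (f ^^ j) x) {..<p} (orb f x)"
proof -
  obtain k where k: "k > 0" "(f ^^ k) x = x" using funpow_return[OF assms] by blast
  define p where "p = (LEAST k. 0 < k \<and> (f ^^ k) x = x)"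
  have p: "0 < p \<and> (f ^^ p) x = x" unfolding p_def by (rule LeastI[of _ k]) (use k in simp)
  have least: "\<not> (0 < j \<and> (f ^^ j) x = x)" if "j < p" for j
    using not_less_Least[of j "\<lambda>k. 0 < k \<and> (f ^^ k) x = x"] that by (simp add: p_def)
  have ne: "(f ^^ a) x \<noteq> (f ^^ b) x" if ab: "a < b" "b < p" for a b
  proof
    assume "(f ^^ a) x = (f ^^ b) x"
    also have "\<dots> = (f ^^ a) ((f ^^ (b - a)) x)"
      using ab by (simp flip: funpow_add[THEN fun_cong, unfolded comp_def])
    finally have "x = (f ^^ (b - a)) x"
      using funpow_inj[OF assms(2,3)] funpow_closed[OF assms(2,3)] by blast
    then have "(f ^^ (b - a)) x = x" by (rule sym)
    moreover have "0 < b - a" "b - a < p" using ab by linarith+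
    ultimately show False using least[of "b - a"] by blast
  qed
  then have "inj_on (\<lambda>j. (f ^^ j) x) {..<p}"
    unfolding inj_on_def by (metis lessThan_iff linorder_neqE_nat)
  moreover have "(\<lambda>j. (f ^^ j) x) ` {..<p} = orb f x"
  proof
    show "orb f x \<subseteq> (\<lambda>j. (f ^^ j) x) ` {..<p}"
    proof (rule orb_subset)
      show "x \<in> (\<lambda>j. (f ^^ j) x) ` {..<p}" by (rule image_eqI[of _ _ 0]) (use p in auto)
      fix y assume "y \<in> (\<lambda>j. (f ^^ j) x) ` {..<p}"
      then obtain j where j: "j < p" "y = (f ^^ j) x" by blast
      show "f y \<in> (\<lambda>j. (f ^^ j) x) ` {..<p}"
      proof (cases "Suc j = p")
        case True
        then have "f y = (f ^^ 0) x" using p j by auto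
        then show ?thesis using p by blast
      next
        case False
        then have "f y = (f ^^ Suc j) x" "Suc j < p" using j by auto
        then show ?thesis by blast
      qed
    qed
  qed auto
  ultimately have "bij_betw (\<lambda>j. (f ^^ j) x) {..<p} (orb f x)" by (simp only: bij_betw_def)
  then show ?thesis using that p by blast
qed

text \<open>Read the elements of \<open>X\<close> as opening and the others as closing parentheses along the cycle \<open>f\<close>.
  Then \<open>mu\<close> matches parentheses and \<open>m\<close> is the length of a matched block: the block of \<open>x\<close> is \<open>x\<close>,
  followed by shorter blocks and by \<open>mu x\<close>.\<close>

definition block_matching :: "('a \<Rightarrow> 'a) \<Rightarrow> 'a set \<Rightarrow> 'a set \<Rightarrow> ('a \<Rightarrow> 'a) \<Rightarrow> ('a \<Rightarrow> nat) \<Rightarrow> bool" where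
  "block_matching f B X mu m \<longleftrightarrow> inj_on mu X \<and> mu ` X \<subseteq> B - X \<and>
    (\<forall>x\<in>X. \<exists>k. ((\<lambda>z. f (mu z)) ^^ k) (f x) = mu x \<and>
       (\<forall>j<k. ((\<lambda>z. f (mu z)) ^^ j) (f x) \<in> X \<and> m (((\<lambda>z. f (mu z)) ^^ j) (f x)) < m x))"

lemma block_matchingD:
  assumes "block_matching f B X mu m"
  shows "inj_on mu X" "mu ` X \<subseteq> B - X"
    "\<And>x. x \<in> X \<Longrightarrow> \<exists>k. ((\<lambda>z. f (mu z)) ^^ k) (f x) = mu x \<and>
       (\<forall>j<k. ((\<lambda>z. f (mu z)) ^^ j) (f x) \<in> X \<and> m (((\<lambda>z. f (mu z)) ^^ j) (f x)) < m x)"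
proof -
  note d = assms[unfolded block_matching_def]
  show "inj_on mu X" by (rule conjunct1[OF d])
  show "mu ` X \<subseteq> B - X" by (rule conjunct1[OF conjunct2[OF d]])
  show "x \<in> X \<Longrightarrow> \<exists>k. ((\<lambda>z. f (mu z)) ^^ k) (f x) = mu x \<and>
      (\<forall>j<k. ((\<lambda>z. f (mu z)) ^^ j) (f x) \<in> X \<and> m (((\<lambda>z. f (mu z)) ^^ j) (f x)) < m x)" for x
    by (rule bspec[OF conjunct2[OF conjunct2[OF d]]])
qed

text \<open>Closing parentheses outnumber opening ones, so the height counted from an opening one
  returns to 0 within one turn of the cycle. The first return gives the match.\<close>

lemma cyclic_matching:
  fixes f :: "'a \<Rightarrow> 'a"
  assumes fin: "finite B" and bij: "bij_betw f B B" and cyc: "\<And>x. x \<in> B \<Longrightarrow> orb f x = B"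
    and X: "X \<subseteq> B" "card X < card (B - X)"
  shows "\<exists>mu m. block_matching f B X mu m"
proof -
  \<comment> \<open>Openings count negatively, so a block is complete when the partial sum first
    becomes nonnegative.\<close>
  define w where "w y = (if y \<in> X then - 1 else 1 :: int)" for y
  define S where "S x n = (\<Sum>j<n. w ((f ^^ j) x))" for x n
  have S_Suc: "S x (Suc n) = S x n + w ((f ^^ n) x)" for x n by (simp add: S_def)
  have S_add: "S x (a + b) = S x a + S ((f ^^ a) x) b" for x a b
  proof (induction b)
    case (Suc b)
    have "(f ^^ b) ((f ^^ a) x) = (f ^^ (a + b)) x" by (simp add: funpow_add add.commute[of a])
    then show ?case using Suc S_Suc by simp
  qed (simp add: S_def)
  have fB: "(f ^^ n) x \<in> B" if "x \<in> B" for n x using funpow_closed[OF bij that] .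
  define m where "m x = (LEAST n. 0 < n \<and> 0 \<le> S x n)" for x
  have ex: "\<exists>p>0. 0 \<le> S x p" if x: "x \<in> X" for x
  proof -
    have xB: "x \<in> B" using x X by blast
    obtain p where p: "p > 0" "bij_betw (\<lambda>j. (f ^^ j) x) {..<p} B"
      using orb_period[OF fin bij xB] cyc[OF xB] by metis
    have "S x p = (\<Sum>y\<in>B. w y)" unfolding S_def by (rule sum.reindex_bij_betw[OF p(2)])
    also have "\<dots> = (\<Sum>y\<in>X. w y) + (\<Sum>y\<in>B - X. w y)" using sum.subset_diff[OF X(1) fin, of w] by simp
    also have "(\<Sum>y\<in>X. w y) = - int (card X)" by (simp add: w_def)
    also have "(\<Sum>y\<in>B - X. w y) = int (card (B - X))" by (simp add: w_def)
    finally have "0 \<le> S x p" using X(2) by simp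
    then show ?thesis using p(1) by blast
  qed
  have m: "0 < m x \<and> 0 \<le> S x (m x)" if "x \<in> X" for x
  proof -
    obtain p where "0 < p \<and> 0 \<le> S x p" using ex[OF \<open>x \<in> X\<close>] by blast
    then show ?thesis unfolding m_def by (rule LeastI)
  qed
  have neg: "S x j < 0" if "x \<in> X" "0 < j" "j < m x" for x j
    using not_less_Least[of j "\<lambda>n. 0 < n \<and> 0 \<le> S x n"] that by (auto simp: m_def)
  have m_le: "m x \<le> n" if "0 < n" "0 \<le> S x n" for x n
    unfolding m_def by (rule Least_le) (use that in simp)
  \<comment> \<open>The block of \<open>x\<close> occupies the offsets 0 to \<open>m x - 1\<close>,
    and its last element closes it.\<close>
  define mu where "mu x = (f ^^ (m x - 1)) x" for x
  have m2: "S x (m x) = 0 \<and> 1 < m x \<and> mu x \<in> B - X" if x: "x \<in> X" for x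
  proof -
    have S1: "S x 1 = - 1" using x by (simp add: S_def w_def)
    have "m x \<noteq> 1" using m[OF x] S1 by auto
    then have m1: "1 < m x" using m[OF x] by linarith
    then have e: "S x (m x) = S x (m x - 1) + w (mu x)" using S_Suc[of x "m x - 1"] by (simp add: mu_def)
    have "S x (m x - 1) < 0" using neg[OF x, of "m x - 1"] m1 by simp
    moreover have "0 \<le> S x (m x)" using m[OF x] by blast
    ultimately have "w (mu x) = 1" "S x (m x) = 0"
      using e by (auto simp: w_def split: if_splits)
    moreover have "mu x \<in> B" using fB X x by (auto simp: mu_def)
    ultimately show ?thesis using m1 by (auto simp: w_def split: if_splits)
  qed
  have f_mu: "f (mu x) = (f ^^ m x) x" if "x \<in> X" for x
  proof -
    have "m x = Suc (m x - 1)" using m[OF that] by simp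
    then show ?thesis unfolding mu_def by (metis funpow.simps(2) comp_apply)
  qed
  \<comment> \<open>If two blocks end together, the shorter starts \<open>d\<close> steps inside the
    longer. Its own sum is 0, so the longer one already had height 0 at its start, which forces
    \<open>d = 0\<close>.\<close>
  have mu_eq: "x = y" if xy: "x \<in> X" "y \<in> X" "mu x = mu y" "m x \<le> m y" for x y
  proof -
    define d where "d = m y - m x"
    have d: "m y = d + m x" using xy by (simp add: d_def)
    have "(f ^^ m x) x = (f ^^ m x) ((f ^^ d) y)"
    proof -
      have "(f ^^ m x) x = (f ^^ m y) y" using f_mu[OF xy(1)] f_mu[OF xy(2)] xy(3) by simp
      also have "m y = m x + d" using d by simp
      finally show ?thesis by (simp add: funpow_add)
    qed
    then have e: "x = (f ^^ d) y" using funpow_inj[OF bij] fB X xy by blast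
    have "S y (m y) = S y d + S x (m x)" unfolding d using S_add[of y d "m x"] e by simp
    then have "S y d = 0" using m2 xy by simp
    then have "\<not> (0 < d \<and> d < m y)" using neg[OF xy(2), of d] by auto
    then have "d = 0" using d m[OF xy(1)] by simp
    then show ?thesis using e by simp
  qed
  have inj: "inj_on mu X"
    unfolding inj_on_def using mu_eq by (metis nle_le)
  \<comment> \<open>From an opening element, \<open>?J\<close> jumps over its whole block. Inside
    the block of \<open>x\<close> such jumps keep the height at -1 until \<open>mu x\<close> is
    reached.\<close>
  let ?J = "\<lambda>z. f (mu z)"
  have chain: "\<exists>k. (?J ^^ k) ((f ^^ q) x) = mu x \<and>
       (\<forall>j<k. (?J ^^ j) ((f ^^ q) x) \<in> X \<and> m ((?J ^^ j) ((f ^^ q) x)) < m x)"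
    if "x \<in> X" "0 < q" "q < m x" "S x q = - 1" for x q
    using that
  proof (induction "m x - q" arbitrary: q rule: less_induct)
    case less
    note x = less.prems(1)
    let ?z = "(f ^^ q) x"
    show ?case
    proof (cases "?z \<in> X")
      case False
      then have "S x (Suc q) = 0" using less.prems by (simp add: S_Suc w_def)
      then have "m x \<le> Suc q" using m_le by simp
      then have "q = m x - 1" using less.prems by simp
      then have "(?J ^^ 0) ?z = mu x" by (simp add: mu_def)
      then show ?thesis by blast
    next
      case True
      have le: "S ?z b \<le> 0" if "b \<le> m ?z" for b
        using neg[OF True, of b] m2[OF True] that by (cases "b = 0"; cases "b = m ?z") (auto simp: S_def)
      \<comment> \<open>A block opened inside the block of \<open>x\<close> cannot outlast it: cut
        off at the end of the latter, it would add at most 0 to the height -1, whereas the total is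
        0.\<close>
      have lt: "q + m ?z < m x"
      proof (rule ccontr)
        assume n: "\<not> ?thesis"
        define b where "b = m x - q"
        have b: "b \<le> m ?z" "m x = q + b" using n less.prems by (auto simp: b_def)
        then have "S x (m x) = - 1 + S ?z b" using S_add less.prems by simp
        then show False using le[OF b(1)] m2[OF x] by simp
      qed
      have z': "(f ^^ (q + m ?z)) x = ?J ?z"
        using f_mu[OF True] by (simp add: funpow_add add.commute[of q])
      have "S x (q + m ?z) = - 1" using S_add[of x q "m ?z"] m2[OF True] less.prems by simp
      moreover have "m x - (q + m ?z) < m x - q" using m[OF True] lt by linarith
      ultimately obtain k where k: "(?J ^^ k) (?J ?z) = mu x"
        "\<forall>j<k. (?J ^^ j) (?J ?z) \<in> X \<and> m ((?J ^^ j) (?J ?z)) < m x"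
        using less.hyps[of "q + m ?z"] lt m[OF True] x unfolding z' by auto
      have "(?J ^^ Suc k) ?z = mu x" using k(1) by (simp only: funpow_Suc_right comp_apply)
      moreover have "(?J ^^ j) ?z \<in> X \<and> m ((?J ^^ j) ?z) < m x" if "j < Suc k" for j
      proof (cases j)
        case 0
        then show ?thesis using True lt by simp
      next
        case (Suc i)
        then show ?thesis using k(2) that by (simp only: funpow_Suc_right comp_apply Suc_less_eq)
      qed
      ultimately show ?thesis by blast
    qed
  qed
  show ?thesis
    unfolding block_matching_def
  proof (intro exI[of _ mu] exI[of _ m] conjI ballI)
    show "inj_on mu X" by (rule inj)
    show "mu ` X \<subseteq> B - X" using m2 by blast
    fix x assume x: "x \<in> X"
    have "S x 1 = - 1" using x by (simp add: S_def w_def)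
    then show "\<exists>k. (?J ^^ k) (f x) = mu x \<and> (\<forall>j<k. (?J ^^ j) (f x) \<in> X \<and> m ((?J ^^ j) (f x)) < m x)"
      using chain[of x 1] x m2[OF x] by simp
  qed
qed

text \<open>A chain that begins outside the image of an injective map cannot repeat a point, so it
  cannot stay in a finite set.\<close>

lemma escape:
  assumes "finite I" "inj_on s I" "x \<notin> s ` I"
  obtains k where "(s ^^ k) x \<notin> I" "\<And>j. j < k \<Longrightarrow> (s ^^ j) x \<in> I"
proof -
  have "\<exists>k. (s ^^ k) x \<notin> I"
  proof (rule ccontr)
    assume n: "\<not> ?thesis"
    then have I: "(s ^^ k) x \<in> I" for k by blast
    have ne: "(s ^^ a) x \<noteq> (s ^^ b) x" if "a < b" for a b
      using that
    proof (induction a arbitrary: b)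
      case 0
      then obtain c where "b = Suc c" by (cases b) auto
      then show ?case using I[of c] assms(3) by auto
    next
      case (Suc a)
      then obtain c where "b = Suc c" "a < c" by (cases b) auto
      then show ?case using Suc.IH[of c] inj_onD[OF assms(2) _ I I, of a c] by auto
    qed
    then have "inj (\<lambda>k. (s ^^ k) x)" unfolding inj_on_def by (metis linorder_neqE_nat)
    moreover have "range (\<lambda>k. (s ^^ k) x) \<subseteq> I" using I by blast
    ultimately have "finite (UNIV :: nat set)" using assms(1) finite_subset finite_imageD by blast
    then show False by simp
  qed
  then obtain k0 where k0: "(s ^^ k0) x \<notin> I" by blast
  define k where "k = (LEAST k. (s ^^ k) x \<notin> I)"
  have "(s ^^ k) x \<notin> I" unfolding k_def by (rule LeastI[of _ k0]) (rule k0)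
  moreover have "(s ^^ j) x \<in> I" if "j < k" for j
    using not_less_Least[of j "\<lambda>k. (s ^^ k) x \<notin> I"] that by (auto simp: k_def)
  ultimately show ?thesis using that by blast
qed

text \<open>Run both chains backwards, by injectivity, until one start is reached. The other chain
  must start there too, since a start is not an image.\<close>

lemma chain_start_unique:
  assumes "inj_on s I" "x \<notin> s ` I" "y \<notin> s ` I" "(s ^^ j) x = (s ^^ k) y"
    "\<And>i. i < j \<Longrightarrow> (s ^^ i) x \<in> I" "\<And>i. i < k \<Longrightarrow> (s ^^ i) y \<in> I"
  shows "x = y"
  using assms(4-6)
proof (induction j arbitrary: k)
  case 0
  show ?case
  proof (cases k)
    case (Suc c)
    then have "x = s ((s ^^ c) y)" "(s ^^ c) y \<in> I" using 0 by auto
    then show ?thesis using assms(2) by blast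
  qed (use 0 in simp)
next
  case (Suc j)
  show ?case
  proof (cases k)
    case 0
    then have "y = s ((s ^^ j) x)" "(s ^^ j) x \<in> I" using Suc.prems by auto
    then show ?thesis using assms(3) by blast
  next
    case k: (Suc c)
    then have "s ((s ^^ j) x) = s ((s ^^ c) y)" "(s ^^ j) x \<in> I" "(s ^^ c) y \<in> I" using Suc.prems by auto
    then have "(s ^^ j) x = (s ^^ c) y" using assms(1) by (metis inj_onD)
    then show ?thesis using Suc.IH[of c] Suc.prems k by simp
  qed
qed

text \<open>This is \<open>genus2_nonneg\<close> for a connected map: V + F is at most E + 2, where
  fixed points of \<open>a\<close>, the buds, do not count as edges.\<close>

lemma euler_inequality:
  assumes fin: "finite D" and ne: "D \<noteq> {}" and bij: "bij_betw s D D"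
    and a: "\<And>d. d \<in> D \<Longrightarrow> a d \<in> D \<and> a (a d) = d"
    and conn: "connected_darts D a s"
  shows "card (orb s ` D) + card (orb (s \<circ> a) ` D) \<le> card {d \<in> D. a d \<noteq> d} div 2 + 2"
proof -
  have bij_a: "bij_betw a D D" by (rule bij_betw_involution) (rule a)
  interpret edge_involution D s a by unfold_locales (use fin bij a in auto)
  let ?C = "{d \<in> D. a d \<noteq> d}"
  have C: "edge_set ?C" using a unfolding edge_set_def by auto
  have r: "restr ?C a d = a d" if "d \<in> D" for d using that by (simp add: restr_def)
  then have g: "gr (restr ?C a) D = gr a D" by (auto simp: gr_def)
  obtain d0 where d0: "d0 \<in> D" using ne by blast
  let ?S = "gr s D \<union> gr (restr ?C a) D"
  have "(x, y) \<in> eqv ?S" if "x \<in> D" "y \<in> D" for x y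
    using conn that unfolding connected_darts_iff[OF fin bij_a bij] g Un_commute[of "gr s D"] by blast
  then have "eqv ?S `` {x} = eqv ?S `` {d0}" if "x \<in> D" for x
    unfolding eqv_class_eq using that d0 by blast
  then have "(\<lambda>x. eqv ?S `` {x}) ` D = (\<lambda>x. eqv ?S `` {d0}) ` D" by (rule image_cong[OF refl])
  also have "\<dots> = {eqv ?S `` {d0}}" using d0 by (rule image_constant)
  finally have "ncl D ?S = 1" by (simp add: ncl_def)
  moreover have "orb (s \<circ> restr ?C a) x = orb (s \<circ> a) x" if "x \<in> D" for x
    by (rule orb_cong[OF bij_comp[OF C] _ that]) (simp add: r)
  then have "orb (s \<circ> restr ?C a) ` D = orb (s \<circ> a) ` D" by auto
  ultimately show ?thesis using genus2_nonneg[OF C] by (simp add: genus2_def)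
qed

section \<open>Closure of a mobile\<close>

text \<open>The inverse construction. The buds \<open>I = B - H\<close> are matched with edges of the mobile by \<open>mt\<close>; the
  unmatched edges \<open>U\<close> receive new tails \<open>u + N\<close>, which form the root face.\<close>

locale closure =
  fixes B H :: "nat set" and om bl mt m :: "nat \<Rightarrow> nat" and N :: nat
  assumes amob: "amob B H om bl" and BN: "\<And>b. b \<in> B \<Longrightarrow> b < N"
    and inj_mt: "inj_on mt (B - H)" and mt_H: "\<And>i. i \<in> B - H \<Longrightarrow> mt i \<in> H"
    and card_less: "card (B - H) < card H"
    and chain: "\<And>i. i \<in> B - H \<Longrightarrow>
      \<exists>k. ((\<lambda>z. inv_into B bl (mt z)) ^^ k) (inv_into B bl i) = om (mt i) \<and>
        (\<forall>j<k. ((\<lambda>z. inv_into B bl (mt z)) ^^ j) (inv_into B bl i) \<in> B - H \<and>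
               m (((\<lambda>z. inv_into B bl (mt z)) ^^ j) (inv_into B bl i)) < m i)"
begin

abbreviation "I \<equiv> B - H"

definition U :: "nat set" where "U = H - mt ` I"
definition ph :: "nat \<Rightarrow> nat" where "ph = inv_into B bl"
text \<open>On a bud \<open>z\<close> this is the vertex rotation of the map to be built,
  \<open>ph\<close> after the involution, with \<open>mt z\<close> as the other dart of the edge of
  \<open>z\<close>.\<close>

definition s :: "nat \<Rightarrow> nat" where "s z = ph (mt z)"

lemma finB: "finite B" and HB: "H \<subseteq> B" and bij_om: "bij_betw om H H" and bij_bl: "bij_betw bl B B"
  using amob by (auto simp: amob_def)

lemma bij_ph: "bij_betw ph B B"
  unfolding ph_def by (rule bij_betw_inv_into[OF bij_bl])

lemma ph_B [simp]: "b \<in> B \<Longrightarrow> ph b \<in> B"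
  using bij_betwE[OF bij_ph] by blast

lemma bl_ph [simp]: "b \<in> B \<Longrightarrow> bl (ph b) = b" and ph_bl [simp]: "b \<in> B \<Longrightarrow> ph (bl b) = b"
  using bij_bl by (simp_all add: ph_def bij_betw_inv_into_left bij_betw_inv_into_right)

lemma bl_B [simp]: "b \<in> B \<Longrightarrow> bl b \<in> B"
  using bij_betwE[OF bij_bl] by blast

lemma ph_inj: "x \<in> B \<Longrightarrow> y \<in> B \<Longrightarrow> ph x = ph y \<longleftrightarrow> x = y"
  using bl_ph by metis

lemma om_H [simp]: "h \<in> H \<Longrightarrow> om h \<in> H"
  using bij_betwE[OF bij_om] by blast

lemma U_H: "u \<in> U \<Longrightarrow> u \<in> H" and U_B: "u \<in> U \<Longrightarrow> u \<in> B" and U_mt: "u \<in> U \<Longrightarrow> i \<in> I \<Longrightarrow> mt i \<noteq> u"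
  using HB by (auto simp: U_def)

lemma mt_B: "i \<in> I \<Longrightarrow> mt i \<in> B"
  using mt_H HB by blast

lemma finU: "finite U"
  using finB HB finite_subset unfolding U_def by blast

lemma card_U: "card U + card I = card H" "U \<noteq> {}"
proof -
  have f: "finite H" using finB HB finite_subset by blast
  have "card (mt ` I) = card I" by (rule card_image[OF inj_mt])
  moreover have "mt ` I \<subseteq> H" using mt_H by blast
  ultimately show "card U + card I = card H"
    unfolding U_def using f card_less by (simp add: card_Diff_subset finite_subset)
  then show "U \<noteq> {}" using card_less by auto
qed

text \<open>In the map to be built, rotation past the head \<open>mt i\<close> comes to
  \<open>ph i\<close> and continues by \<open>s\<close>. It meets only buds of smaller rank than
  \<open>i\<close> before the next head \<open>om (mt i)\<close>.\<close>

lemma chain': "i \<in> I \<Longrightarrow> \<exists>k. (s ^^ k) (ph i) = om (mt i) \<and>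
    (\<forall>j<k. (s ^^ j) (ph i) \<in> I \<and> m ((s ^^ j) (ph i)) < m i)"
  using chain[of i] unfolding ph_def[symmetric] s_def[symmetric] .

lemma inj_s: "inj_on s I"
proof (rule inj_onI)
  fix x y assume xy: "x \<in> I" "y \<in> I" "s x = s y"
  then have "mt x = mt y" using ph_inj mt_B unfolding s_def by blast
  then show "x = y" using inj_mt xy by (metis inj_onD)
qed

lemma start: "b \<in> I \<union> U \<Longrightarrow> ph b \<notin> s ` I"
proof
  assume b: "b \<in> I \<union> U" and "ph b \<in> s ` I"
  then obtain i where i: "i \<in> I" "ph b = ph (mt i)" unfolding s_def by blast
  moreover have "b \<in> B" using b U_B by blast
  ultimately have "b = mt i" using ph_inj mt_B by blast
  then show False using b i mt_H U_mt by blast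
qed

text \<open>The chain from \<open>ph a\<close>, for an unmatched \<open>a\<close>, leaves
  \<open>I\<close> at some head \<open>om u\<close>. Here \<open>u\<close> is unmatched: the chain
  that ends at \<open>om (mt i)\<close> begins at \<open>ph i\<close>, and ends determine starts.
  Sending \<open>a\<close> to \<open>u\<close> is a permutation of \<open>U\<close>, with inverse
  \<open>rho\<close>.\<close>

lemma ex_rho:
  "\<exists>rho. bij_betw rho U U \<and> (\<forall>u\<in>U. \<exists>k. (s ^^ k) (ph (rho u)) = om u \<and> (\<forall>j<k. (s ^^ j) (ph (rho u)) \<in> I))"
proof -
  have fI: "finite I" using finB by simp
  have "\<exists>u\<in>U. \<exists>k. (s ^^ k) (ph a) = om u \<and> (\<forall>j<k. (s ^^ j) (ph a) \<in> I)" if a: "a \<in> U" for a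
  proof -
    obtain k where k: "(s ^^ k) (ph a) \<notin> I" "\<And>j. j < k \<Longrightarrow> (s ^^ j) (ph a) \<in> I"
      using escape[OF fI inj_s start[of a]] a by blast
    have "(s ^^ k) (ph a) \<in> B"
    proof (cases k)
      case 0
      then show ?thesis using a U_B by simp
    next
      case (Suc j)
      then show ?thesis using k(2)[of j] mt_B by (simp add: s_def)
    qed
    then have "(s ^^ k) (ph a) \<in> H" using k(1) by blast
    then obtain g where g: "g \<in> H" "(s ^^ k) (ph a) = om g"
      using bij_om unfolding bij_betw_def by (metis imageE)
    have "g \<in> U"
    proof (rule ccontr)
      assume "g \<notin> U"
      then obtain i where i: "i \<in> I" "g = mt i" using g by (auto simp: U_def)
      obtain n where n: "(s ^^ n) (ph i) = om g" "\<And>j. j < n \<Longrightarrow> (s ^^ j) (ph i) \<in> I"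
        using chain'[OF i(1)] i(2) by blast
      have "ph i = ph a"
        by (rule chain_start_unique[OF inj_s, of _ _ n k]) (use n k g start a i in auto)
      then have "i = a" using ph_inj U_B a i by blast
      then show False using a i U_H by blast
    qed
    then show ?thesis using g k(2) by blast
  qed
  then obtain c where c: "\<And>a. a \<in> U \<Longrightarrow> c a \<in> U"
    "\<And>a. a \<in> U \<Longrightarrow> \<exists>k. (s ^^ k) (ph a) = om (c a) \<and> (\<forall>j<k. (s ^^ j) (ph a) \<in> I)"
    by metis
  have "inj_on c U"
  proof (rule inj_onI)
    fix a b assume ab: "a \<in> U" "b \<in> U" "c a = c b"
    obtain k where k: "(s ^^ k) (ph a) = om (c a)" "\<And>j. j < k \<Longrightarrow> (s ^^ j) (ph a) \<in> I" using c(2)[OF ab(1)] by blast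
    obtain n where n: "(s ^^ n) (ph b) = om (c b)" "\<And>j. j < n \<Longrightarrow> (s ^^ j) (ph b) \<in> I" using c(2)[OF ab(2)] by blast
    have "ph a = ph b"
      by (rule chain_start_unique[OF inj_s, of _ _ k n]) (use n k start ab in auto)
    then show "a = b" using ph_inj U_B ab by blast
  qed
  moreover have "c ` U \<subseteq> U" using c(1) by blast
  ultimately have bij: "bij_betw c U U" using endo_inj_surj[OF finU] by (simp add: bij_betw_def)
  have "c (inv_into U c u) = u" "inv_into U c u \<in> U" if "u \<in> U" for u
    using bij that by (auto simp: bij_betw_def f_inv_into_f inv_into_into)
  then have "\<forall>u\<in>U. \<exists>k. (s ^^ k) (ph (inv_into U c u)) = om u \<and> (\<forall>j<k. (s ^^ j) (ph (inv_into U c u)) \<in> I)"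
    using c(2) by metis
  then show ?thesis using bij_betw_inv_into[OF bij] by blast
qed

definition rho :: "nat \<Rightarrow> nat" where
  "rho = (SOME rho. bij_betw rho U U \<and>
     (\<forall>u\<in>U. \<exists>k. (s ^^ k) (ph (rho u)) = om u \<and> (\<forall>j<k. (s ^^ j) (ph (rho u)) \<in> I)))"

lemma rho: "bij_betw rho U U"
  "u \<in> U \<Longrightarrow> \<exists>k. (s ^^ k) (ph (rho u)) = om u \<and> (\<forall>j<k. (s ^^ j) (ph (rho u)) \<in> I)"
  using someI_ex[OF ex_rho, folded rho_def] by blast+

lemma rho_U [simp]: "u \<in> U \<Longrightarrow> rho u \<in> U"
  using bij_betwE[OF rho(1)] by blast

section \<open>The reconstructed map\<close>

definition RF :: "nat set" where "RF = (\<lambda>u. u + N) ` U"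
definition DD :: "nat set" where "DD = B \<union> RF"

definition alp :: "nat \<Rightarrow> nat" where
  "alp d = (if d \<in> I then mt d else if d \<in> mt ` I then inv_into I mt d
            else if d \<in> U then d + N else d - N)"

text \<open>With this choice of successor on the root-face, rotation from an unmatched
  \<open>u\<close> meets the new tail \<open>rho u + N\<close> and then follows the chain from
  \<open>ph (rho u)\<close> to \<open>om u\<close>.\<close>

definition pf :: "nat \<Rightarrow> nat" where
  "pf d = (if d \<in> B then ph d else rho (d - N) + N)"

definition sgm :: "nat \<Rightarrow> nat" where "sgm = pf \<circ> alp"

lemma RF_notB: "r \<in> RF \<Longrightarrow> r \<notin> B"
  using BN by (fastforce simp: RF_def)

lemma alp_I: "i \<in> I \<Longrightarrow> alp i = mt i"
  and alp_mt: "i \<in> I \<Longrightarrow> alp (mt i) = i"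
  and alp_U: "u \<in> U \<Longrightarrow> alp u = u + N"
  and alp_R: "u \<in> U \<Longrightarrow> alp (u + N) = u"
proof -
  show "i \<in> I \<Longrightarrow> alp i = mt i" by (simp add: alp_def)
  show "i \<in> I \<Longrightarrow> alp (mt i) = i" using mt_H[of i] inj_mt by (simp add: alp_def)
  show "u \<in> U \<Longrightarrow> alp u = u + N" using U_H[of u] U_mt[of u] by (auto simp: alp_def)
  assume u: "u \<in> U"
  then have n: "u + N \<notin> B" using RF_notB by (simp add: RF_def)
  moreover have "u + N \<notin> mt ` I" using n mt_B by auto
  moreover have "u + N \<notin> U" using n U_B by blast
  ultimately show "alp (u + N) = u" by (simp add: alp_def)
qed

lemma dart_cases:
  assumes "d \<in> DD"
  obtains "d \<in> I" | i where "i \<in> I" "d = mt i" | "d \<in> U" | u where "u \<in> U" "d = u + N"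
  using assms HB by (auto simp: DD_def RF_def U_def)

lemma alp: "d \<in> DD \<Longrightarrow> alp d \<in> DD \<and> alp (alp d) = d \<and> alp d \<noteq> d \<and> (alp d \<in> H \<longleftrightarrow> d \<notin> H)"
proof (erule dart_cases)
  assume d: "d \<in> I"
  then have "mt d \<in> H" "mt d \<in> B" using mt_H mt_B by auto
  then show ?thesis using d alp_I[OF d] alp_mt[OF d] by (auto simp: DD_def)
next
  fix i assume i: "i \<in> I" "d = mt i"
  then have "mt i \<in> H" using mt_H by auto
  then show ?thesis using i alp_I[OF i(1)] alp_mt[OF i(1)] by (auto simp: DD_def)
next
  assume d: "d \<in> U"
  then have "d + N \<in> RF" by (simp add: RF_def)
  then have "d + N \<notin> H" "d + N \<in> DD" using RF_notB HB by (auto simp: DD_def)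
  then show ?thesis using d alp_U[OF d] alp_R[OF d] U_H by metis
next
  fix u assume u: "u \<in> U" "d = u + N"
  then have "d \<in> RF" by (simp add: RF_def)
  then have "d \<notin> H" using RF_notB HB by blast
  moreover have "u \<in> DD" using U_B[OF u(1)] by (simp add: DD_def)
  ultimately show ?thesis using u alp_U[OF u(1)] alp_R[OF u(1)] U_H[OF u(1)] by metis
qed

lemma pf_B: "b \<in> B \<Longrightarrow> pf b = ph b" and pf_R: "u \<in> U \<Longrightarrow> pf (u + N) = rho u + N"
  using RF_notB by (auto simp: pf_def RF_def)

lemma pf_RF: "r \<in> RF \<Longrightarrow> pf r \<in> RF"
  unfolding RF_def by (erule imageE) (simp add: pf_R)

lemma finD: "finite DD"
  using finB finU by (simp add: DD_def RF_def)

lemma bij_alp: "bij_betw alp DD DD"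
  by (rule bij_betw_involution) (use alp in blast)

lemma bij_pf: "bij_betw pf DD DD"
proof -
  have 1: "bij_betw pf B B" using bij_ph bij_betw_cong[of B pf ph] pf_B by blast
  have "inj_on pf RF"
  proof (rule inj_onI)
    fix x y assume xy: "x \<in> RF" "y \<in> RF" "pf x = pf y"
    then obtain u v where uv: "u \<in> U" "x = u + N" "v \<in> U" "y = v + N" unfolding RF_def by blast
    then have "rho u = rho v" using xy pf_R by simp
    then show "x = y" using rho(1) uv unfolding bij_betw_def by (metis inj_onD)
  qed
  moreover have "finite RF" using finU by (simp add: RF_def)
  moreover have "pf ` RF \<subseteq> RF" using pf_RF by blast
  ultimately have 2: "bij_betw pf RF RF" using endo_inj_surj by (simp add: bij_betw_def)
  have "B \<inter> RF = {}" using RF_notB by blast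
  from bij_betw_combine[OF 1 2 this] show ?thesis by (simp add: DD_def)
qed

lemma bij_sgm: "bij_betw sgm DD DD"
  unfolding sgm_def by (rule bij_betw_trans[OF bij_alp bij_pf])

lemma sgm_alp: "d \<in> DD \<Longrightarrow> sgm (alp d) = pf d"
  using alp by (simp add: sgm_def)

lemma sgm_I: "i \<in> I \<Longrightarrow> sgm i = s i"
  using mt_B by (simp add: sgm_def alp_I pf_B s_def)

lemma sgm_mt: "i \<in> I \<Longrightarrow> sgm (mt i) = ph i"
  by (simp add: sgm_def alp_mt pf_B)

lemma sgm_U: "u \<in> U \<Longrightarrow> sgm u = rho u + N"
  by (simp add: sgm_def alp_U pf_R)

lemma sgm_R: "u \<in> U \<Longrightarrow> sgm (u + N) = ph u"
  by (simp add: sgm_def alp_R pf_B U_B)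

lemma sgm_chain:
  assumes "\<And>j. j < k \<Longrightarrow> (s ^^ j) x \<in> I" "j \<le> k"
  shows "(sgm ^^ j) x = (s ^^ j) x"
  using assms(2)
proof (induction j)
  case (Suc j)
  then show ?case using assms(1)[of j] sgm_I by simp
qed simp

lemma next_mt:
  assumes i: "i \<in> I"
  shows "\<exists>k. (sgm ^^ Suc k) (mt i) = om (mt i) \<and>
    (\<forall>j<k. (sgm ^^ Suc j) (mt i) \<in> I \<and> m ((sgm ^^ Suc j) (mt i)) < m i)"
proof -
  obtain k where k: "(s ^^ k) (ph i) = om (mt i)" "\<And>j. j < k \<Longrightarrow> (s ^^ j) (ph i) \<in> I"
    "\<And>j. j < k \<Longrightarrow> m ((s ^^ j) (ph i)) < m i" using chain'[OF i] by blast
  have e: "(sgm ^^ Suc j) (mt i) = (s ^^ j) (ph i)" if "j \<le> k" for j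
    using sgm_chain[OF k(2) that] sgm_mt[OF i] by (simp only: funpow_Suc_right comp_apply)
  show ?thesis
  proof (intro exI[of _ k] conjI allI impI)
    show "(sgm ^^ Suc k) (mt i) = om (mt i)" using e[of k] k(1) by simp
    fix j assume j: "j < k"
    then have "(sgm ^^ Suc j) (mt i) = (s ^^ j) (ph i)" using e[of j] by simp
    then show "(sgm ^^ Suc j) (mt i) \<in> I" "m ((sgm ^^ Suc j) (mt i)) < m i"
      using k(2,3)[OF j] by (simp_all only:)
  qed
qed

text \<open>One step longer than in \<open>next_mt\<close>, because the new tail is passed before
  the chain of buds.\<close>

lemma next_U:
  assumes u: "u \<in> U"
  shows "\<exists>k. (sgm ^^ Suc (Suc k)) u = om u \<and> (\<forall>j<k. (sgm ^^ Suc (Suc j)) u \<in> I)"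
proof -
  obtain k where k: "(s ^^ k) (ph (rho u)) = om u" "\<And>j. j < k \<Longrightarrow> (s ^^ j) (ph (rho u)) \<in> I"
    using rho(2)[OF u] by blast
  have e: "(sgm ^^ Suc (Suc j)) u = (s ^^ j) (ph (rho u))" if "j \<le> k" for j
    using sgm_chain[OF k(2) that] sgm_U[OF u] sgm_R[of "rho u"] u by (simp only: funpow_Suc_right comp_apply rho_U)
  show ?thesis
  proof (intro exI[of _ k] conjI allI impI)
    show "(sgm ^^ Suc (Suc k)) u = om u" using e[of k] k(1) by simp
    fix j assume j: "j < k"
    then have "(sgm ^^ Suc (Suc j)) u = (s ^^ j) (ph (rho u))" using e[of j] by simp
    then show "(sgm ^^ Suc (Suc j)) u \<in> I" using k(2)[OF j] by (simp only:)
  qed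
qed

text \<open>Between a head and its \<open>om\<close>-successor the rotation meets only tails; hence
  the white vertices of the mobile reappear when tails are skipped.\<close>

lemma next_head:
  assumes h: "h \<in> H" shows "next_in (\<lambda>d. d \<in> H) sgm h = om h"
proof (cases "h \<in> U")
  case True
  obtain k where k: "(sgm ^^ Suc (Suc k)) h = om h" "\<And>j. j < k \<Longrightarrow> (sgm ^^ Suc (Suc j)) h \<in> I"
    using next_U[OF True] by blast
  have n: "(sgm ^^ j) h \<notin> H" if j: "0 < j" "j < Suc (Suc k)" for j
  proof (cases "j = 1")
    case True
    have "rho h + N \<in> RF" using \<open>h \<in> U\<close> by (simp add: RF_def)
    then show ?thesis using True sgm_U[OF \<open>h \<in> U\<close>] RF_notB HB by auto
  next
    case False
    then obtain i where "j = Suc (Suc i)" using j by (metis One_nat_def gr0_conv_Suc not0_implies_Suc)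
    then show ?thesis using k(2)[of i] j by blast
  qed
  have "(sgm ^^ Suc (Suc k)) h \<in> H" unfolding k(1) by (rule om_H[OF h])
  then have "next_in (\<lambda>d. d \<in> H) sgm h = (sgm ^^ Suc (Suc k)) h"
    by (rule next_in_eqI[of "Suc (Suc k)" "\<lambda>d. d \<in> H" sgm h, OF zero_less_Suc _ n])
  then show ?thesis using k(1) by (rule trans)
next
  case False
  then obtain i where i: "i \<in> I" "h = mt i" using h by (auto simp: U_def)
  obtain k where k: "(sgm ^^ Suc k) h = om h" "\<And>j. j < k \<Longrightarrow> (sgm ^^ Suc j) h \<in> I"
    using next_mt[OF i(1), folded i(2)] by metis
  have n: "(sgm ^^ j) h \<notin> H" if j: "0 < j" "j < Suc k" for j
  proof -
    obtain i where "j = Suc i" using j by (metis gr0_conv_Suc)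
    then show ?thesis using k(2)[of i] j by blast
  qed
  have "(sgm ^^ Suc k) h \<in> H" unfolding k(1) by (rule om_H[OF h])
  then have "next_in (\<lambda>d. d \<in> H) sgm h = (sgm ^^ Suc k) h"
    by (rule next_in_eqI[of "Suc k" "\<lambda>d. d \<in> H" sgm h, OF zero_less_Suc _ n])
  then show ?thesis using k(1) by (rule trans)
qed

text \<open>Both rotations of the mobile are realized by steps of the map, so connectedness of the
  mobile carries over to \<open>B\<close>; each new tail is joined to it by its edge.\<close>

lemma connected: "connected_darts DD alp sgm"
proof -
  let ?S = "gr alp DD \<union> gr sgm DD"
  have a: "(d, alp d) \<in> eqv ?S" if "d \<in> DD" for d using that by (intro eqv_base) auto
  have p: "(d, pf d) \<in> eqv ?S" if d: "d \<in> DD" for d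
  proof -
    have "(alp d, sgm (alp d)) \<in> eqv ?S" using alp[OF d] by (intro eqv_base) auto
    then show ?thesis using eqv_trans[OF a[OF d]] sgm_alp[OF d] by simp
  qed
  have BD: "b \<in> DD" if "b \<in> B" for b using that by (simp add: DD_def)
  have b: "(b, bl b) \<in> eqv ?S" if "b \<in> B" for b
    using eqv_sym[OF p[OF BD[of "bl b"]]] that by (simp add: pf_B)
  have o: "(h, om h) \<in> eqv ?S" if h: "h \<in> H" for h
  proof -
    have hD: "h \<in> DD" using h HB BD by blast
    have "\<exists>k. (sgm ^^ k) h = om h"
      using next_head[OF h] unfolding next_in_def by metis
    then obtain k where k: "(sgm ^^ k) h = om h" by blast
    have "(h, (sgm ^^ k) h) \<in> eqv (gr sgm DD)" by (rule funpow_eqv[OF bij_sgm hD])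
    then show ?thesis using eqv_mono[of "gr sgm DD" ?S] k by auto
  qed
  have "eqv (gr om H \<union> gr bl B) \<subseteq> eqv ?S"
    by (rule eqv_least) (use b o in \<open>auto simp: gr_def\<close>)
  then have BB: "(x, y) \<in> eqv ?S" if "x \<in> B" "y \<in> B" for x y
    using amob that unfolding amob_def by blast
  have "\<exists>b\<in>B. (d, b) \<in> eqv ?S" if dD: "d \<in> DD" for d
  proof (cases "d \<in> B")
    case True
    have "(d, d) \<in> eqv ?S" by (rule eqv_refl)
    then show ?thesis using True by blast
  next
    case False
    then obtain u where "u \<in> U" "d = u + N" using dD by (auto simp: DD_def RF_def)
    then show ?thesis using a[OF dD] alp_R U_B by metis
  qed
  then have "(x, y) \<in> eqv ?S" if xy: "x \<in> DD" "y \<in> DD" for x y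
  proof -
    obtain b c where b: "b \<in> B" "(x, b) \<in> eqv ?S" and c: "c \<in> B" "(y, c) \<in> eqv ?S"
      using \<open>\<And>d. d \<in> DD \<Longrightarrow> \<exists>b\<in>B. (d, b) \<in> eqv ?S\<close> xy by metis
    show ?thesis by (rule eqv_trans[OF eqv_trans[OF b(2) BB[OF b(1) c(1)]] eqv_sym[OF c(2)]])
  qed
  then show ?thesis unfolding connected_darts_iff[OF finD bij_alp bij_sgm] by blast
qed

lemma card_DD: "card DD = 2 * card H"
proof -
  have "card RF = card U" unfolding RF_def by (rule card_image) simp
  moreover have "card B = card H + card I"
    using HB finB card_Diff_subset[of H B] card_mono[of B H] finite_subset[of H B] by simp
  moreover have "card DD = card B + card RF"
    unfolding DD_def using finB finU RF_notB by (intro card_Un_disjoint) (auto simp: RF_def)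
  ultimately show ?thesis using card_U(1) by simp
qed

text \<open>Euler's inequality forces the new tails to form a single face and every vertex to have a head.\<close>

lemma counts:
  "card (orb pf ` RF) = 1" "orb sgm ` DD = orb sgm ` H"
  "card (orb sgm ` DD) + card (orb pf ` DD) = card DD div 2 + 2"
proof -
  have BD: "B \<subseteq> DD" and HD: "H \<subseteq> DD" and RD: "RF \<subseteq> DD" using HB by (auto simp: DD_def)
  have ne: "DD \<noteq> {}" using card_U(2) by (auto simp: DD_def RF_def)
  have "card (orb sgm ` DD) + card (orb (sgm \<circ> alp) ` DD) \<le> card {d \<in> DD. alp d \<noteq> d} div 2 + 2"
    by (rule euler_inequality[OF finD ne bij_sgm _ connected]) (use alp in blast)
  moreover have "{d \<in> DD. alp d \<noteq> d} = DD" using alp by blast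
  moreover have "orb pf x = orb (sgm \<circ> alp) x" if "x \<in> DD" for x
    by (rule orb_cong[OF bij_pf _ that]) (simp add: sgm_alp)
  then have "orb (sgm \<circ> alp) ` DD = orb pf ` DD" by auto
  ultimately have le: "card (orb sgm ` DD) + card (orb pf ` DD) \<le> card H + 2"
    using card_DD by simp
  have "orb om h = orb (next_in (\<lambda>d. d \<in> H) sgm) h" if "h \<in> H" for h
    by (rule orb_cong[OF bij_om _ that]) (simp add: next_head)
  then have "orb om ` H = orb (next_in (\<lambda>d. d \<in> H) sgm) ` H" by auto
  then have V: "card (orb om ` H) = card (orb sgm ` H)"
    using card_orb_next_in[OF finD bij_sgm HD] by simp
  have V': "card (orb sgm ` H) \<le> card (orb sgm ` DD)" "orb sgm ` H \<subseteq> orb sgm ` DD"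
    using HD finD by (auto intro!: card_mono)
  have ob: "orb bl b = orb pf b" if "b \<in> B" for b
  proof -
    have "orb bl b = orb ph b" by (rule orb_inverse[OF finB bij_ph _ that]) simp
    also have "\<dots> = orb pf b" by (rule orb_cong[OF bij_ph _ that]) (simp add: pf_B)
    finally show ?thesis .
  qed
  have "orb pf ` DD = orb bl ` B \<union> orb pf ` RF" unfolding DD_def using ob by (auto simp: image_Un)
  moreover have "orb bl ` B \<inter> orb pf ` RF = {}"
  proof -
    have False if x: "b \<in> B" "r \<in> RF" "orb bl b = orb pf r" for b r
    proof -
      have "orb pf r \<subseteq> RF" by (rule orb_subset[OF x(2) pf_RF])
      moreover have "b \<in> orb pf r" using x(3) orb_self by metis
      ultimately show False using RF_notB x(1) by blast
    qed
    then show ?thesis by blast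
  qed
  moreover have fR: "finite (orb pf ` RF)" using finU by (simp add: RF_def)
  ultimately have F: "card (orb pf ` DD) = card (orb bl ` B) + card (orb pf ` RF)"
    using finB by (simp add: card_Un_disjoint)
  have R: "card (orb pf ` RF) \<ge> 1"
    using fR card_U(2) card_gt_0_iff[of "orb pf ` RF"] by (simp add: RF_def)
  have t: "card (orb om ` H) + card (orb bl ` B) = card H + 1" using amob by (simp add: amob_def)
  \<comment> \<open>The tree equation together with the lower bounds on vertices and faces already
    gives \<open>card H + 2\<close>, the maximum allowed by \<open>le\<close>; every bound is
    therefore attained.\<close>
  show "card (orb pf ` RF) = 1" using le F R t V V'(1) by linarith
  have "card (orb sgm ` DD) = card (orb sgm ` H)" using le F R t V V'(1) by linarith
  then show "orb sgm ` DD = orb sgm ` H" using card_subset_eq[OF _ V'(2)] finD by simp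
  show "card (orb sgm ` DD) + card (orb pf ` DD) = card DD div 2 + 2"
    using le F R t V V'(1) card_DD by linarith
qed

section \<open>The reconstructed map is clockwise-minimal and accessible\<close>

definition M :: "nat fro" where
  "M = \<lparr>darts = DD, alpha = alp, sigma = sgm, head = (\<lambda>d. d \<in> H), root = (SOME u. u \<in> U) + N\<rparr>"

lemma M_sel [simp]: "darts M = DD" "alpha M = alp" "sigma M = sgm" "head M = (\<lambda>d. d \<in> H)"
  by (simp_all add: M_def)

lemma root_RF: "root M \<in> RF"
  using someI_ex[of "\<lambda>u. u \<in> U"] card_U(2) by (auto simp: M_def RF_def)

lemma phi_M: "d \<in> DD \<Longrightarrow> phi M d = pf d"
  by (simp add: phi_def sgm_alp)

lemma face_M: "d \<in> DD \<Longrightarrow> face M d = orb pf d"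
  unfolding face_def by (rule orb_cong[OF bij_pf, symmetric]) (simp_all add: phi_M)

lemma is_fro_M: "is_fro M"
proof -
  have "face M ` DD = orb pf ` DD" using face_M by auto
  moreover have "vert M ` DD = orb sgm ` DD" by (auto simp: vert_def)
  moreover have "DD \<noteq> {}" using root_RF by (auto simp: DD_def)
  moreover have "root M \<in> DD" using root_RF by (simp add: DD_def)
  ultimately show ?thesis
    unfolding is_fro_def using finD alp bij_sgm connected counts(3) by simp
qed

lemma root_face_M: "root_face M = RF"
proof -
  have D: "RF \<subseteq> DD" by (simp add: DD_def)
  have "root_face M = orb pf (root M)"
    unfolding root_face_def using face_M root_RF D by blast
  moreover have "orb pf (root M) \<subseteq> RF" by (rule orb_subset[OF root_RF pf_RF])
  moreover have "r \<in> orb pf (root M)" if "r \<in> RF" for r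
  proof -
    obtain X where "orb pf ` RF = {X}" using counts(1) by (auto simp: card_1_singleton_iff)
    then have "orb pf r = orb pf (root M)" using that root_RF by blast
    then show ?thesis using orb_self by metis
  qed
  ultimately show ?thesis by blast
qed

interpretation F: fro M by (unfold_locales) (rule is_fro_M)

text \<open>Accessibility of the vertex and dual accessibility of the corner are treated together
  because both propagate along the same walks through tails, by \<open>pf\<close> and by
  \<open>sgm\<close>.\<close>

definition good :: "nat \<Rightarrow> bool" where
  "good d \<longleftrightarrow> (\<exists>r\<in>RF. (vert M r, vert M d) \<in> (dstep M)\<^sup>*) \<and> (root M, d) \<in> (dual_step M)\<^sup>*"

lemma good_RF: "r \<in> RF \<Longrightarrow> good r"
proof -
  assume r: "r \<in> RF"
  have "r \<in> orb (phi M) (root M)" using r root_face_M by (simp add: root_face_def face_def)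
  moreover have "orb (phi M) (root M) \<subseteq> {d \<in> DD. (root M, d) \<in> (dual_step M)\<^sup>*}"
    by (rule orb_subset) (use F.rt F.ph_closed in \<open>auto simp: dual_step_def intro: rtrancl_into_rtrancl\<close>)
  ultimately show "good r" using r by (auto simp: good_def)
qed

lemma good_alp: "good t \<Longrightarrow> t \<in> DD \<Longrightarrow> t \<notin> H \<Longrightarrow> good (alp t)"
  unfolding good_def by (auto simp: dual_step_def dstep_def intro: rtrancl_into_rtrancl)

lemma good_pf: "good t \<Longrightarrow> t \<in> DD \<Longrightarrow> t \<notin> H \<Longrightarrow> good (pf t)"
proof -
  assume t: "good t" "t \<in> DD" "t \<notin> H"
  have "(root M, pf t) \<in> (dual_step M)\<^sup>*"
    using t phi_M[OF t(2)] unfolding good_def by (auto simp: dual_step_def intro: rtrancl_into_rtrancl)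
  moreover have "vert M (pf t) = vert M (alp t)"
    using F.vert_sg[of "alp t"] sgm_alp[OF t(2)] alp[OF t(2)] by simp
  ultimately show "good (pf t)" using good_alp[OF t] by (simp add: good_def)
qed

text \<open>Crossing the edge of \<open>t\<close> from left to right leads into the face of the
  corner \<open>sgm t\<close>, and the vertex stays the same.\<close>

lemma good_sgm: "good t \<Longrightarrow> t \<in> DD \<Longrightarrow> t \<notin> H \<Longrightarrow> good (sgm t)"
proof -
  assume t: "good t" "t \<in> DD" "t \<notin> H"
  have "(alp t, pf (alp t)) \<in> dual_step M"
    using alp[OF t(2)] phi_M[of "alp t"] by (auto simp: dual_step_def)
  moreover have "pf (alp t) = sgm t" by (simp add: sgm_def)
  ultimately have "(root M, sgm t) \<in> (dual_step M)\<^sup>*"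
    using good_alp[OF t] by (auto simp: good_def intro: rtrancl_into_rtrancl)
  moreover have "vert M (sgm t) = vert M t" using F.vert_sg[of t] t by simp
  ultimately show "good (sgm t)" using t by (simp add: good_def)
qed

text \<open>A bud is reached by rotating from the last head before it, whose partner has a longer block.\<close>

lemma good_I: "t \<in> I \<Longrightarrow> good t"
proof (induction "Max (insert 0 (m ` I)) - m t" arbitrary: t rule: less_induct)
  case less
  have tD: "t \<in> DD" "t \<notin> H" using less.prems by (auto simp: DD_def)
  have HD: "H \<subseteq> DD" using HB by (auto simp: DD_def)
  \<comment> \<open>By \<open>counts\<close> every vertex has a head. The head chosen is the one
    from which the fewest rotation steps lead to \<open>t\<close>, so only tails lie between
    them.\<close>
  have "orb sgm t \<in> orb sgm ` H" using counts(2) tD by blast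
  then obtain h0 where "h0 \<in> H" "orb sgm t = orb sgm h0" by blast
  then have "\<exists>n. \<exists>h\<in>H. (sgm ^^ n) h = t" using orb_self[of t sgm] by (auto simp: orb_def)
  then obtain n h where h: "h \<in> H" "(sgm ^^ n) h = t"
    and least: "\<And>n'. n' < n \<Longrightarrow> \<forall>h\<in>H. (sgm ^^ n') h \<noteq> t"
    using exists_least_iff[of "\<lambda>n. \<exists>h\<in>H. (sgm ^^ n) h = t"] by blast
  have "n \<noteq> 0"
  proof
    assume "n = 0"
    then have "t = h" using h(2) by simp
    then show False using h(1) tD(2) by simp
  qed
  then obtain p where p: "n = Suc p" by (cases n) auto
  have noH: "(sgm ^^ j) h \<notin> H" if j: "0 < j" "j \<le> n" for j
  proof
    assume "(sgm ^^ j) h \<in> H"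
    moreover have "(sgm ^^ (n - j)) ((sgm ^^ j) h) = t"
      using h(2) j by (simp flip: funpow_add[THEN fun_cong, unfolded comp_def])
    moreover have "n - j < n" using j by linarith
    ultimately show False using least by blast
  qed
  have "good (sgm h)"
  proof (cases "h \<in> U")
    case True
    then have "rho h + N \<in> RF" by (simp add: RF_def)
    then show ?thesis using good_RF sgm_U[OF True] by simp
  next
    case False
    then obtain i where i: "i \<in> I" "h = mt i" using h by (auto simp: U_def)
    obtain k where k: "(sgm ^^ Suc k) h = om h" "\<And>j. j < k \<Longrightarrow> m ((sgm ^^ Suc j) h) < m i"
      using next_mt[OF i(1), folded i(2)] by metis
    have "(sgm ^^ Suc k) h \<in> H" unfolding k(1) by (rule om_H[OF h(1)])
    \<comment> \<open>As \<open>t\<close> comes before the next head, it lies on the chain of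
      \<open>i\<close> and has smaller rank, so the induction hypothesis applies to
      \<open>i\<close>.\<close>
    then have "p < k" using noH[of "Suc k"] p by (meson not_le Suc_le_mono zero_less_Suc)
    then have mt: "m t < m i" using k(2)[of p] h(2) p by simp
    moreover have "m i \<le> Max (insert 0 (m ` I))" using i(1) finB by (intro Max_ge) auto
    ultimately have "good i" using less.hyps[of i] i(1) by linarith
    then show ?thesis using good_pf[of i] i sgm_mt[OF i(1)] pf_B by (auto simp: DD_def)
  qed
  moreover have D: "(sgm ^^ j) (sgm h) \<in> DD" for j
    using funpow_closed[OF bij_sgm] bij_betwE[OF bij_sgm] h(1) HD by blast
  ultimately have "good ((sgm ^^ j) (sgm h))" if "j \<le> p" for j
    using that
  proof (induction j)
    case (Suc j)
    have "(sgm ^^ j) (sgm h) = (sgm ^^ Suc j) h" by (simp only: funpow_Suc_right comp_apply)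
    then have "(sgm ^^ j) (sgm h) \<notin> H" using noH[of "Suc j"] Suc.prems p by simp
    then show ?case using good_sgm[OF _ D] Suc by simp
  qed simp
  from this[of p] show ?case using h(2) p by (simp only: funpow_Suc_right comp_apply)
qed

lemma good: "d \<in> DD \<Longrightarrow> good d"
proof -
  assume d: "d \<in> DD"
  have tail: "good t" if "t \<in> DD" "t \<notin> H" for t
    using that good_I good_RF by (auto simp: DD_def)
  show "good d"
  proof (cases "d \<in> H")
    case True
    then have "good (alp d)" "alp d \<in> DD" "alp d \<notin> H" using alp[OF d] tail by auto
    then show ?thesis using good_alp[of "alp d"] alp[OF d] by simp
  qed (use tail d in blast)
qed

lemma cw_fro_M: "cw_fro M"
proof unfold_locales
  show "accessible M" using good by (auto simp: accessible_def root_face_M good_def)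
  show "dual_accessible M" using good by (auto simp: dual_accessible_def good_def)
  show "\<not> head M h" if "h \<in> root_face M" for h
    using that RF_notB HB by (auto simp: root_face_M)
qed

lemma M_black: "darts M - root_face M = B"
  using RF_notB by (auto simp: root_face_M DD_def)

lemma M_heads: "{d \<in> darts M. head M d} = H"
  using HB by (auto simp: DD_def)

lemma M_white_rotation:
  "h \<in> H \<Longrightarrow> next_in (\<lambda>d. d \<in> {d \<in> darts M. head M d}) (sigma M) h = om h"
  unfolding M_heads using next_head by simp

lemma M_black_rotation: "b \<in> B \<Longrightarrow> phi_inv M b = bl b"
proof -
  assume b: "b \<in> B"
  have D: "bl b \<in> DD" using b by (simp add: DD_def)
  have "phi_inv M (phi M (bl b)) = bl b" using F.bl(3)[of "bl b"] D by simp
  then show ?thesis using phi_M[OF D] pf_B[of "bl b"] b by simp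
qed

lemma M_outer: "alpha M ` root_face M = H - mt ` I"
  unfolding root_face_M U_def[symmetric] RF_def using alp_R by (auto simp: image_image)

end

section \<open>Admissible orientations\<close>

lemma rep_cong:
  assumes "rep T B H om bl e" "\<And>h. h \<in> H \<Longrightarrow> om h = om' h"
  shows "rep T B H om' bl e"
  using assms unfolding rep_def by (metis (no_types, lifting))

context cw_fro
begin

abbreviation "A \<equiv> al ` R"

lemma A_iff: "d \<in> D \<Longrightarrow> d \<in> A \<longleftrightarrow> al d \<in> R"
proof
  assume "d \<in> D" "al d \<in> R"
  then show "d \<in> A" using al(2) by (metis imageI)
qed auto

lemma A_H: "a \<in> A \<Longrightarrow> a \<in> H"
  using tails_R by auto

lemma first_vert: "x \<in> D \<Longrightarrow> first x \<in> vert M x \<and> first x \<in> H"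
proof -
  assume x: "x \<in> D"
  show ?thesis
  proof (cases "head M x")
    case False
    obtain h where h: "h \<in> vert M x" "head M h" using vert_has_head[OF x] by blast
    then obtain n where n: "h = (sg ^^ n) x" by (auto simp: vert_def orb_def)
    show ?thesis
    proof (rule next_in_spec[of n "\<lambda>d. d \<in> H" sg x])
      show "n > 0" using n h False by (cases n) auto
      show "(sg ^^ n) x \<in> H" using n h vert_closed[OF x] by blast
      show ?thesis if "nh x = (sg ^^ m) x" "(sg ^^ m) x \<in> H" for m
        using that False by (simp add: first_def vert_def)
    qed
  qed (use x in \<open>simp add: first_def\<close>)
qed

lemma outer_head:
  assumes x: "x \<in> R"
  obtains a where "a \<in> A" "sg a = x" "vert M a = vert M x"
proof
  have b: "bl x \<in> R" using x R_ph[of "bl x"] by simp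
  then show "al (bl x) \<in> A" by blast
  show "sg (al (bl x)) = x" using x by (simp add: sg_al)
  then show "vert M (al (bl x)) = vert M x" using vert_sg[of "al (bl x)"] x by simp
qed

lemma leaf_vert:
  assumes a: "a \<in> H" "nh a = a"
  shows "vert M a \<inter> H = {a}"
proof -
  have "orb nh a = {a}" using orb_subset[of a "{a}" nh] a(2) orb_self[of a nh] by blast
  then show ?thesis unfolding vert_def using orb_next_in[OF fin bij_sg _ a(1)] by blast
qed

text \<open>If outer heads are white leaves, each outer vertex has a single head, and the contour
  dart that follows this head is determined by it. So the contour visits no vertex twice.\<close>

lemma admissibleI:
  assumes leaf: "\<And>a. a \<in> A \<Longrightarrow> nh a = a" shows "admissible M"
  unfolding admissible_def
proof (intro conjI ballI impI)
  fix x assume x: "x \<in> R"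
  obtain a where a: "a \<in> A" "sg a = x" "vert M a = vert M x" by (rule outer_head[OF x])
  have va: "vert M x \<inter> H = {a}" using leaf_vert[OF A_H[OF a(1)] leaf[OF a(1)]] a(3) by simp
  show "al x \<notin> R" using x tails_R[OF x] head_notin_R[of "al x"] by simp
  have "{h \<in> D. head M h \<and> vert M h = vert M x} = {a}"
  proof -
    have "{h \<in> D. head M h \<and> vert M h = vert M x} = vert M x \<inter> H"
      using vert_eq_iff[of x] x by auto
    then show ?thesis using va by simp
  qed
  then show "indegree M (vert M x) = 1" by (simp add: indegree_def)
  fix y assume y: "y \<in> R" "x \<noteq> y"
  show "vert M x \<noteq> vert M y"
  proof
    assume e: "vert M x = vert M y"
    obtain b where b: "b \<in> A" "sg b = y" "vert M b = vert M y" by (rule outer_head[OF y(1)])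
    have "b \<in> vert M x \<inter> H" using b A_H[OF b(1)] e vert_self[of b] by simp
    then show False using va a(2) b(2) y(2) by simp
  qed
qed

end

locale adm_fro = cw_fro +
  assumes adm: "admissible M"
begin

lemma outer_unique:
  assumes "h \<in> H" "x \<in> R" "vert M h = vert M x"
  shows "h \<in> A" "sg h = x"
proof -
  obtain a where a: "a \<in> A" "sg a = x" "vert M a = vert M x" by (rule outer_head[OF assms(2)])
  have "card {h \<in> D. head M h \<and> vert M h = vert M x} = 1"
    using adm assms(2) unfolding admissible_def indegree_def by blast
  then obtain z where z: "{h \<in> D. head M h \<and> vert M h = vert M x} = {z}" by (auto simp: card_1_singleton_iff)
  moreover have "a \<in> {h \<in> D. head M h \<and> vert M h = vert M x}" using A_H[OF a(1)] a(3) by simp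
  moreover have "h \<in> {h \<in> D. head M h \<and> vert M h = vert M x}" using assms by simp
  ultimately have "h = a" by auto
  then show "h \<in> A" "sg h = x" using a by auto
qed

lemma outer_vert_iff: "h \<in> H \<Longrightarrow> vert M h \<in> vert M ` R \<longleftrightarrow> h \<in> A"
proof
  assume "h \<in> H" "h \<in> A"
  then obtain r where r: "r \<in> R" "h = al r" by blast
  then have "sg h \<in> R" "vert M (sg h) = vert M h" using vert_sg[of h] by (simp_all add: sg_al)
  then show "vert M h \<in> vert M ` R" by (metis imageI)
qed (use outer_unique(1) in blast)

lemma leaf: "a \<in> A \<Longrightarrow> nh a = a"
proof -
  assume a: "a \<in> A"
  then obtain x where x: "x \<in> R" "vert M a = vert M x" using outer_vert_iff A_H by blast
  have n: "nh a \<in> H" using bij_betwE[OF bij_nh] A_H[OF a] by blast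
  have "nh a \<in> orb nh a" by (rule orb_step[OF orb_self])
  then have "nh a \<in> vert M a"
    unfolding vert_def using orb_next_in[OF fin bij_sg, of H a] A_H[OF a] by blast
  then have "vert M (nh a) = vert M x" using vert_eq_iff[of a "nh a"] A_H[OF a] x(2) by simp
  then have "sg (nh a) = sg a" using outer_unique(2)[OF n x(1)] outer_unique(2)[OF A_H[OF a] x] by simp
  then show "nh a = a" using sg_inj n A_H[OF a] by blast
qed

text \<open>After reversal the outer edges have their heads on the root-face and at outer vertices,
  so both halves of the edges created from them are deleted. The former outer heads \<open>A\<close>
  are now tails, hence buds, and the rotations around inner vertices are unaffected.\<close>

lemma Phi_minus_rep: "represented (Phi_minus M) (D - R) (H - A) nh bl (\<lambda>d. (d, False))"
proof -
  let ?hdd = "\<lambda>d. if d \<in> R \<or> al d \<in> R then \<not> head M d else head M d"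
  let ?V = "vert M ` R"
  let ?H' = "{d \<in> D. ?hdd d \<and> vert M d \<notin> ?V}"
  have 1: "vert M d \<notin> ?V" if d: "d \<in> D - R" "?hdd d" for d
  proof (cases "al d \<in> R")
    case True
    then have "head M d" using tails_R[OF True] d by simp
    then show ?thesis using d True by simp
  next
    case False
    then have "d \<in> H" "d \<notin> A" using d A_iff[of d] by simp_all
    then show ?thesis by (simp only: outer_vert_iff not_False_eq_True)
  qed
  have 2: "d \<notin> R" if "vert M d \<notin> ?V" for d using imageI[of d R "vert M"] that by metis
  have H': "?H' = H - A"
  proof (intro set_eqI iffI)
    fix d assume d: "d \<in> ?H'"
    then have "d \<in> D" "d \<notin> R" "?hdd d" using 2[of d] by blast+
    moreover have "al d \<notin> R"
    proof
      assume r: "al d \<in> R"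
      then have "head M d" using tails_R[OF r] \<open>d \<in> D\<close> by simp
      then show False using \<open>?hdd d\<close> r by simp
    qed
    ultimately show "d \<in> H - A" using A_iff[of d] by simp
  next
    fix d assume d: "d \<in> H - A"
    then have "d \<in> D" "head M d" "al d \<notin> R" "d \<notin> R" using A_iff[of d] head_notin_R by auto
    then show "d \<in> ?H'" using outer_vert_iff[of d] d by simp
  qed
  have r: "represented (Phi_minus M) (D - R) ?H' (next_in (\<lambda>d. d \<in> ?H') sg) bl (\<lambda>d. (d, False))"
    unfolding Phi_minus_def by (rule local_transform_rep) (use 1 2 in blast)+
  have "next_in (\<lambda>d. d \<in> H - A) sg h = nh h" if h: "h \<in> H - A" for h
  proof (rule next_in_cong)
    fix k
    have "vert M ((sg ^^ k) h) = vert M h" using vert_funpow h by blast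
    then have "(sg ^^ k) h \<in> H \<Longrightarrow> (sg ^^ k) h \<notin> A"
      using outer_vert_iff[of h] outer_vert_iff[of "(sg ^^ k) h"] h by simp
    then show "(sg ^^ k) h \<in> H - A \<longleftrightarrow> (sg ^^ k) h \<in> H" by blast
  qed simp
  then have "rep (Phi_minus M) (D - R) (H - A) nh bl (\<lambda>d. (d, False))"
    using rep_cong[OF represented.rep[OF r[unfolded H']]] by blast
  with represented.pre[OF r] show ?thesis by (rule represented.intro)
qed

lemma H_A: "A \<subseteq> H" "H \<subseteq> D - R"
  using A_H H_notin_R by blast+

text \<open>Turning as many leaf edges into buds as the outer degree lowers the excess of
  \<open>Phi_plus\<close> by twice that degree, which negates it.\<close>

lemma Phi_minus_mobile:
  "is_pb_mobile (Phi_minus M)" "excess (Phi_minus M) = - int (outer_degree M)"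
proof -
  interpret T: represented "Phi_minus M" "D - R" "H - A" nh bl "\<lambda>d. (d, False)" by (rule Phi_minus_rep)
  have f: "finite (D - R)" "finite R" using fin R_sub finite_subset by auto
  have "amob (D - R) (H - A) nh bl"
    using amob_remove_leaves[OF H_A(1) leaf H_A(2) f(1)] amob_plus by simp
  then show "is_pb_mobile (Phi_minus M)" using T.is_pb_mobile_iff_amob by simp
  have fH: "finite H" "finite A" using f fin by auto
  have "inj_on al R" using bij_al R_sub unfolding bij_betw_def by (blast intro: inj_on_subset)
  then have cA: "card A = outer_degree M" unfolding outer_degree_def by (rule card_image)
  have "card H = card (H - A) + card A"
    using card_Diff_subset[OF fH(2) H_A(1)] card_mono[OF fH(1) H_A(1)] by simp
  moreover have "D - R - (H - A) = (D - R - H) \<union> A" using H_A by blast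
  moreover have "card ((D - R - H) \<union> A) = card (D - R - H) + card A"
    using f fH H_A by (intro card_Un_disjoint) auto
  ultimately show "excess (Phi_minus M) = - int (outer_degree M)"
    using T.excess_eq excess_plus cA by simp
qed

text \<open>The involution pairs the two darts of each inner edge. The equality is used to turn an
  inclusion between sets of matched buds into an equality.\<close>

lemma inner_card: "card (D - R - H) = card (H - A)"
proof -
  have "bij_betw al (D - R - H) (H - A)"
  proof (rule bij_betw_byWitness[where f' = al])
    show "al ` (D - R - H) \<subseteq> H - A"
    proof (rule image_subsetI)
      fix x assume x: "x \<in> D - R - H"
      have "al x \<notin> A" unfolding A_iff[OF al(1)[OF DiffD1[OF DiffD1[OF x]]]] using x by simp
      moreover have "al x \<in> H" using x by simp
      ultimately show "al x \<in> H - A" by (rule DiffI[rotated])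
    qed
    show "al ` (H - A) \<subseteq> D - R - H"
    proof (rule image_subsetI)
      fix x assume x: "x \<in> H - A"
      then have "x \<in> D" by blast
      then have "al x \<notin> R" using A_iff x by blast
      then show "al x \<in> D - R - H" using x by simp
    qed
  qed simp_all
  then show ?thesis by (rule bij_betw_same_card)
qed

lemma nh_inner: "h \<in> H - A \<Longrightarrow> nh h \<in> H - A"
proof -
  assume h: "h \<in> H - A"
  have "bij_betw nh A A"
  proof (rule bij_betw_involution)
    fix a assume a: "a \<in> A"
    show "nh a \<in> A \<and> nh (nh a) = a" unfolding leaf[OF a] using a by (intro conjI refl)
  qed
  from bij_betwE[OF bij_betw_DiffI[OF bij_nh this H_A(1) H_A(1)]] h show "nh h \<in> H - A" by (rule bspec)
qed

end

text \<open>By the same induction, matched buds correspond to matched buds; hence so do the unmatched ones,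
  and the removed leaves can be put back.\<close>

lemma fro_iso_of_amob_iso_minus:
  assumes "adm_fro M1" "adm_fro M2"
    and iso: "amob_iso g (darts M1 - root_face M1) ({d \<in> darts M1. head M1 d} - alpha M1 ` root_face M1)
      (next_in (\<lambda>d. d \<in> {d \<in> darts M1. head M1 d}) (sigma M1)) (phi_inv M1)
      (darts M2 - root_face M2) ({d \<in> darts M2. head M2 d} - alpha M2 ` root_face M2)
      (next_in (\<lambda>d. d \<in> {d \<in> darts M2. head M2 d}) (sigma M2)) (phi_inv M2)"
  shows "fro_iso M1 M2"
proof -
  interpret X: adm_fro M1 by (rule assms(1))
  interpret Y: adm_fro M2 by (rule assms(2))
  have g: "bij_betw g (X.D - X.R) (Y.D - Y.R)"
    and gH: "\<And>b. b \<in> X.D - X.R \<Longrightarrow> g b \<in> Y.H - Y.A \<longleftrightarrow> b \<in> X.H - X.A"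
    and gnh: "\<And>h. h \<in> X.H - X.A \<Longrightarrow> g (X.nh h) = Y.nh (g h)"
    and gbl: "\<And>b. b \<in> X.D - X.R \<Longrightarrow> g (X.bl b) = Y.bl (g b)"
    using iso unfolding amob_iso_def by blast+
  have gD: "g b \<in> Y.D - Y.R" if "b \<in> X.D - X.R" for b using bij_betwE[OF g] that by blast
  have inj: "inj_on g (X.D - X.R)" and img: "g ` (X.D - X.R) = Y.D - Y.R"
    using g unfolding bij_betw_def by auto
  have gph: "g (X.ph x) = Y.ph (g x)" if x: "x \<in> X.D" "x \<notin> X.R" for x
  proof -
    have "g x = Y.bl (g (X.ph x))" using gbl[of "X.ph x"] x by simp
    then show ?thesis using Y.bl(2)[of "g (X.ph x)"] gD[of "X.ph x"] x by simp
  qed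
  have nh_inj: "x = y" if "x \<in> Y.H" "y \<in> Y.H" "Y.nh x = Y.nh y" for x y
    using Y.bij_nh that unfolding bij_betw_def inj_on_def by blast
  \<comment> \<open>Inner tails and outer heads are both buds of \<open>Phi_minus\<close>, so that
    \<open>g x\<close> is a tail has to be part of the induction. The head seen is compared only
    where it is inner, since only there does \<open>g\<close> respect \<open>nh\<close>.\<close>
  have tail: "\<not> head M2 (g x) \<and> (X.first x \<in> X.H - X.A \<longrightarrow> Y.first (g x) = g (X.first x))"
    if "x \<in> X.D" "x \<notin> X.R" "\<not> head M1 x" for x
    using X.wf_child that
  proof (induction x rule: wf_induct_rule)
    case (less x)
    note x = less.prems
    have F: "Y.first (g y) = g (X.first y)"
      if y: "y \<in> X.D" "y \<notin> X.R" "y = X.ph x \<or> y = X.sg x" "X.first y \<in> X.H - X.A" for y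
    proof (cases "head M1 y")
      case True
      then have "X.first y = y" by (simp add: X.first_def)
      then have "g y \<in> Y.H - Y.A" using gH[of y] y by simp
      then show ?thesis using \<open>X.first y = y\<close> by (simp add: Y.first_def)
    next
      case False
      then have "(y, x) \<in> X.child" using y x by (auto simp: X.child_def)
      then show ?thesis using less.IH y False by blast
    qed
    have ax: "X.al x \<in> X.H - X.A" "X.al x \<in> X.D" "X.al x \<notin> X.R"
      using X.head_notin_R[of "X.al x"] X.A_iff[of "X.al x"] x by simp_all
    have gx: "g x \<in> Y.D" "g x \<notin> Y.R" "g x \<notin> Y.H - Y.A" using gD[of x] gH[of x] x by auto
    have nx: "X.first (X.ph x) = X.nh (X.al x)" using X.nh_eq[of "X.al x"] ax by (simp add: X.sg_al)
    have "X.first (X.ph x) \<in> X.H - X.A" unfolding nx by (rule X.nh_inner[OF ax(1)])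
    then have 1: "Y.first (Y.ph (g x)) = g (X.nh (X.al x))" using F[of "X.ph x"] gph[of x] x nx by simp
    have inner: "g (X.nh (X.al x)) \<in> Y.H - Y.A"
      using gH[of "X.nh (X.al x)"] X.nh_inner[OF ax(1)] X.H_A(2) by blast
    \<comment> \<open>Otherwise \<open>g x\<close> would be an outer head and
      \<open>ph (g x)\<close> would sit at an outer vertex. The head seen from there would then be
      outer, but it is the image of an inner one.\<close>
    have t: "\<not> head M2 (g x)"
    proof
      assume "head M2 (g x)"
      then have "g x \<in> Y.A" using gx by simp
      then have r: "Y.al (g x) \<in> Y.R" "Y.al (g x) \<in> Y.D" using Y.A_iff[OF gx(1)] by auto
      have "Y.sg (Y.al (g x)) = Y.ph (g x)" by (simp add: Y.sg_al)
      then have "vert M2 (Y.ph (g x)) = vert M2 (Y.al (g x))" using Y.vert_sg[OF r(2)] by simp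
      moreover have "Y.first (Y.ph (g x)) \<in> vert M2 (Y.ph (g x))" using Y.first_vert[of "Y.ph (g x)"] gx by simp
      then have "vert M2 (Y.first (Y.ph (g x))) = vert M2 (Y.ph (g x))"
        using Y.vert_eq_iff[of "Y.ph (g x)"] gx by simp
      ultimately have "vert M2 (g (X.nh (X.al x))) \<in> vert M2 ` Y.R" using 1 r by (metis imageI)
      then show False using Y.outer_vert_iff inner by blast
    qed
    have gax: "g (X.al x) \<in> Y.H - Y.A" using gH[of "X.al x"] ax by blast
    have "Y.nh (Y.al (g x)) = Y.first (Y.ph (g x))" using Y.nh_eq[of "Y.al (g x)"] gx by (simp add: Y.sg_al)
    also have "\<dots> = Y.nh (g (X.al x))" using 1 gnh[OF ax(1)] by simp
    finally have al: "Y.al (g x) = g (X.al x)"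
      by (rule nh_inj[rotated 2]) (use gx t gax in simp_all)
    have "Y.sg (g x) = Y.ph (Y.al (g x))" using gx by (simp add: Y.ph_al)
    also have "\<dots> = g (X.sg x)" using al gph[OF ax(2,3)] x by (simp add: X.ph_al)
    finally have "Y.first (g x) = Y.first (g (X.sg x))" using Y.first_tail[OF gx(1) t] by simp
    moreover have "X.first x = X.first (X.sg x)" by (rule X.first_tail[OF x(1,3)])
    ultimately show ?case using t F[of "X.sg x"] X.sg_notin_R[OF x(1,3)] x by auto
  qed
  \<comment> \<open>Tails go to tails, and on both sides the tails off the root-face are as many as
    the inner heads, which \<open>g\<close> matches. So the inclusion is an equality, and the
    unmatched buds correspond as well.\<close>
  have "g ` (X.D - X.R - X.H) \<subseteq> Y.D - Y.R - Y.H"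
  proof (rule image_subsetI)
    fix x assume "x \<in> X.D - X.R - X.H"
    then have x: "x \<in> X.D" "x \<notin> X.R" "\<not> head M1 x" by simp_all
    show "g x \<in> Y.D - Y.R - Y.H" using gD[of x] conjunct1[OF tail[OF x]] x by simp
  qed
  moreover have "card (g ` (X.D - X.R - X.H)) = card (Y.D - Y.R - Y.H)"
  proof -
    have "card (g ` (X.D - X.R - X.H)) = card (X.D - X.R - X.H)"
      by (rule card_image[OF inj_on_subset[OF inj Diff_subset]])
    moreover have "card (g ` (X.H - X.A)) = card (X.H - X.A)"
      by (rule card_image[OF inj_on_subset[OF inj order_trans[OF Diff_subset X.H_A(2)]]])
    moreover have "g ` (X.H - X.A) = Y.H - Y.A"
    proof
      show "g ` (X.H - X.A) \<subseteq> Y.H - Y.A"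
      proof (rule image_subsetI)
        fix x assume x: "x \<in> X.H - X.A"
        then have "x \<in> X.D - X.R" using X.H_A(2) by blast
        then show "g x \<in> Y.H - Y.A" using gH x by blast
      qed
      show "Y.H - Y.A \<subseteq> g ` (X.H - X.A)"
      proof
        fix y assume y: "y \<in> Y.H - Y.A"
        then have "y \<in> Y.D - Y.R" using Y.H_A(2) by blast
        then have "y \<in> g ` (X.D - X.R)" unfolding img .
        then obtain x where x: "x \<in> X.D - X.R" "y = g x" by (rule imageE)
        then have "x \<in> X.H - X.A" using gH[OF x(1)] y by (simp only:)
        then show "y \<in> g ` (X.H - X.A)" unfolding x(2) by (rule imageI)
      qed
    qed
    ultimately show ?thesis using X.inner_card Y.inner_card by simp
  qed
  moreover have "finite (Y.D - Y.R - Y.H)" using Y.fin by simp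
  ultimately have gI: "g ` (X.D - X.R - X.H) = Y.D - Y.R - Y.H" by (rule card_subset_eq[rotated])
  have gA: "g b \<in> Y.A \<longleftrightarrow> b \<in> X.A" if b: "b \<in> X.D - X.R" for b
  proof -
    have 1: "g b \<in> Y.D - Y.R - Y.H \<longleftrightarrow> b \<in> X.D - X.R - X.H"
      unfolding gI[symmetric] by (rule inj_on_image_mem_iff[OF inj b Diff_subset])
    have "g b \<in> Y.A \<longleftrightarrow> g b \<notin> Y.H - Y.A \<and> g b \<notin> Y.D - Y.R - Y.H" using gD[OF b] Y.H_A(1) by blast
    also have "\<dots> \<longleftrightarrow> b \<notin> X.H - X.A \<and> b \<notin> X.D - X.R - X.H" using gH[OF b] 1 by blast
    also have "\<dots> \<longleftrightarrow> b \<in> X.A" using b X.H_A(1) by blast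
    finally show ?thesis .
  qed
  have "amob_iso g (X.D - X.R) X.H X.nh X.bl (Y.D - Y.R) Y.H Y.nh Y.bl"
    unfolding amob_iso_def
  proof (intro conjI ballI)
    show "g b \<in> Y.H \<longleftrightarrow> b \<in> X.H" if b: "b \<in> X.D - X.R" for b
      using gA[OF b] gH[OF b] X.H_A(1) Y.H_A(1) by blast
    show "g (X.nh h) = Y.nh (g h)" if h: "h \<in> X.H" for h
    proof (cases "h \<in> X.A")
      case True
      then have "g h \<in> Y.A" using gA X.H_A h by blast
      then show ?thesis using True X.leaf Y.leaf by simp
    qed (use gnh h in blast)
  qed (use g gbl in auto)
  then show ?thesis by (rule fro_iso_of_amob_iso[OF X.cw_fro_axioms Y.cw_fro_axioms])
qed

section \<open>Surjectivity and the main theorem\<close>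

text \<open>One step of the contour walk around the tree, restricted to black darts.\<close>

definition contour :: "'a set \<Rightarrow> ('a \<Rightarrow> 'a) \<Rightarrow> ('a \<Rightarrow> 'a) \<Rightarrow> 'a \<Rightarrow> 'a" where
  "contour H om bl y = bl (if y \<in> H then om y else y)"

lemma bij_contour:
  assumes "bij_betw om H H" "bij_betw bl B B" "H \<subseteq> B"
  shows "bij_betw (contour H om bl) B B"
proof -
  let ?w = "\<lambda>y. if y \<in> H then om y else y"
  have "bij_betw ?w H H" using assms(1) bij_betw_cong[of H ?w om] by simp
  moreover have "bij_betw ?w (B - H) (B - H)" by (rule bij_betw_involution) simp
  ultimately have "bij_betw ?w (H \<union> (B - H)) (H \<union> (B - H))" by (rule bij_betw_combine) blast
  then have "bij_betw ?w B B" using assms(3) by (simp add: Un_absorb1)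
  from bij_betw_trans[OF this assms(2)] show ?thesis
    using bij_betw_cong[of B "contour H om bl" "bl \<circ> ?w" B] by (simp add: contour_def)
qed

context represented
begin

text \<open>Euler's inequality leaves a tree at most one face. A step of \<open>contour\<close> is
  one step of the face walk at a bud and two steps at an edge, one to the white end of the next edge
  and one back to a black vertex.\<close>

lemma orb_contour:
  assumes "is_pb_mobile T" "x \<in> B"
  shows "orb (contour H om bl) x = B"
proof -
  let ?k = "contour H om bl"
  define f where "f = s \<circ> a"
  have f: "f d = s (a d)" for d by (simp add: f_def)
  have HB': "H \<subseteq> B" using HB by blast
  have bij_k: "bij_betw ?k B B" by (rule bij_contour[OF bij_om bij_bl HB'])
  have ne: "mdarts T \<noteq> {}" using e_in(1)[OF assms(2)] by blast
  have c: "connected_darts (mdarts T) a s" "card (orb s ` mdarts T) = num_edges T + 1"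
    using assms(1) by (simp_all add: is_pb_mobile_iff)
  have "card (orb s ` mdarts T) + card (orb f ` mdarts T) \<le> num_edges T + 2"
    unfolding num_edges_def f_def by (rule euler_inequality[OF fin ne bij_s _ c(1)]) simp
  then have le: "card (orb f ` mdarts T) \<le> 1" using c(2) by simp
  have "bij_betw a (mdarts T) (mdarts T)" by (rule bij_betw_involution) simp
  then have bij_f: "bij_betw f (mdarts T) (mdarts T)" unfolding f_def by (rule bij_betw_trans[OF _ bij_s])
  have black: "y \<in> orb ?k z" if "z \<in> B" "y \<in> B" "(f ^^ n) (e z) = e y" for n y z
    using that
  proof (induction n arbitrary: z rule: less_induct)
    case (less n)
    show ?case
    proof (cases n)
      case 0
      then have "z = y" using less.prems inj_e by (simp add: inj_on_def)
      then show ?thesis by simp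
    next
      case (Suc p)
      have kz: "?k z \<in> B" using bij_betwE[OF bij_k] less.prems(1) by blast
      have sub: "orb ?k (?k z) \<subseteq> orb ?k z" by (rule orb_subset_orb[OF orb_step[OF orb_self]])
      have p: "(f ^^ p) (f (e z)) = e y" using less.prems(3) unfolding Suc by (simp only: funpow_Suc_right comp_apply)
      show ?thesis
      proof (cases "z \<in> H")
        case False
        then have "a (e z) = e z" using less.prems(1) unfolding H_def by blast
        then have "f (e z) = e (?k z)" using bl(2)[OF less.prems(1)] False by (simp add: contour_def f)
        then have "(f ^^ p) (e (?k z)) = e y" using p by (simp only:)
        then have "y \<in> orb ?k (?k z)" by (rule less.IH[OF _ kz less.prems(2), rotated]) (simp add: Suc)
        then show ?thesis using sub by blast
      next
        case True
        have oz: "om z \<in> H" "om z \<in> B" using om(1)[OF True] HB by auto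
        have f1: "f (e z) = a (e (om z))" using om(2)[OF True] by (simp add: f)
        have "p \<noteq> 0"
        proof
          assume "p = 0"
          then have "a (e (om z)) = e y" using p f1 by simp
          then show False using ae[OF oz(1)] e_in(2)[OF less.prems(2)] by simp
        qed
        then obtain q where q: "p = Suc q" by (cases p) auto
        have "(f ^^ q) (f (a (e (om z)))) = e y"
          using p unfolding f1 q by (simp only: funpow_Suc_right comp_apply)
        moreover have "f (a (e (om z))) = e (?k z)"
          using e_in(1)[OF oz(2)] bl(2)[OF oz(2)] True by (simp add: contour_def f)
        ultimately have "(f ^^ q) (e (?k z)) = e y" by (simp only:)
        then have "y \<in> orb ?k (?k z)" by (rule less.IH[OF _ kz less.prems(2), rotated]) (simp add: Suc q)
        then show ?thesis using sub by blast
      qed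
    qed
  qed
  have "y \<in> orb ?k x" if y: "y \<in> B" for y
  proof -
    have "orb f (e x) = orb f (e y)"
    proof (rule ccontr)
      assume "orb f (e x) \<noteq> orb f (e y)"
      then have "card {orb f (e x), orb f (e y)} = 2" by simp
      moreover have "{orb f (e x), orb f (e y)} \<subseteq> orb f ` mdarts T"
        using e_in(1)[OF assms(2)] e_in(1)[OF y] by simp
      then have "card {orb f (e x), orb f (e y)} \<le> card (orb f ` mdarts T)"
        using fin by (intro card_mono) simp_all
      ultimately show False using le by linarith
    qed
    then have "e y \<in> orb f (e x)" using orb_self[of "e y" f] by simp
    then obtain n where "(f ^^ n) (e x) = e y" by (auto simp: orb_def)
    then show ?thesis by (rule black[OF assms(2) y])
  qed
  moreover have "orb ?k x \<subseteq> B" by (rule orb_closed[OF bij_k assms(2)])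
  ultimately show ?thesis by blast
qed

end

text \<open>Buds are scarcer than edges, so they are the opening parentheses. The contour is read
  backwards, so that blocks proceed by \<open>ph\<close> as required by
  \<open>closure\<close>.\<close>

lemma Phi_plus_surj:
  fixes T :: "'m mobile"
  assumes T: "is_pb_mobile T" and ex: "excess T > 0"
  shows "\<exists>M :: nat fro. cw_fro M \<and> mobile_iso (Phi_plus M) T"
proof -
  have pre: "premob T" using T is_pb_mobile_iff by blast
  then obtain N H om bl e where rep: "rep T {..<N :: nat} H om bl e" using ex_nat_rep by blast
  define B where "B = {..<N}"
  interpret T: represented T B H om bl e by (rule represented.intro[OF pre]) (simp add: rep B_def)
  have HB: "H \<subseteq> B" using T.HB by blast
  have am: "amob B H om bl" using T T.is_pb_mobile_iff_amob by simp
  have finB: "finite B" by (simp add: B_def)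
  let ?I = "B - H" and ?k = "contour H om bl"
  have card: "card ?I < card H" using ex T.excess_eq by simp
  define ph where "ph = inv_into B bl"
  have ph: "ph y \<in> B" "bl (ph y) = y" if "y \<in> B" for y
    using T.bij_bl that unfolding ph_def bij_betw_def by (metis inv_into_into, metis f_inv_into_f)
  \<comment> \<open>The inverse of the white part of a contour step; it does nothing at
    buds.\<close>
  define wi where "wi z = (if z \<in> H then inv_into H om z else z)" for z
  have wi: "wi z \<in> B" "(if wi z \<in> H then om (wi z) else wi z) = z" "wi z \<in> H \<longleftrightarrow> z \<in> H" if "z \<in> B" for z
  proof -
    have "inv_into H om z \<in> H" "om (inv_into H om z) = z" if "z \<in> H"
      using T.bij_om that unfolding bij_betw_def by (metis inv_into_into, metis f_inv_into_f)
    then show "wi z \<in> B" "(if wi z \<in> H then om (wi z) else wi z) = z" "wi z \<in> H \<longleftrightarrow> z \<in> H"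
      using that HB by (auto simp: wi_def)
  qed
  define f where "f y = wi (ph y)" for y
  have bij_k: "bij_betw ?k B B" by (rule bij_contour[OF T.bij_om T.bij_bl HB])
  have kf: "f y \<in> B \<and> ?k (f y) = y" if "y \<in> B" for y
    using wi[of "ph y"] ph[OF that] by (simp add: f_def contour_def)
  have "inj_on f B" by (rule inj_on_inverseI[of _ ?k]) (use kf in blast)
  moreover have "f ` B \<subseteq> B" using kf by blast
  ultimately have bij_f: "bij_betw f B B" using endo_inj_surj[OF finB] by (simp add: bij_betw_def)
  have cyc: "orb f x = B" if "x \<in> B" for x
    using orb_inverse[OF finB bij_k kf that] T.orb_contour[OF T that] by simp
  have BI: "B - ?I = H" using HB by blast
  have "card ?I < card (B - ?I)" using card BI by simp
  from cyclic_matching[OF finB bij_f cyc Diff_subset this]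
  obtain mt m where match: "block_matching f B ?I mt m" by blast
  have mt: "inj_on mt ?I" "mt ` ?I \<subseteq> B - ?I"
    and chain: "\<And>x. x \<in> ?I \<Longrightarrow> \<exists>k. ((\<lambda>z. f (mt z)) ^^ k) (f x) = mt x \<and>
       (\<forall>j<k. ((\<lambda>z. f (mt z)) ^^ j) (f x) \<in> ?I \<and> m (((\<lambda>z. f (mt z)) ^^ j) (f x)) < m x)"
    by (fact block_matchingD[OF match])+
  have mtH: "mt i \<in> H" if "i \<in> ?I" for i using mt(2) that unfolding BI by blast
  let ?J = "\<lambda>z. f (mt z)" and ?s = "\<lambda>z. ph (mt z)"
  have c: "\<exists>k. (?s ^^ k) (ph i) = om (mt i) \<and> (\<forall>j<k. (?s ^^ j) (ph i) \<in> ?I \<and> m ((?s ^^ j) (ph i)) < m i)"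
    if i: "i \<in> ?I" for i
  proof -
    obtain k where k: "(?J ^^ k) (f i) = mt i" "\<And>j. j < k \<Longrightarrow> (?J ^^ j) (f i) \<in> ?I"
      "\<And>j. j < k \<Longrightarrow> m ((?J ^^ j) (f i)) < m i" using chain[OF i] by blast
    define y where "y j = (?J ^^ j) (f i)" for j
    define z where "z j = (?s ^^ j) (ph i)" for j
    have y0: "y 0 = wi (ph i)" and ySuc: "y (Suc j) = wi (ph (mt (y j)))"
      and z0: "z 0 = ph i" and zSuc: "z (Suc j) = ph (mt (z j))" for j
      by (simp_all add: y_def z_def f_def)
    have yI: "y j \<in> ?I" and ym: "m (y j) < m i" if "j < k" for j
      unfolding y_def by (fact k(2)[OF that], fact k(3)[OF that])
    have iB: "i \<in> B" using i by blast
    \<comment> \<open>Before the end of the chain only buds occur, where \<open>wi\<close> is the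
      identity, so the backward contour agrees with the rotation chain. At the end \<open>wi\<close>
      undoes \<open>om\<close>.\<close>
    have st: "y j = wi (z j) \<and> z j \<in> B" if "j \<le> k" for j
      using that
    proof (induction j)
      case 0
      then show ?case using y0 z0 ph(1)[OF iB] by simp
    next
      case (Suc j)
      then have IH: "y j = wi (z j)" "z j \<in> B" and j: "j < k" by simp_all
      have "z j \<notin> H" using wi(3)[OF IH(2)] yI[OF j] IH(1) by simp
      then have zy: "z j = y j" using IH(1) by (simp add: wi_def)
      have "mt (z j) \<in> B" using mtH[OF yI[OF j]] HB unfolding zy by blast
      then show ?case using ySuc[of j] zSuc[of j] zy ph(1) by simp
    qed
    have zy: "z j = y j" if "j < k" for j
    proof -
      have s: "y j = wi (z j)" "z j \<in> B" using st[of j] that by simp_all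
      then have "z j \<notin> H" using wi(3)[OF s(2)] yI[OF that] by simp
      then show ?thesis using s(1) by (simp add: wi_def)
    qed
    have zk: "wi (z k) = mt i" "z k \<in> B" using st[of k] k(1) by (simp_all add: y_def)
    then have "om (mt i) = z k" using wi(2)[OF zk(2)] mtH[OF i] by simp
    moreover have "z j \<in> ?I \<and> m (z j) < m i" if "j < k" for j
      unfolding zy[OF that] by (intro conjI yI[OF that] ym[OF that])
    ultimately have "z k = om (mt i) \<and> (\<forall>j<k. z j \<in> ?I \<and> m (z j) < m i)" by simp
    then show ?thesis unfolding z_def by (rule exI[of _ k])
  qed
  interpret C: closure B H om bl mt m N
  proof
    show "amob B H om bl" by (rule am)
    show "b < N" if "b \<in> B" for b using that by (simp add: B_def)
    show "inj_on mt (B - H)" "card (B - H) < card H" by (fact mt(1), fact card)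
    show "mt i \<in> H" if "i \<in> B - H" for i by (rule mtH[OF that])
    show "\<exists>k. ((\<lambda>z. inv_into B bl (mt z)) ^^ k) (inv_into B bl i) = om (mt i) \<and>
        (\<forall>j<k. ((\<lambda>z. inv_into B bl (mt z)) ^^ j) (inv_into B bl i) \<in> B - H \<and>
               m (((\<lambda>z. inv_into B bl (mt z)) ^^ j) (inv_into B bl i)) < m i)"
      if "i \<in> B - H" for i
      using c[OF that] unfolding ph_def .
  qed
  obtain M :: "nat fro" where M_def: "M = C.M" by blast
  have M: "cw_fro M" "darts M - root_face M = B" "{d \<in> darts M. head M d} = H"
    "\<And>h. h \<in> H \<Longrightarrow> next_in (\<lambda>d. d \<in> {d \<in> darts M. head M d}) (sigma M) h = om h"
    "\<And>b. b \<in> B \<Longrightarrow> phi_inv M b = bl b"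
    unfolding M_def by (fact C.cw_fro_M C.M_black C.M_heads C.M_white_rotation C.M_black_rotation)+
  interpret M: cw_fro M by (rule M(1))
  have "amob_iso id (M.D - M.R) M.H M.nh M.bl B H om bl"
    unfolding amob_iso_def M(2,3) using M(4,5) by (auto simp: M(3))
  then have "mobile_iso (Phi_plus M) T"
    using mobile_iso_iff[OF M.Phi_plus_rep T.represented_axioms] by blast
  then show ?thesis using M(1) by blast
qed

text \<open>Here edges are scarcer and open along the forward contour. The unmatched buds are
  completed to edges with white leaves, which yields a mobile of positive excess whose unmatched
  edges are exactly the added ones; hence the result is admissible.\<close>

lemma Phi_minus_surj:
  fixes T :: "'m mobile"
  assumes T: "is_pb_mobile T" and ex: "excess T < 0"
  shows "\<exists>M :: nat fro. adm_fro M \<and> mobile_iso (Phi_minus M) T"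
proof -
  have pre: "premob T" using T is_pb_mobile_iff by blast
  then obtain N H' om' bl e where rep: "rep T {..<N :: nat} H' om' bl e" using ex_nat_rep by blast
  define B where "B = {..<N}"
  interpret T: represented T B H' om' bl e by (rule represented.intro[OF pre]) (simp add: rep B_def)
  have HB: "H' \<subseteq> B" using T.HB by blast
  have finB: "finite B" by (simp add: B_def)
  let ?Y = "B - H'" and ?k = "contour H' om' bl"
  have card: "card H' < card ?Y" using ex T.excess_eq by simp
  define ph where "ph = inv_into B bl"
  have ph_bl: "ph (bl y) = y" if "y \<in> B" for y
    using T.bij_bl that unfolding ph_def by (rule bij_betw_inv_into_left)
  have bij_k: "bij_betw ?k B B" by (rule bij_contour[OF T.bij_om T.bij_bl HB])
  obtain mu m where match: "block_matching ?k B H' mu m"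
    using cyclic_matching[OF finB bij_k T.orb_contour[OF T] HB card] by blast
  have mu: "inj_on mu H'" "mu ` H' \<subseteq> ?Y"
    and chain: "\<And>x. x \<in> H' \<Longrightarrow> \<exists>k. ((\<lambda>z. ?k (mu z)) ^^ k) (?k x) = mu x \<and>
       (\<forall>j<k. ((\<lambda>z. ?k (mu z)) ^^ j) (?k x) \<in> H' \<and> m (((\<lambda>z. ?k (mu z)) ^^ j) (?k x)) < m x)"
    by (fact block_matchingD[OF match])+
  define I where "I = mu ` H'"
  define A where "A = ?Y - I"
  define H where "H = H' \<union> A"
  \<comment> \<open>An added edge ends in a white leaf, which is a fixed point of the
    rotation.\<close>
  define om where "om h = (if h \<in> H' then om' h else h)" for h
  define mt where "mt = inv_into H' mu"
  have mt_mu: "mt (mu h) = h" if "h \<in> H'" for h using mu(1) that by (simp add: mt_def)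
  have BI: "B - H = I" using mu(2) HB by (auto simp: H_def A_def I_def)
  have HH: "H - A = H'" "A \<subseteq> H" "H \<subseteq> B" using HB by (auto simp: H_def A_def)
  have "rep T B H' om bl e" using T.rep by (rule rep_cong) (simp add: om_def)
  then interpret T': represented T B H' om bl e by (rule represented.intro[OF pre])
  have "amob B H' om bl" using T T'.is_pb_mobile_iff_amob by simp
  moreover have "om a = a" if "a \<in> A" for a using that HB by (auto simp: om_def A_def)
  ultimately have am: "amob B H om bl"
    using amob_remove_leaves[of A H om B bl] HH finB by simp
  have cI: "card I = card H'" unfolding I_def by (rule card_image[OF mu(1)])
  have "I \<subseteq> ?Y" "finite ?Y" "finite H'" using mu(2) finB HB finite_subset by (auto simp: I_def)
  then have "card A = card ?Y - card I" "H' \<inter> A = {}" "finite A"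
    using finB by (auto simp: A_def card_Diff_subset finite_subset)
  then have "card H = card H' + card A" "card A > 0"
    using card cI \<open>finite H'\<close> by (simp_all add: H_def card_Un_disjoint)
  then have card': "card I < card H" using cI by simp
  let ?J = "\<lambda>z. ?k (mu z)" and ?s = "\<lambda>z. ph (mt z)"
  have kmu: "?k (mu y) = bl (mu y)" if "y \<in> H'" for y using mu(2) that by (auto simp: contour_def)
  have muB: "mu y \<in> B" if "y \<in> H'" for y using mu(2) that by blast
  have c: "\<exists>k. (?s ^^ k) (ph i) = om (mt i) \<and>
      (\<forall>j<k. (?s ^^ j) (ph i) \<in> I \<and> (m \<circ> mt) ((?s ^^ j) (ph i)) < (m \<circ> mt) i)"
    if i: "i \<in> I" for i
  proof -
    obtain h where h: "h \<in> H'" "i = mu h" using i by (auto simp: I_def)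
    obtain k where k: "(?J ^^ k) (?k h) = mu h" "\<And>j. j < k \<Longrightarrow> (?J ^^ j) (?k h) \<in> H'"
      "\<And>j. j < k \<Longrightarrow> m ((?J ^^ j) (?k h)) < m h" using chain[OF h(1)] by blast
    define y where "y j = (?J ^^ j) (?k h)" for j
    have yk: "y k = i" using k(1) h(2) by (simp add: y_def)
    have yH: "y j \<in> H'" if "j < k" for j using k(2)[OF that] by (simp add: y_def)
    have y0: "ph (y 0) = om' h"
      using ph_bl[of "om' h"] T.om(1)[OF h(1)] T.HB h(1) by (simp add: y_def contour_def)
    have ySuc: "ph (y (Suc j)) = mu (y j)" if "j < k" for j
      using kmu[OF yH[OF that]] ph_bl[OF muB[OF yH[OF that]]] by (simp add: y_def)
    \<comment> \<open>The block chain read backwards: \<open>ph\<close> undoes \<open>bl\<close> and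
      \<open>mt\<close> undoes \<open>mu\<close>, so the chain that led from \<open>h\<close> to its
      bud now leads from the bud to \<open>om' h\<close>.\<close>
    have st: "(?s ^^ j) (ph i) = ph (y (k - j))" if "j \<le> k" for j
      using that
    proof (induction j)
      case 0
      then show ?case using yk by simp
    next
      case (Suc j)
      define p where "p = k - Suc j"
      have p: "k - j = Suc p" "p < k" using Suc.prems by (auto simp: p_def)
      have "(?s ^^ j) (ph i) = mu (y p)" using Suc p ySuc[OF p(2)] by simp
      then show ?case using mt_mu[OF yH[OF p(2)]] by (simp add: p_def)
    qed
    have "mt i = h" using mt_mu h by simp
    then have "(?s ^^ k) (ph i) = om (mt i)" using st[of k] y0 h(1) by (simp add: om_def)
    moreover have "(?s ^^ j) (ph i) \<in> I \<and> (m \<circ> mt) ((?s ^^ j) (ph i)) < (m \<circ> mt) i" if "j < k" for j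
    proof -
      define p where "p = k - Suc j"
      have p: "k - j = Suc p" "p < k" using that by (auto simp: p_def)
      have "(?s ^^ j) (ph i) = mu (y p)" using st[of j] that p ySuc[OF p(2)] by simp
      moreover have "m (y p) < m h" using k(3)[OF p(2)] by (simp add: y_def)
      ultimately show ?thesis using yH[OF p(2)] mt_mu \<open>mt i = h\<close> by (simp add: I_def)
    qed
    ultimately show ?thesis by blast
  qed
  have mtI: "mt i \<in> H'" if "i \<in> I" for i using that mt_mu by (auto simp: I_def)
  have inj_mt: "inj_on mt I" unfolding mt_def I_def by (rule inj_on_inv_into) simp
  interpret C: closure B H om bl mt "m \<circ> mt" N
  proof
    show "amob B H om bl" by (rule am)
    show "b < N" if "b \<in> B" for b using that by (simp add: B_def)
    show "inj_on mt (B - H)" "card (B - H) < card H" unfolding BI by (fact inj_mt, fact card')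
    show "mt i \<in> H" if "i \<in> B - H" for i
    proof -
      have "mt i \<in> H'" using that by (intro mtI) (simp only: BI)
      then show ?thesis by (simp add: H_def)
    qed
    show "\<exists>k. ((\<lambda>z. inv_into B bl (mt z)) ^^ k) (inv_into B bl i) = om (mt i) \<and>
        (\<forall>j<k. ((\<lambda>z. inv_into B bl (mt z)) ^^ j) (inv_into B bl i) \<in> B - H \<and>
               (m \<circ> mt) (((\<lambda>z. inv_into B bl (mt z)) ^^ j) (inv_into B bl i)) < (m \<circ> mt) i)"
      if "i \<in> B - H" for i
      using c[of i] that unfolding BI ph_def by blast
  qed
  obtain M :: "nat fro" where M_def: "M = C.M" by blast
  have M: "cw_fro M" "darts M - root_face M = B" "{d \<in> darts M. head M d} = H"
    "\<And>h. h \<in> H \<Longrightarrow> next_in (\<lambda>d. d \<in> {d \<in> darts M. head M d}) (sigma M) h = om h"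
    "\<And>b. b \<in> B \<Longrightarrow> phi_inv M b = bl b" "alpha M ` root_face M = H - mt ` (B - H)"
    unfolding M_def by (fact C.cw_fro_M C.M_black C.M_heads C.M_white_rotation C.M_black_rotation C.M_outer)+
  interpret M: cw_fro M by (rule M(1))
  have "mt ` I = H'" using mtI mt_mu by (force simp: I_def)
  then have MA: "M.A = A" using M(6) BI by (auto simp: H_def A_def)
  have "admissible M"
  proof (rule M.admissibleI)
    fix a assume "a \<in> M.A"
    then have a: "a \<in> A" by (simp only: MA)
    then have "om a = a" using HB by (auto simp: om_def A_def)
    moreover have "a \<in> H" using a HH by blast
    ultimately show "M.nh a = a" using M(4) by simp
  qed
  then interpret M': adm_fro M by unfold_locales
  have "amob_iso id (M.D - M.R) (M.H - M.A) M.nh M.bl B H' om' bl"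
    unfolding amob_iso_def M(2)
  proof (intro conjI ballI)
    have HA: "M.H - M.A = H'" using MA HH(1) M(3) by (simp only:)
    show "id b \<in> H' \<longleftrightarrow> b \<in> M.H - M.A" for b unfolding HA by simp
    show "id (M.nh h) = om' (id h)" if "h \<in> M.H - M.A" for h
    proof -
      have "h \<in> H'" using that HA by (simp only:)
      moreover have "h \<in> H" using calculation by (simp add: H_def)
      ultimately show ?thesis using M(4)[of h] by (simp add: om_def)
    qed
  qed (use M(5) in simp_all)
  then have "mobile_iso (Phi_minus M) T"
    using mobile_iso_iff[OF M'.Phi_minus_rep T.represented_axioms] by blast
  then show ?thesis using M'.adm_fro_axioms by blast
qed

lemma calO_adm_iff: "M \<in> calO_adm \<longleftrightarrow> adm_fro M"
  unfolding calO_adm_def adm_fro_def adm_fro_axioms_def by (simp add: calO_iff)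

theorem theorem8:
  shows
  "((\<forall>M \<in> (calO :: nat fro set). is_pb_mobile (Phi_plus M) \<and> excess (Phi_plus M) > 0 \<and>
        int (outer_degree M) = excess (Phi_plus M)) \<and>
    (\<forall>M1 \<in> (calO :: nat fro set). \<forall>M2 \<in> (calO :: nat fro set).
        fro_iso M1 M2 \<longleftrightarrow> mobile_iso (Phi_plus M1) (Phi_plus M2)) \<and>
    (\<forall>T :: 'm mobile. is_pb_mobile T \<and> excess T > 0 \<longrightarrow>
        (\<exists>M \<in> (calO :: nat fro set). mobile_iso (Phi_plus M) T)))
   \<and>
   ((\<forall>M \<in> (calO_adm :: nat fro set). is_pb_mobile (Phi_minus M) \<and> excess (Phi_minus M) < 0 \<and>
        int (outer_degree M) = - excess (Phi_minus M)) \<and>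
    (\<forall>M1 \<in> (calO_adm :: nat fro set). \<forall>M2 \<in> (calO_adm :: nat fro set).
        fro_iso M1 M2 \<longleftrightarrow> mobile_iso (Phi_minus M1) (Phi_minus M2)) \<and>
    (\<forall>T :: 'm mobile. is_pb_mobile T \<and> excess T < 0 \<longrightarrow>
        (\<exists>M \<in> (calO_adm :: nat fro set). mobile_iso (Phi_minus M) T)))"
proof (intro conjI ballI allI impI)
  fix M :: "nat fro" assume "M \<in> calO"
  then interpret cw_fro M by (simp add: calO_iff)
  show "is_pb_mobile (Phi_plus M)" "excess (Phi_plus M) > 0" "int (outer_degree M) = excess (Phi_plus M)"
    using Phi_plus_mobile by simp_all
next
  fix M1 M2 :: "nat fro" assume "M1 \<in> calO" "M2 \<in> calO"
  then have c: "cw_fro M1" "cw_fro M2" by (simp_all add: calO_iff)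
  show "fro_iso M1 M2 \<longleftrightarrow> mobile_iso (Phi_plus M1) (Phi_plus M2)"
    unfolding mobile_iso_iff[OF cw_fro.Phi_plus_rep[OF c(1)] cw_fro.Phi_plus_rep[OF c(2)]]
    using amob_iso_of_fro_iso[OF c] fro_iso_of_amob_iso[OF c] by blast
next
  fix T :: "'m mobile" assume "is_pb_mobile T \<and> excess T > 0"
  then show "\<exists>M \<in> (calO :: nat fro set). mobile_iso (Phi_plus M) T"
    using Phi_plus_surj[of T] by (auto simp: calO_iff)
next
  fix M :: "nat fro" assume "M \<in> calO_adm"
  then interpret adm_fro M by (simp add: calO_adm_iff)
  show "is_pb_mobile (Phi_minus M)" "excess (Phi_minus M) < 0" "int (outer_degree M) = - excess (Phi_minus M)"
    using Phi_minus_mobile Phi_plus_mobile(3) by simp_all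
next
  fix M1 M2 :: "nat fro" assume "M1 \<in> calO_adm" "M2 \<in> calO_adm"
  then have c: "adm_fro M1" "adm_fro M2" by (simp_all add: calO_adm_iff)
  interpret X: adm_fro M1 by (rule c(1))
  interpret Y: adm_fro M2 by (rule c(2))
  have "\<exists>g. amob_iso g (X.D - X.R) (X.H - X.A) X.nh X.bl (Y.D - Y.R) (Y.H - Y.A) Y.nh Y.bl"
    if iso: "fro_iso M1 M2"
  proof -
    obtain g where g: "amob_iso g (X.D - X.R) X.H X.nh X.bl (Y.D - Y.R) Y.H Y.nh Y.bl"
      and A: "\<And>b. b \<in> X.D \<Longrightarrow> Y.al (g b) \<in> Y.R \<longleftrightarrow> X.al b \<in> X.R"
      using amob_iso_of_fro_iso[OF X.cw_fro_axioms Y.cw_fro_axioms iso] by blast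
    have "g b \<in> Y.H - Y.A \<longleftrightarrow> b \<in> X.H - X.A" if b: "b \<in> X.D - X.R" for b
    proof -
      have "g b \<in> Y.H \<longleftrightarrow> b \<in> X.H" using g b unfolding amob_iso_def by blast
      moreover have "g b \<in> Y.D" using g b bij_betwE unfolding amob_iso_def by blast
      then have "g b \<in> Y.A \<longleftrightarrow> b \<in> X.A" using A[of b] Y.A_iff[of "g b"] X.A_iff[of b] b by simp
      ultimately show ?thesis by blast
    qed
    then have "amob_iso g (X.D - X.R) (X.H - X.A) X.nh X.bl (Y.D - Y.R) (Y.H - Y.A) Y.nh Y.bl"
      using g unfolding amob_iso_def by blast
    then show ?thesis by blast
  qed
  then show "fro_iso M1 M2 \<longleftrightarrow> mobile_iso (Phi_minus M1) (Phi_minus M2)"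
    unfolding mobile_iso_iff[OF X.Phi_minus_rep Y.Phi_minus_rep]
    using fro_iso_of_amob_iso_minus[OF c] by blast
next
  fix T :: "'m mobile" assume "is_pb_mobile T \<and> excess T < 0"
  then show "\<exists>M \<in> (calO_adm :: nat fro set). mobile_iso (Phi_minus M) T"
    using Phi_minus_surj[of T] by (auto simp: calO_adm_iff)
qed

end
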